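(* Let $n_1,n_2,n_3\ge0$ be integers, let $a,b,c\in\mathbb C$ be nonzero with $a^2+b^2+c^2=0$, and let $l_1,l_2,l_3\in\mathbb C$ satisfy $$a^2(2l_1+1)=\pm b^2(2l_2+1)=\pm c^2(2l_3+1)$$ (for some choice of signs). On $V=\mathbb C^{n_1}\oplus\mathbb C^{n_2}\oplus\mathbb C^{n_3}$, with Cartesian coordinates $x_i$, $x_i'$, $x_i''$ on the three summands, consider \begin{align*} L_{\mathcal A}&=\Delta_1+\frac{b^2c^2}{a^4}\sum_{i<j,\pm}\frac{2}{(x_i\pm x_j)^2}-\sum_i\frac{l_1(l_1+1)}{x_i^2}+a^2\sum_{i,j,\pm}\frac{2}{(bx_i'\pm cx_j'')^2}\\ &+\Delta_2+\frac{a^2c^2}{b^4}\sum_{i<j,\pm}\frac{2}{(x_i'\pm x_j')^2}-\sum_i\frac{l_2(l_2+1)}{(x_i')^2}+b^2\sum_{i,j,\pm}\frac{2}{(ax_i\pm cx_j'')^2}\\ &+\Delta_3+\frac{a^2b^2}{c^4}\sum_{i<j,\pm}\frac{2}{(x_i''\pm x_j'')^2}-\sum_i\frac{l_3(l_3+1)}{(x_i'')^2}+c^2\sum_{i,j,\pm}\frac{2}{(ax_i\pm bx_j')^2}, \end{align*} and for $d=1,2,\dots$ put $L_d=\frac1{2^{2d}(2d)!}\,\mathrm{ad}_{L_{\mathcal A}}^{2d}(p_d)$, where $$p_d=a^{2d-2}\sum_{i=1}^{n_1}x_i^{2d}+b^{2d-2}\sum_{i=1}^{n_2}(x_i')^{2d}+c^{2d-2}\sum_{i=1}^{n_3}(x_i'')^{2d}.$$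 Then $[L_{d_1},L_{d_2}]=0$ for all $d_1,d_2\ge1$. Moreover, $L_1=L_{\mathcal A}$.
   Context: $\Delta_1,\Delta_2,\Delta_3$ are the standard Laplacians in the coordinates $x_i$, $x_i'$, $x_i''$ respectively; indices range over $1,\dots,n_1$ for $x_i$, $1,\dots,n_2$ for $x'_i$, $1,\dots,n_3$ for $x''_i$. A subscript $\pm$ in a sum means summation over both signs. $\mathrm{ad}_L(m)=Lm-mL$, and $p_d$ is regarded as a multiplication operator. *)

theory Defs
  imports Complex_Main "HOL-Library.Poly_Mapping" "HOL-Computational_Algebra.Fraction_Field"
begin

text \<open>
  Differential operators with rational coefficients are treated as endomorphisms of a field of
  rational functions. They act faithfully on it, so an identity between such operators is the same
  as the identity of the corresponding endomorphisms.

  Monomials are exponent vectors \<open>nat \<Rightarrow>\<^sub>0 nat\<close>. Only finitely many of the countably many variables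
  occur in any given element; \<open>rat_functions N\<close> below is the field in the first \<open>N\<close> variables.
\<close>

type_synonym cpoly = "(nat \<Rightarrow>\<^sub>0 nat) \<Rightarrow>\<^sub>0 complex"
type_synonym crat = "cpoly fract"

definition poly_vars :: "cpoly \<Rightarrow> nat set" where
  "poly_vars p = (\<Union>m \<in> Poly_Mapping.keys p. Poly_Mapping.keys m)"

definition Const :: "complex \<Rightarrow> crat" where
  "Const c = Fract (Poly_Mapping.single 0 c) 1"

definition Var :: "nat \<Rightarrow> crat" where
  "Var v = Fract (Poly_Mapping.single (Poly_Mapping.single v 1) 1) 1"

definition rat_functions :: "nat \<Rightarrow> crat set" where
  "rat_functions N =
     {Fract p q | p q. q \<noteq> 0 \<and> poly_vars p \<subseteq> {..<N} \<and> poly_vars q \<subseteq> {..<N}}"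

subsection \<open>Partial derivatives\<close>

text \<open>The coefficient of \<open>x\<^sup>m\<close> in \<open>\<partial>p / \<partial>x\<^sub>v\<close> is \<open>m\<^sub>v + 1\<close> times that of \<open>x\<^sub>v x\<^sup>m\<close> in \<open>p\<close>.\<close>

lift_definition poly_deriv :: "nat \<Rightarrow> cpoly \<Rightarrow> cpoly" is
  "\<lambda>v p m. of_nat (Suc (Poly_Mapping.lookup m v)) * p (m + Poly_Mapping.single v 1)"
proof -
  fix v :: nat and p :: "(nat \<Rightarrow>\<^sub>0 nat) \<Rightarrow> complex"
  assume fin: "finite {m. p m \<noteq> 0}"
  have "inj (\<lambda>m. m + Poly_Mapping.single v (1::nat))"
    by (simp add: inj_def)
  with fin have "finite ((\<lambda>m. m + Poly_Mapping.single v 1) -` {m. p m \<noteq> 0})"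
    by (rule finite_vimageI)
  then show "finite {m. of_nat (Suc (Poly_Mapping.lookup m v)) * p (m + Poly_Mapping.single v 1) \<noteq> 0}"
    by (rule rev_finite_subset) auto
qed

lemma poly_deriv_0 [simp]: "poly_deriv v 0 = 0"
  by (rule poly_mapping_eqI) (simp add: poly_deriv.rep_eq)

lemma poly_deriv_add: "poly_deriv v (p + q) = poly_deriv v p + poly_deriv v q"
  by (rule poly_mapping_eqI) (simp add: poly_deriv.rep_eq lookup_add distrib_left)

lemma poly_deriv_single:
  "poly_deriv v (Poly_Mapping.single m c) =
     Poly_Mapping.single (m - Poly_Mapping.single v 1) (of_nat (Poly_Mapping.lookup m v) * c)"
proof (rule poly_mapping_eqI)
  fix k
  let ?e = "Poly_Mapping.single v (1::nat)"
  show "Poly_Mapping.lookup (poly_deriv v (Poly_Mapping.single m c)) k =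
    Poly_Mapping.lookup (Poly_Mapping.single (m - ?e) (of_nat (Poly_Mapping.lookup m v) * c)) k"
  proof (cases "Poly_Mapping.lookup m v = 0")
    case True
    then have "m \<noteq> k + ?e"
      by (metis add_is_0 lookup_add lookup_single_eq one_neq_zero)
    with True show ?thesis
      by (simp add: poly_deriv.rep_eq lookup_single_not_eq)
  next
    case False
    have "m - ?e + ?e = m"
      using False by (intro poly_mapping_eqI) (auto simp: lookup_add lookup_minus lookup_single when_def)
    then have "m = k + ?e \<longleftrightarrow> m - ?e = k"
      by (metis add_diff_cancel_right')
    with False show ?thesis
      by (auto simp: poly_deriv.rep_eq lookup_single when_def lookup_minus simp del: of_nat_Suc)
  qed
qed

lemma cpoly_induct [case_names zero add]:
  assumes "P 0" and "\<And>p m c. P p \<Longrightarrow> P (p + Poly_Mapping.single m c)"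
  shows "P (p :: cpoly)"
proof (induction p rule: update_induct)
  case const
  show ?case by (rule assms(1))
next
  case (update p m c)
  have "Poly_Mapping.update m c p = p + Poly_Mapping.single m c"
    using update by (intro poly_mapping_eqI)
      (auto simp: lookup_update lookup_add lookup_single when_def in_keys_iff)
  with update assms(2) show ?case by simp
qed

lemma poly_deriv_mult_single:
  "poly_deriv v (Poly_Mapping.single m c * Poly_Mapping.single n d) =
     poly_deriv v (Poly_Mapping.single m c) * Poly_Mapping.single n d
     + Poly_Mapping.single m c * poly_deriv v (Poly_Mapping.single n d)"
proof -
  let ?e = "Poly_Mapping.single v (1::nat)"
  have 1: "m - ?e + n = m + n - ?e" if "Poly_Mapping.lookup m v \<noteq> 0"
    using that by (intro poly_mapping_eqI) (auto simp: lookup_add lookup_minus lookup_single when_def)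
  have 2: "m + (n - ?e) = m + n - ?e" if "Poly_Mapping.lookup n v \<noteq> 0"
    using that by (intro poly_mapping_eqI) (auto simp: lookup_add lookup_minus lookup_single when_def)
  show ?thesis
    using 1 2
    by (cases "Poly_Mapping.lookup m v = 0"; cases "Poly_Mapping.lookup n v = 0")
      (simp_all add: poly_deriv_single mult_single lookup_add single_add [symmetric] algebra_simps)
qed

lemma poly_deriv_mult:
  "poly_deriv v (p * q) = poly_deriv v p * q + p * poly_deriv v q"
proof (induction p rule: cpoly_induct)
  case (add p m c)
  have "poly_deriv v (Poly_Mapping.single m c * q) =
    poly_deriv v (Poly_Mapping.single m c) * q + Poly_Mapping.single m c * poly_deriv v q"
    by (induction q rule: cpoly_induct)
      (simp_all add: distrib_left poly_deriv_add poly_deriv_mult_single algebra_simps)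
  with add show ?case
    by (simp add: distrib_right poly_deriv_add algebra_simps)
qed simp

lift_definition rat_deriv :: "nat \<Rightarrow> crat \<Rightarrow> crat" is
  "\<lambda>v (p, q). (poly_deriv v p * q - p * poly_deriv v q, q\<^sup>2)"
proof -
  fix v and x y :: "cpoly \<times> cpoly"
  assume xy: "fractrel x y"
  obtain p q where x: "x = (p, q)" by (cases x)
  obtain r s where y: "y = (r, s)" by (cases y)
  have nz: "q \<noteq> 0" "s \<noteq> 0" and eq: "p * s = r * q"
    using xy by (auto simp: x y)
  have "poly_deriv v p * s + p * poly_deriv v s = poly_deriv v r * q + r * poly_deriv v q"
    using arg_cong [OF eq, of "poly_deriv v"] by (simp add: poly_deriv_mult)
  with eq have "(poly_deriv v p * q - p * poly_deriv v q) * s\<^sup>2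
      = (poly_deriv v r * s - r * poly_deriv v s) * q\<^sup>2"
    by algebra
  with nz show "fractrel
      (case x of (p, q) \<Rightarrow> (poly_deriv v p * q - p * poly_deriv v q, q\<^sup>2))
      (case y of (p, q) \<Rightarrow> (poly_deriv v p * q - p * poly_deriv v q, q\<^sup>2))"
    by (simp add: x y)
qed

lemma rat_deriv_Fract:
  "q \<noteq> 0 \<Longrightarrow> rat_deriv v (Fract p q) = Fract (poly_deriv v p * q - p * poly_deriv v q) (q\<^sup>2)"
  by transfer simp

lemma rat_deriv_Const [simp]: "rat_deriv v (Const c) = 0"
proof -
  have "poly_deriv v (Poly_Mapping.single 0 c) = 0" for c
    by (simp add: poly_deriv_single)
  from this [of c] this [of 1] show ?thesis
    by (simp add: Const_def rat_deriv_Fract Zero_fract_def)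
qed

lemma rat_deriv_Var: "rat_deriv v (Var w) = (if v = w then 1 else 0)"
proof -
  have "poly_deriv v 1 = 0"
    using poly_deriv_single [of v 0 1] by simp
  then show ?thesis
    by (auto simp: Var_def rat_deriv_Fract poly_deriv_single lookup_single when_def
        Zero_fract_def One_fract_def)
qed

lemma rat_deriv_add: "rat_deriv v (f + g) = rat_deriv v f + rat_deriv v g"
proof (cases f)
  case f: (Fract p q)
  show ?thesis
  proof (cases g)
    case g: (Fract r s)
    show ?thesis
      using f g
      by (simp add: rat_deriv_Fract eq_fract poly_deriv_add poly_deriv_mult)
        (simp add: algebra_simps power2_eq_square)
  qed
qed

lemma rat_deriv_mult: "rat_deriv v (f * g) = rat_deriv v f * g + f * rat_deriv v g"
proof (cases f)
  case f: (Fract p q)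
  show ?thesis
  proof (cases g)
    case g: (Fract r s)
    show ?thesis
      using f g
      by (simp add: rat_deriv_Fract eq_fract poly_deriv_mult)
        (simp add: algebra_simps power2_eq_square)
  qed
qed

subsection \<open>Operators\<close>

definition mult_op :: "crat \<Rightarrow> crat \<Rightarrow> crat" where
  "mult_op g = (\<lambda>f. g * f)"

text \<open>The commutator \<open>[L, M] = LM - ML\<close>.\<close>

definition ad :: "(crat \<Rightarrow> crat) \<Rightarrow> (crat \<Rightarrow> crat) \<Rightarrow> (crat \<Rightarrow> crat)" where
  "ad L M = (\<lambda>f. L (M f) - M (L f))"

definition laplacian :: "nat set \<Rightarrow> crat \<Rightarrow> crat" where
  "laplacian I f = (\<Sum>v\<in>I. rat_deriv v (rat_deriv v f))"

text \<open>
  The coordinates on the three summands are consecutive blocks of variables: \<open>x\<^sub>i\<close>, \<open>x'\<^sub>i\<close>, \<open>x''\<^sub>i\<close>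
  are the variables \<open>i\<close>, \<open>n1 + i\<close>, \<open>n1 + n2 + i\<close>, with \<open>i\<close> counted from \<open>0\<close>. The sums over
  \<open>s \<in> {1, -1}\<close> are the sums over both signs.
\<close>

definition LA :: "nat \<Rightarrow> nat \<Rightarrow> nat \<Rightarrow> complex \<Rightarrow> complex \<Rightarrow> complex \<Rightarrow>
    complex \<Rightarrow> complex \<Rightarrow> complex \<Rightarrow> crat \<Rightarrow> crat" where
  "LA n1 n2 n3 a b c l1 l2 l3 f =
    (let x = (\<lambda>i. Var i); x' = (\<lambda>i. Var (n1 + i)); x'' = (\<lambda>i. Var (n1 + n2 + i)) in
      laplacian {..<n1} f
      + (Const (b\<^sup>2 * c\<^sup>2 / a ^ 4) * (\<Sum>j<n1. \<Sum>i<j. \<Sum>s\<in>{1, -1}. 2 / (x i + s * x j)\<^sup>2)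
         - (\<Sum>i<n1. Const (l1 * (l1 + 1)) / (x i)\<^sup>2)
         + Const (a\<^sup>2) * (\<Sum>i<n2. \<Sum>j<n3. \<Sum>s\<in>{1, -1}.
             2 / (Const b * x' i + s * Const c * x'' j)\<^sup>2)) * f
      + laplacian {n1..<n1 + n2} f
      + (Const (a\<^sup>2 * c\<^sup>2 / b ^ 4) * (\<Sum>j<n2. \<Sum>i<j. \<Sum>s\<in>{1, -1}. 2 / (x' i + s * x' j)\<^sup>2)
         - (\<Sum>i<n2. Const (l2 * (l2 + 1)) / (x' i)\<^sup>2)
         + Const (b\<^sup>2) * (\<Sum>i<n1. \<Sum>j<n3. \<Sum>s\<in>{1, -1}.
             2 / (Const a * x i + s * Const c * x'' j)\<^sup>2)) * f
      + laplacian {n1 + n2..<n1 + n2 + n3} f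
      + (Const (a\<^sup>2 * b\<^sup>2 / c ^ 4) * (\<Sum>j<n3. \<Sum>i<j. \<Sum>s\<in>{1, -1}. 2 / (x'' i + s * x'' j)\<^sup>2)
         - (\<Sum>i<n3. Const (l3 * (l3 + 1)) / (x'' i)\<^sup>2)
         + Const (c\<^sup>2) * (\<Sum>i<n1. \<Sum>j<n2. \<Sum>s\<in>{1, -1}.
             2 / (Const a * x i + s * Const b * x' j)\<^sup>2)) * f)"

text \<open>Only used for \<open>d \<ge> 1\<close>, so the natural subtraction is not truncated.\<close>

definition p_poly :: "nat \<Rightarrow> nat \<Rightarrow> nat \<Rightarrow> complex \<Rightarrow> complex \<Rightarrow> complex \<Rightarrow> nat \<Rightarrow> crat" where
  "p_poly n1 n2 n3 a b c d =
     Const (a ^ (2 * d - 2)) * (\<Sum>i<n1. Var i ^ (2 * d))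
     + Const (b ^ (2 * d - 2)) * (\<Sum>i<n2. Var (n1 + i) ^ (2 * d))
     + Const (c ^ (2 * d - 2)) * (\<Sum>i<n3. Var (n1 + n2 + i) ^ (2 * d))"

definition Ld :: "nat \<Rightarrow> nat \<Rightarrow> nat \<Rightarrow> complex \<Rightarrow> complex \<Rightarrow> complex \<Rightarrow>
    complex \<Rightarrow> complex \<Rightarrow> complex \<Rightarrow> nat \<Rightarrow> crat \<Rightarrow> crat" where
  "Ld n1 n2 n3 a b c l1 l2 l3 d f =
     Const (1 / (2 ^ (2 * d) * fact (2 * d))) *
       ((ad (LA n1 n2 n3 a b c l1 l2 l3) ^^ (2 * d)) (mult_op (p_poly n1 n2 n3 a b c d))) f"

end

theory Submission
  imports Defs "HOL-Computational_Algebra.Factorial_Ring"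
begin

text \<open>
  Write \<open>u = a x\<^sub>i\<close>, \<open>b x'\<^sub>i\<close>, \<open>c x''\<^sub>i\<close> and give these particles the masses \<open>a\<^sup>2\<close>, \<open>b\<^sup>2\<close>, \<open>c\<^sup>2\<close>. Then every
  pair potential has the coupling \<open>a\<^sup>2 b\<^sup>2 c\<^sup>2 / (m m')\<close>, and \<open>p\<^sub>d\<close> is the sum of \<open>u\<^sup>2\<^sup>d / m\<close>. Since the \<open>p\<^sub>d\<close>
  commute, it is enough to show \<open>F = ad\<^sub>L\<^bsup>2d+1\<^esup>(p\<^sub>d) = 0\<close>: the Leibniz rule for \<open>ad\<^sub>L\<close> then expresses the
  commutator of \<open>ad\<^sub>L\<^bsup>2d\<^esup>(p\<^sub>d)\<close> and \<open>ad\<^sub>L\<^bsup>2e\<^esup>(p\<^sub>e)\<close> through \<open>ad\<^sub>L\<^bsup>2d+2e\<^esup>([p\<^sub>d, p\<^sub>e]) = 0\<close>.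

  \<open>F\<close> has order at most \<open>2d + 1\<close> and degree \<open>-2d - 2\<close>, so the coefficients of its principal symbol have
  negative degree. They vanish if they are polynomials, that is, if they have no pole along any of the
  hyperplanes. Along a hyperplane \<open>u = 0\<close>, or \<open>u = \<plusminus>u'\<close> with equal masses, \<open>L\<close> is invariant under the
  reflection, and \<open>L\<close> and \<open>p\<^sub>d\<close> generate operators with regular symbols, as Dunkl operators do. Along
  \<open>u = \<plusminus>u'\<close> with distinct masses the singular part is \<open>-2/x\<^sup>2\<close>, and the relation between the masses and
  the \<open>l\<^sub>i\<close> makes \<open>L\<close> and \<open>p\<^sub>d\<close> preserve the functions \<open>x\<^sup>-\<^sup>1 f\<close> with \<open>f\<close> regular and \<open>\<partial>f/\<partial>x = 0\<close> at
  \<open>x = 0\<close>; an operator that does so has a regular symbol.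
\<close>

section \<open>Commutators and derivations of rings\<close>

text \<open>The exponent \<open>2d + 1\<close> is the least that works: the symbol of
  \<open>ad^k(p_d)\<close>, taken in order \<open>k\<close>, has coefficients of degree
  \<open>2d - k\<close>. Vanishing of one symbol only lowers the order, so the argument has to be
  repeated down to order zero, and at every stage the next symbol must again be free of poles. Only
  symbols can be expected to be regular; lower coefficients, such as the potential in
  \<open>L\<close> itself, do have poles. For this reason coefficients are never written down: order
  and symbol are read off from iterated commutators with coordinates. The obstacle at walls and at
  equal masses is that the coupling is an arbitrary complex number. The natural space of functions
  there is \<open>x^\<kappa>\<close> times the even functions, which leaves the field of rational
  functions when \<kappa> is not an integer. It is replaced by an abstract ring of operators with a
  basis adapted to the order. For distinct masses the exponent is the integer -1, so an actual space
  of functions is available.\<close>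

definition com :: "'a::ring \<Rightarrow> 'a \<Rightarrow> 'a" where
  "com x y = x * y - y * x"

lemma com_add_left: "com (x + y) z = com x z + com y z"
  and com_add_right: "com x (y + z) = com x y + com x z"
  and com_diff_left: "com (x - y) z = com x z - com y z"
  and com_diff_right: "com x (y - z) = com x y - com x z"
  and com_mult_left: "com (x * y) z = com x z * y + x * com y z"
  and com_mult_right: "com x (y * z) = com x y * z + y * com x z"
  by (simp_all add: com_def algebra_simps)

lemma com_zero [simp]: "com x 0 = 0" "com 0 x = 0"
  by (simp_all add: com_def)

lemma com_one [simp]: "com x (1::'a::ring_1) = 0" "com (1::'a) x = 0"
  by (simp_all add: com_def)

lemma com_sum_left: "com (\<Sum>i\<in>I. f i) z = (\<Sum>i\<in>I. com (f i) z)"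
  by (simp add: com_def sum_distrib_left sum_distrib_right sum_subtractf)

lemma com_jacobi: "com x (com y z) = com (com x y) z + com y (com x z)"
  by (simp add: com_def algebra_simps)

lemma com_eq_0_iff: "com x y = 0 \<longleftrightarrow> x * y = y * x"
  by (simp add: com_def)

lemma com_funpow_commute:
  assumes "com z x = 0" "com z y = 0"
  shows "com z ((com x ^^ n) y) = 0"
  using assms by (induction n) (simp_all add: com_jacobi [of z])

locale ring_derivation =
  fixes D :: "'a::ring_1 \<Rightarrow> 'a"
  assumes add: "D (x + y) = D x + D y"
    and mult: "D (x * y) = D x * y + x * D y"
begin

lemma zero [simp]: "D 0 = 0"
  using add [of 0 0] by simp

lemma one [simp]: "D 1 = 0"
  using mult [of 1 1] by simp

lemma sum: "D (\<Sum>i\<in>I. f i) = (\<Sum>i\<in>I. D (f i))"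
  by (induction I rule: infinite_finite_induct) (simp_all add: add)

lemma of_nat [simp]: "D (of_nat n) = 0"
  by (induction n) (simp_all add: add)

lemma numeral [simp]: "D (numeral n) = 0"
  using of_nat [of "numeral n"] by simp

lemma funpow_zero [simp]: "(D ^^ n) 0 = 0"
  by (induction n) simp_all

lemma funpow_add: "(D ^^ n) (x + y) = (D ^^ n) x + (D ^^ n) y"
  by (induction n) (simp_all add: add)

lemma funpow_sum: "(D ^^ n) (\<Sum>i\<in>I. f i) = (\<Sum>i\<in>I. (D ^^ n) (f i))"
  by (induction n) (simp_all add: sum)

lemma funpow_vanish_mono:
  assumes "(D ^^ m) x = 0" "m \<le> n"
  shows "(D ^^ n) x = 0"
proof -
  have "(D ^^ (n - m + m)) x = 0"
    using assms(1) by (simp only: funpow_add comp_def Nat.funpow_add) simp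
  with assms(2) show ?thesis by simp
qed

lemma funpow_mult_left:
  assumes "D x = 0"
  shows "(D ^^ n) (x * y) = x * (D ^^ n) y"
  using assms by (induction n) (simp_all add: mult)

text \<open>In the Leibniz sum only the term survives in which each factor is differentiated as
  often as its nilpotency allows. With \<open>D\<close> the commutator with \<open>L\<close> this
  yields the commuting flows; with \<open>D\<close> the commutator with a function it says that
  symbols multiply.\<close>

lemma funpow_mult_top:
  assumes "(D ^^ Suc m) x = 0" "(D ^^ Suc n) y = 0"
  shows "(D ^^ (m + n)) (x * y) = of_nat ((m + n) choose m) * ((D ^^ m) x * (D ^^ n) y)
    \<and> (D ^^ Suc (m + n)) (x * y) = 0"
  using assms
proof (induction "m + n" arbitrary: m n x y)
  case 0
  then show ?case by (simp add: mult)
next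
  case (Suc s)
  have step: "(D ^^ Suc k) (x * y) = (D ^^ k) (D x * y) + (D ^^ k) (x * D y)" for k
    by (simp only: funpow_Suc_right comp_def mult funpow_add)
  \<comment> \<open>The case \<open>m = 0\<close> is kept apart because \<open>m - 1\<close> is
    truncated; there already \<open>D x = 0\<close>. The two contributions are then added by
    Pascal's rule.\<close>
  have 1: "(D ^^ s) (D x * y) = (if m = 0 then 0 else of_nat (s choose (m - 1)) * ((D ^^ m) x * (D ^^ n) y))
     \<and> (D ^^ Suc s) (D x * y) = 0"
  proof (cases m)
    case 0
    with Suc.prems(1) have "D x = 0" by simp
    with 0 show ?thesis by (simp del: funpow.simps(2))
  next
    case (Suc m')
    with Suc.hyps(2) have "s = m' + n" by simp
    moreover have "(D ^^ Suc m') (D x) = 0"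
      using Suc.prems(1) by (simp only: Suc funpow_Suc_right comp_def)
    ultimately show ?thesis
      using Suc.hyps(1) [of m' n "D x" y] Suc.prems(2)
      by (simp only: Suc funpow_Suc_right comp_def) simp
  qed
  have 2: "(D ^^ s) (x * D y) = (if n = 0 then 0 else of_nat (s choose m) * ((D ^^ m) x * (D ^^ n) y))
     \<and> (D ^^ Suc s) (x * D y) = 0"
  proof (cases n)
    case 0
    with Suc.prems(2) have "D y = 0" by simp
    with 0 show ?thesis by (simp del: funpow.simps(2))
  next
    case (Suc n')
    with Suc.hyps(2) have "s = m + n'" by simp
    moreover have "(D ^^ Suc n') (D y) = 0"
      using Suc.prems(2) by (simp only: Suc funpow_Suc_right comp_def)
    ultimately show ?thesis
      using Suc.hyps(1) [of m n' x "D y"] Suc.prems(1)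
      by (simp only: Suc funpow_Suc_right comp_def) simp
  qed
  have "(D ^^ Suc s) (x * y) = of_nat (Suc s choose m) * ((D ^^ m) x * (D ^^ n) y)"
  proof (cases "m = 0 \<or> n = 0")
    case True
    with 1 2 Suc.hyps(2) show ?thesis
      unfolding step by auto
  next
    case False
    then obtain m' where "m = Suc m'" by (cases m) auto
    with 1 2 False show ?thesis
      unfolding step by (simp add: distrib_right)
  qed
  with 1 2 show ?case
    unfolding Suc.hyps(2) [symmetric] step [of "Suc s"] by (simp del: funpow.simps(2))
qed

end

lemma ring_derivation_com: "ring_derivation (com x)"
  by unfold_locales (simp_all add: com_add_right com_mult_right)

lemma ring_derivation_com_left: "ring_derivation (\<lambda>y. com y x)"
  by unfold_locales (simp_all add: com_add_left com_mult_left)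

text \<open>The products \<open>x * y\<close> and \<open>y * x\<close> agree, hence so do their top
  derivatives, which are the two products of the top derivatives with the same binomial coefficient.
  The coefficient stays in the statement because the ring may have torsion.\<close>

lemma com_ad_nilpotent:
  fixes x y z :: "'a::ring_1"
  assumes "com x y = 0" and "(com z ^^ Suc m) x = 0" and "(com z ^^ Suc n) y = 0"
  shows "of_nat ((m + n) choose m) * com ((com z ^^ m) x) ((com z ^^ n) y) = 0"
proof -
  interpret ring_derivation "com z" by (rule ring_derivation_com)
  have "(com z ^^ (m + n)) (x * y) = (com z ^^ (m + n)) (y * x)"
    using assms(1) by (simp add: com_eq_0_iff)
  moreover have "(n + m) choose n = (m + n) choose m"
    using binomial_symmetric [of n "n + m"] by (simp add: add.commute)
  ultimately show ?thesis
    using funpow_mult_top [OF assms(2,3)] funpow_mult_top [OF assms(3,2)]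
    by (simp add: com_def right_diff_distrib add.commute)
qed

section \<open>An even Calogero--Moser operator in one variable over a ring of coefficients\<close>

text \<open>\<open>A\<close> models operators that are tangential to the hyperplane
  \<open>l = 0\<close> and even under its reflection; \<open>Y\<close> models the conjugate of the
  normal derivative by \<open>l^\<kappa>\<close>. Parity is encoded in \<open>A_Y\<close>: the
  normal derivative of an even object is odd, that is, \<open>l\<close> times an even one.\<close>

locale even_calculus =
  fixes l li Y c :: "'a::ring_1" and A :: "'a set"
  assumes l_li: "l * li = 1" "li * l = 1"
    and Y_l: "Y * l = l * Y + 1"
    and c_comm: "c * l = l * c" "c * Y = Y * c" "x \<in> A \<Longrightarrow> c * x = x * c"
    and A_one: "1 \<in> A" and A_add: "x \<in> A \<Longrightarrow> y \<in> A \<Longrightarrow> x + y \<in> A"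
    and A_minus: "x \<in> A \<Longrightarrow> - x \<in> A"
    and A_mult: "x \<in> A \<Longrightarrow> y \<in> A \<Longrightarrow> x * y \<in> A"
    and c_in: "c \<in> A" and ll_in: "l * l \<in> A"
    and A_l: "x \<in> A \<Longrightarrow> x * l = l * x"
    and A_Y: "x \<in> A \<Longrightarrow> \<exists>x'\<in>A. Y * x = x * Y + l * x'"
    and torsion_free: "n > 0 \<Longrightarrow> of_nat n * (x :: 'a) = 0 \<Longrightarrow> x = 0"
begin

text \<open>For \<open>l = x\<close>, \<open>Y = d/dx - \<kappa>/x\<close> and \<open>c = 2\<kappa>\<close> the operator \<open>T\<close> is \<open>d\<^sup>2/dx\<^sup>2 - \<kappa>(\<kappa> - 1)/x\<^sup>2\<close>.\<close>

definition Z where "Z = l * Y"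
definition T where "T = Y * Y + c * li * Y"
definition E where "E i = (if even i then 1 else Z) * T ^ (i div 2)"

text \<open>An analogue over \<open>A\<close> of the even part of the rank one Dunkl algebra. With
  coefficients on the left and at most one factor \<open>Z\<close>, closure under products comes
  down to the commutation rules of \<open>Z\<close> and \<open>T\<close> with each other and with
  \<open>A\<close>.\<close>

inductive_set C :: "'a set" where
  zero: "0 \<in> C"
| add: "x \<in> A \<Longrightarrow> y \<in> C \<Longrightarrow> x * E i + y \<in> C"

lemma A_zero: "0 \<in> A"
  using A_add [OF A_one A_minus [OF A_one]] by simp

lemma A_li: "x \<in> A \<Longrightarrow> x * li = li * x"
  by (metis A_l l_li mult.assoc mult_1_left mult_1_right)

lemma c_li: "c * li = li * c"
  using A_li c_in by blast

lemma li_cancel [simp]: "l * (li * x) = x" "li * (l * x) = x"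
  by (simp_all add: l_li flip: mult.assoc)

lemma Y_li: "Y * li = li * Y - li * li"
proof -
  have "Y = l * (Y * li) + li"
    using arg_cong [OF Y_l, of "\<lambda>x. x * li"] by (simp add: mult.assoc distrib_right l_li)
  then have "li * Y = Y * li + li * li"
    by (metis distrib_left li_cancel(2))
  then show ?thesis by simp
qed

lemma Z_A:
  assumes "x \<in> A"
  shows "\<exists>x'\<in>A. Z * x = x * Z + x'"
proof -
  obtain x' where x': "x' \<in> A" "Y * x = x * Y + l * x'"
    using A_Y assms by blast
  have "Z * x = x * Z + l * l * x'"
    using x'(2) A_l [OF assms] by (simp add: Z_def mult.assoc distrib_left) (simp flip: mult.assoc)
  with x'(1) show ?thesis using A_mult ll_in by blast
qed

text \<open>The rule that keeps the number of factors \<open>Z\<close> in a basis element at most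
  one; without it odd and even basis elements would not suffice.\<close>

lemma Z_Z: "Z * Z = l * l * T + (1 - c) * Z"
proof -
  have "Z * Z = l * (Y * l) * Y" by (simp add: Z_def mult.assoc)
  also have "\<dots> = l * l * (Y * Y) + Z"
    by (simp add: Y_l Z_def distrib_left distrib_right mult.assoc)
  also have "l * l * (Y * Y) = l * l * T - c * Z"
  proof -
    have "l * l * T = l * l * (Y * Y) + l * (l * li) * (c * Y)"
      by (simp add: T_def distrib_left mult.assoc c_li)
    also have "l * (l * li) * (c * Y) = c * Z"
      using c_comm(1) by (simp add: l_li Z_def flip: mult.assoc)
    finally show ?thesis by simp
  qed
  finally show ?thesis by (simp add: algebra_simps)
qed

text \<open>\<open>Z\<close> acts as an Euler operator in the normal direction, and \<open>T\<close>
  is homogeneous of degree -2.\<close>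

lemma T_Z: "T * Z = Z * T + 2 * T"
proof -
  have YYl: "Y * (Y * (l * Y)) = l * (Y * (Y * Y)) + 2 * (Y * Y)"
  proof -
    have *: "Y * (l * x) = l * (Y * x) + x" for x
      using arg_cong [OF Y_l, of "\<lambda>y. y * x"] by (simp add: mult.assoc distrib_right)
    show ?thesis by (simp add: * distrib_left mult_2)
  qed
  have 1: "c * (li * (Y * (l * Y))) = c * (Y * Y) + c * (li * Y)"
    by (simp add: Y_l distrib_left distrib_right flip: mult.assoc) (simp add: distrib_left mult.assoc)
  have 2: "l * (Y * (c * (li * Y))) = c * (Y * Y) - c * (li * Y)"
  proof -
    have "l * (Y * (c * (li * Y))) = c * (l * (Y * li) * Y)"
      by (metis c_comm(1,2) mult.assoc)
    then show ?thesis
      by (simp add: Y_li right_diff_distrib left_diff_distrib mult.assoc)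
  qed
  show ?thesis
    by (simp add: T_def Z_def distrib_left distrib_right mult.assoc YYl 1 2 mult_2) 
qed

text \<open>The second normal derivative meets the odd element \<open>l * x'\<close> and restores
  evenness, while the pole of \<open>c * li\<close> is absorbed by the factor \<open>l\<close> from
  \<open>A_Y\<close>.\<close>

lemma T_A:
  assumes "x \<in> A"
  shows "\<exists>x'\<in>A. \<exists>x''\<in>A. T * x = x * T + x' * Z + x''"
proof -
  obtain x' where x': "x' \<in> A" "Y * x = x * Y + l * x'"
    using A_Y assms by blast
  obtain x'' where x'': "x'' \<in> A" "Y * x' = x' * Y + l * x''"
    using A_Y x' by blast
  have 0: "Y * (l * x') = x' * Z + l * l * x'' + x'"
  proof -
    have "Y * (l * x') = l * (Y * x') + x'"
      by (simp add: Y_l distrib_right flip: mult.assoc)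
    then show ?thesis
      using A_l [OF x'(1)] by (simp add: x'' Z_def distrib_left) (simp flip: mult.assoc)
  qed
  have 1: "Y * Y * x = x * (Y * Y) + 2 * x' * Z + (l * l * x'' + x')"
  proof -
    have "Y * Y * x = Y * (Y * x)" by (simp add: mult.assoc)
    also have "\<dots> = Y * x * Y + Y * (l * x')" by (subst x'(2)) (simp only: distrib_left mult.assoc)
    also have "Y * x * Y = x * (Y * Y) + x' * Z"
      using A_l [OF x'(1)] by (simp add: x' distrib_right Z_def) (simp flip: mult.assoc)
    finally show ?thesis by (simp add: 0 algebra_simps mult_2)
  qed
  have 2: "c * li * Y * x = x * (c * li * Y) + c * x'"
  proof -
    have "c * li * Y * x = c * li * x * Y + c * li * l * x'"
      by (simp add: x' mult.assoc distrib_left)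
    also have "c * li * x = x * (c * li)"
      by (metis A_li assms c_comm(3) mult.assoc)
    finally show ?thesis by (simp add: mult.assoc)
  qed
  have "T * x = x * T + (x' + x') * Z + (l * l * x'' + x' + c * x')"
    by (simp only: T_def distrib_right distrib_left 1 2) (simp add: algebra_simps mult_2)
  with x'(1) x''(1) show ?thesis
    by (intro bexI [of _ "x' + x'"] bexI [of _ "l * l * x'' + x' + c * x'"])
      (auto intro!: A_add A_mult c_in ll_in)
qed

lemma C_add: "x \<in> C \<Longrightarrow> y \<in> C \<Longrightarrow> x + y \<in> C"
  by (induction rule: C.induct) (auto simp: add.assoc intro: C.add)

lemma C_single: "x \<in> A \<Longrightarrow> x * E i \<in> C"
  using C.add [OF _ C.zero, of x i] by simp

lemma C_A: "x \<in> A \<Longrightarrow> x \<in> C"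
  using C_single [of x 0] by (simp add: E_def)

lemma C_T: "T \<in> C"
  using C_single [OF A_one, of 2] by (simp add: E_def)

lemma C_A_mult: "x \<in> A \<Longrightarrow> y \<in> C \<Longrightarrow> x * y \<in> C"
proof (rotate_tac, induction y rule: C.induct)
  case (add z y i)
  then show ?case
    by (simp add: distrib_left C.add A_mult flip: mult.assoc)
qed (simp add: C.zero)

lemma E_T: "E i * T = E (i + 2)"
  by (simp add: E_def mult.assoc power_commutes)

lemma C_mult_T: "y \<in> C \<Longrightarrow> y * T \<in> C"
  by (induction rule: C.induct) (auto simp: distrib_right mult.assoc E_T C.zero intro!: C.add)

lemma C_mult_T_power: "y \<in> C \<Longrightarrow> y * T ^ j \<in> C"
  by (induction j) (auto simp: power_Suc2 C_mult_T simp del: power_Suc simp flip: mult.assoc)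

lemma C_Z: "x \<in> A \<Longrightarrow> x * Z \<in> C"
  using C_single [of x 1] by (simp add: E_def)

lemma C_Z_mult: "y \<in> C \<Longrightarrow> Z * y \<in> C"
proof (induction rule: C.induct)
  case (add x y i)
  obtain x' where x': "x' \<in> A" "Z * x = x * Z + x'"
    using Z_A add by blast
  have "x * Z * (if even i then 1 else Z) \<in> C"
  proof (cases "even i")
    case False
    have "1 + - c \<in> A" by (intro A_add A_one A_minus c_in)
    then have "x * (l * l * T + (1 - c) * Z) \<in> C"
      using add(1) by (intro C_A_mult C_add C_T C_Z ll_in) simp_all
    with False show ?thesis by (simp add: mult.assoc Z_Z)
  qed (use add(1) C_Z in simp)
  from C_mult_T_power [OF this, of "i div 2"] have "x * Z * E i \<in> C"
    by (simp add: E_def mult.assoc)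
  then show ?case
    using add x' by (simp add: distrib_left distrib_right C_add C_single flip: mult.assoc)
qed (simp add: C.zero)

lemma C_T_mult: "y \<in> C \<Longrightarrow> T * y \<in> C"
proof (induction rule: C.induct)
  case (add x y i)
  obtain x' x'' where x': "x' \<in> A" "x'' \<in> A" "T * x = x * T + x' * Z + x''"
    using T_A add by blast
  have "T * (if even i then 1 else Z) \<in> C"
    using C_add [OF C_T C_T] C_mult_T [OF C_Z [OF A_one]]
    by (auto simp: C_T T_Z mult_2 intro!: C_add)
  from C_mult_T_power [OF this, of "i div 2"] have "T * E i \<in> C"
    by (simp add: E_def mult.assoc)
  moreover have "Z * E i \<in> C"
    using C_Z_mult C_single [OF A_one] by simp
  ultimately have "x * (T * E i) + x' * (Z * E i) + x'' * E i \<in> C"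
    using add(1) x'(1,2) by (meson C_add C_A_mult C_single)
  then have "T * (x * E i) \<in> C"
    by (simp add: x'(3) distrib_right mult.assoc flip: mult.assoc [of T x])
  with add show ?case by (simp add: distrib_left C_add)
qed (simp add: C.zero)

lemma C_mult: "x \<in> C \<Longrightarrow> y \<in> C \<Longrightarrow> x * y \<in> C"
proof (induction rule: C.induct)
  case (add x z i)
  have "T ^ j * y \<in> C" for j
    by (induction j) (use add in \<open>auto simp: mult.assoc C_T_mult\<close>)
  then have "x * (E i * y) \<in> C"
    by (intro C_A_mult [OF add(1)]) (simp add: E_def mult.assoc C_Z_mult)
  with add show ?case by (simp add: distrib_right mult.assoc C_add)
qed (simp add: C.zero)

lemma C_minus: "x \<in> C \<Longrightarrow> - x \<in> C"
  using C_A_mult [OF A_minus [OF A_one]] by simp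

lemma C_com: "x \<in> C \<Longrightarrow> y \<in> C \<Longrightarrow> com x y \<in> C"
  using C_add [OF C_mult [of x y] C_minus [OF C_mult [of y x]]] by (simp add: com_def)

lemma C_com_funpow: "x \<in> C \<Longrightarrow> y \<in> C \<Longrightarrow> (com x ^^ n) y \<in> C"
  by (induction n) (auto intro: C_com)

section \<open>The order filtration of \<open>C\<close>, measured by commutators with
  \<open>l\<close>\<close>

sublocale der: ring_derivation "\<lambda>x. com x l"
  by (rule ring_derivation_com_left)

lemma der_A: "x \<in> A \<Longrightarrow> com x l = 0"
  by (simp add: com_eq_0_iff A_l)

lemma der_Z: "com Z l = l"
  by (simp add: com_def Z_def Y_l mult.assoc distrib_left)

lemma der_T: "com T l = 2 * Y + c * li"
proof -
  have "com Y l = 1" "com li l = 0" "com c l = 0"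
    by (simp_all add: com_def Y_l l_li c_comm)
  then show ?thesis
    by (simp add: T_def com_add_left com_mult_left mult_2)
qed

lemma der_T2: "((\<lambda>x. com x l) ^^ 2) T = 2"
proof -
  have "com Y l = 1" "com li l = 0" "com c l = 0" "com 2 l = 0"
    by (simp_all add: com_def Y_l l_li c_comm mult_2 mult_2_right)
  then show ?thesis
    by (simp add: numeral_2_eq_2 der_T com_add_left com_mult_left)
qed

lemma der_T_power:
  "((\<lambda>x. com x l) ^^ (2 * j)) (T ^ j) = of_nat (fact (2 * j)) \<and> ((\<lambda>x. com x l) ^^ Suc (2 * j)) (T ^ j) = 0"
proof (induction j)
  case (Suc j)
  have "((\<lambda>x. com x l) ^^ Suc 2) T = 0"
    by (simp only: funpow.simps(2) comp_def der_T2 der.numeral)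
  note * = der.funpow_mult_top [OF this conjunct2 [OF Suc.IH]]
  have "of_nat ((2 + 2 * j) choose 2) * (2 * of_nat (fact (2 * j))) = (of_nat (fact (2 * Suc j)) :: 'a)"
  proof -
    have "((2 + 2 * j) choose 2) * (2 * fact (2 * j)) = (fact (2 * Suc j) :: nat)"
      using binomial_fact_lemma [of 2 "2 + 2 * j"] by (simp add: numeral_2_eq_2 algebra_simps)
    then show ?thesis by (metis of_nat_mult of_nat_numeral)
  qed
  with * Suc.IH show ?case
    by (simp only: der_T2 power_Suc mult_Suc_right simp_thms)
qed simp

text \<open>\<open>T\<close> has the constant second commutator 2 and \<open>Z\<close> the first
  commutator \<open>l\<close>. Since top commutators multiply, \<open>E i\<close> has order exactly
  \<open>i\<close>, and its symbol shows no trace of the pole of \<open>T\<close>.\<close>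

lemma der_E:
  "((\<lambda>x. com x l) ^^ i) (E i) = of_nat (fact i) * (if even i then 1 else l)
    \<and> ((\<lambda>x. com x l) ^^ Suc i) (E i) = 0"
proof (cases "even i")
  case True
  then have i: "i = 2 * (i div 2)" by simp
  from der_T_power [of "i div 2"] show ?thesis
    unfolding i [symmetric] by (simp add: E_def True)
next
  case False
  then obtain j where i: "i = Suc (2 * j)" by (metis oddE Suc_eq_plus1)
  have "com (com Z l) l = 0" by (simp add: der_Z) (simp add: com_def)
  then have *: "((\<lambda>x. com x l) ^^ Suc 1) Z = 0" by simp
  have E: "E i = Z * T ^ j" by (simp add: E_def i)
  have "of_nat (Suc (2 * j)) * (l * of_nat (fact (2 * j))) = (of_nat (fact i) * l :: 'a)"
    by (simp only: i fact_Suc of_nat_mult mult.assoc mult_of_nat_commute [of "fact (2 * j)" l] of_nat_id)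
  with der.funpow_mult_top [OF * conjunct2 [OF der_T_power], of j] der_T_power [of j] show ?thesis
    unfolding E using der_Z E by (simp del: funpow.simps of_nat_Suc fact_Suc add: i funpow_Suc_right [of 0, simplified])
qed

lemma C_rep:
  assumes "x \<in> C"
  shows "\<exists>n f. range f \<subseteq> A \<and> x = (\<Sum>i<n. f i * E i)"
  using assms
proof (induction rule: C.induct)
  case zero
  show ?case by (intro exI [of _ "0::nat"] exI [of _ "\<lambda>_. 1"]) (simp add: A_one)
next
  case (add x y i)
  then obtain n f where f: "range f \<subseteq> A" "y = (\<Sum>i<n. f i * E i)" by auto
  define g where "g j = (if j < n then f j else 0)" for j
  define h where "h = g(i := x + g i)"
  have "range h \<subseteq> A"
    using f(1) add(1) by (auto simp: h_def g_def A_zero image_subset_iff intro!: A_add)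
  moreover have "x * E i + y = (\<Sum>j<n + Suc i. h j * E j)"
  proof -
    have "y = (\<Sum>j<n + Suc i. g j * E j)"
      unfolding f(2) by (rule sum.mono_neutral_cong_left) (auto simp: g_def)
    moreover have "(\<Sum>j<n + Suc i. h j * E j) = (\<Sum>j<n + Suc i. g j * E j + (if j = i then x * E i else 0))"
      by (rule sum.cong) (auto simp: h_def distrib_right add.commute)
    ultimately show ?thesis by (simp add: sum.distrib)
  qed
  ultimately show ?case by blast
qed

text \<open>The order of an element of \<open>C\<close> as a differential operator equals its degree in the basis \<open>E\<close>, so
  its symbol has no pole, although \<open>T\<close> itself has one.\<close>

lemma C_top_coeff:
  assumes "x \<in> C" "((\<lambda>x. com x l) ^^ Suc a) x = 0"
  shows "((\<lambda>x. com x l) ^^ a) x \<in> A \<union> (\<lambda>y. l * y) ` A"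
proof -
  obtain n f where f: "range f \<subseteq> A" "x = (\<Sum>i<n. f i * E i)"
    using C_rep assms(1) by blast
  have single: "((\<lambda>x. com x l) ^^ k) (f i * E i) = f i * ((\<lambda>x. com x l) ^^ k) (E i)" for k i
    by (rule der.funpow_mult_left) (use f der_A in auto)
  have low: "((\<lambda>x. com x l) ^^ k) (\<Sum>i<k. f i * E i) = 0" for k
  proof -
    have "((\<lambda>x. com x l) ^^ k) (E i) = 0" if "i < k" for i
      using der.funpow_vanish_mono [OF conjunct2 [OF der_E]] that by simp
    then show ?thesis by (simp add: der.funpow_sum single)
  qed
  have top: "((\<lambda>x. com x l) ^^ k) (\<Sum>i<Suc k. f i * E i) = of_nat (fact k) * (f k * (if even k then 1 else l))" for k
    using der_E [of k] by (simp add: der.funpow_add low single mult_of_nat_commute mult.assoc)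
  from f(2) show ?thesis
  proof (induction n)
    case 0
    then show ?case by (simp add: A_zero)
  next
    case (Suc n)
    show ?case
    proof (cases "n \<le> a")
      case True
      show ?thesis
      proof (cases "n = a")
        case n: True
        have nat: "of_nat m * y \<in> A" if "y \<in> A" for m y
          by (induction m) (auto simp: distrib_right A_zero A_add that)
        have "of_nat (fact a) * f a \<in> A" using nat f by blast
        then show ?thesis
          using A_l [of "of_nat (fact a) * f a"] mult.assoc [of "of_nat (fact a)" "f a" l]
          unfolding Suc.prems n top by auto
      next
        case False
        with True have "Suc n \<le> a" by simp
        then show ?thesis
          unfolding Suc.prems using der.funpow_vanish_mono [OF low] A_zero by (simp del: sum.lessThan_Suc)
      qed
    next
      case False
      \<comment> \<open>Beyond the order \<open>a\<close> the \<open>n\<close>-th commutator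
        isolates the leading coefficient and vanishes. Cancelling the factorial and, for odd
        \<open>n\<close>, the invertible \<open>l\<close> removes that coefficient, and the sum gets
        shorter.\<close>
      then have "((\<lambda>x. com x l) ^^ n) x = 0"
        using der.funpow_vanish_mono [OF assms(2)] by simp
      then have "f n * (if even n then 1 else l) = 0"
        using torsion_free [of "fact n"] top [of n] Suc.prems by simp
      then have "f n = 0"
        by (metis (full_types) l_li(1) mult.assoc mult_1_right mult_zero_left)
      then show ?thesis using Suc by simp
    qed
  qed
qed

end

section \<open>Polynomials and rational functions\<close>

instance fract :: ("{idom, ring_char_0}") field_char_0
proof
  show "inj (of_nat :: nat \<Rightarrow> 'a fract)"
    by (rule injI) (simp add: Fract_of_nat_eq [symmetric] eq_fract)
qed

definition pconst :: "complex \<Rightarrow> cpoly" where "pconst c = Poly_Mapping.single 0 c"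
definition pvar :: "nat \<Rightarrow> cpoly" where "pvar v = Poly_Mapping.single (Poly_Mapping.single v 1) 1"

lemma pconst_simps:
  "pconst 0 = 0" "pconst 1 = 1" "pconst (x + y) = pconst x + pconst y"
  "pconst (x * y) = pconst x * pconst y"
  by (simp_all add: pconst_def single_add mult_single)

lemma cpoly_ring_induct [case_names const var add mult]:
  assumes const: "\<And>c. P (pconst c)" and var: "\<And>v. P (pvar v)"
    and add: "\<And>p q. P p \<Longrightarrow> P q \<Longrightarrow> P (p + q)" and mult: "\<And>p q. P p \<Longrightarrow> P q \<Longrightarrow> P (p * q)"
  shows "P p"
proof -
  have power: "P (pvar v ^ k)" for v k
    by (induction k) (use const [of 1] var mult in \<open>auto simp: pconst_simps\<close>)
  have single_power: "Poly_Mapping.single (Poly_Mapping.single v k) 1 = pvar v ^ k" for v k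
  proof (induction k)
    case (Suc k)
    have "Poly_Mapping.single (Poly_Mapping.single v (Suc k)) (1::complex) =
        pvar v * Poly_Mapping.single (Poly_Mapping.single v k) 1"
      by (simp add: pvar_def mult_single flip: single_add)
    with Suc show ?case by simp
  qed simp
  have "P (Poly_Mapping.single m 1)" for m
  proof (induction m rule: update_induct)
    case const
    show ?case using assms(1) [of 1] by (simp add: pconst_simps)
  next
    case (update m v k)
    have "Poly_Mapping.update v k m = m + Poly_Mapping.single v k"
      using update by (intro poly_mapping_eqI)
        (auto simp: lookup_update lookup_add lookup_single when_def in_keys_iff)
    then have "Poly_Mapping.single (Poly_Mapping.update v k m) (1::complex)
        = Poly_Mapping.single m 1 * pvar v ^ k"
      by (simp add: mult_single flip: single_power)
    with update power mult show ?case by simp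
  qed
  then have "P (pconst c * Poly_Mapping.single m 1)" for c m
    using const mult by blast
  then have "P (Poly_Mapping.single m c)" for c m
    by (simp add: pconst_def mult_single)
  then show ?thesis
    using const [of 0] add by (induction p rule: cpoly_induct) (auto simp: pconst_simps)
qed

definition monom_subst :: "(nat \<Rightarrow> cpoly) \<Rightarrow> (nat \<Rightarrow>\<^sub>0 nat) \<Rightarrow> cpoly" where
  "monom_subst g m = (\<Prod>v\<in>Poly_Mapping.keys m. g v ^ Poly_Mapping.lookup m v)"

definition poly_subst :: "(nat \<Rightarrow> cpoly) \<Rightarrow> cpoly \<Rightarrow> cpoly" where
  "poly_subst g p = (\<Sum>m\<in>Poly_Mapping.keys p. pconst (Poly_Mapping.lookup p m) * monom_subst g m)"

lemma monom_subst_superset: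
  assumes "finite S" "Poly_Mapping.keys m \<subseteq> S"
  shows "monom_subst g m = (\<Prod>v\<in>S. g v ^ Poly_Mapping.lookup m v)"
  unfolding monom_subst_def using assms by (intro prod.mono_neutral_left) (auto simp: in_keys_iff)

lemma monom_subst_add: "monom_subst g (m + n) = monom_subst g m * monom_subst g n"
proof -
  let ?S = "Poly_Mapping.keys m \<union> Poly_Mapping.keys n"
  have "Poly_Mapping.keys (m + n) \<subseteq> ?S" by (rule keys_add)
  then show ?thesis
    by (simp add: monom_subst_superset [of ?S] lookup_add power_add prod.distrib)
qed

lemma poly_subst_superset:
  assumes "finite S" "Poly_Mapping.keys p \<subseteq> S"
  shows "poly_subst g p = (\<Sum>m\<in>S. pconst (Poly_Mapping.lookup p m) * monom_subst g m)"
  unfolding poly_subst_def using assms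
  by (intro sum.mono_neutral_left) (auto simp: in_keys_iff pconst_simps)

lemma poly_subst_add: "poly_subst g (p + q) = poly_subst g p + poly_subst g q"
proof -
  let ?S = "Poly_Mapping.keys p \<union> Poly_Mapping.keys q"
  have "Poly_Mapping.keys (p + q) \<subseteq> ?S" by (rule keys_add)
  then show ?thesis
    by (simp add: poly_subst_superset [of ?S] lookup_add pconst_simps distrib_right sum.distrib)
qed

lemma poly_subst_0 [simp]: "poly_subst g 0 = 0"
  by (simp add: poly_subst_def)

lemma poly_subst_single: "poly_subst g (Poly_Mapping.single m c) = pconst c * monom_subst g m"
  by (subst poly_subst_superset [of "{m}"]) auto

lemma poly_subst_mult: "poly_subst g (p * q) = poly_subst g p * poly_subst g q"
proof (induction p rule: cpoly_induct)
  case (add p m c)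
  have "poly_subst g (Poly_Mapping.single m c * q) = poly_subst g (Poly_Mapping.single m c) * poly_subst g q"
    by (induction q rule: cpoly_induct)
      (simp_all add: distrib_left poly_subst_add poly_subst_single mult_single pconst_simps
        monom_subst_add mult_ac)
  with add show ?case by (simp add: distrib_right poly_subst_add)
qed simp

lemma poly_subst_pconst: "poly_subst g (pconst c) = pconst c"
  by (simp add: pconst_def poly_subst_single monom_subst_def)

lemma poly_subst_pvar: "poly_subst g (pvar v) = g v"
  by (simp add: pvar_def poly_subst_single monom_subst_def pconst_simps)

lemma poly_subst_sum: "poly_subst g (\<Sum>i\<in>I. f i) = (\<Sum>i\<in>I. poly_subst g (f i))"
  by (induction I rule: infinite_finite_induct) (simp_all add: poly_subst_add)

text \<open>Solving \<open>q = 0\<close> for the variable \<open>i\<close> gives the substitution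
  \<open>g\<close>, which kills \<open>q\<close> and is the identity modulo \<open>q\<close>. Thus
  the multiples of \<open>q\<close> are the kernel of a ring homomorphism into a domain.\<close>

lemma linear_form_prime:
  fixes h :: "nat \<Rightarrow> complex"
  assumes i: "i < N" "h i \<noteq> 0"
  defines "q \<equiv> \<Sum>v<N. pconst (h v) * pvar v"
  shows "prime_elem q"
proof -
  define g where "g v = (if v = i then pvar v - pconst (1 / h i) * q else pvar v)" for v
  have gq: "poly_subst g q = 0"
  proof -
    have "poly_subst g q = (\<Sum>v<N. pconst (h v) * g v)"
      by (simp add: q_def poly_subst_sum poly_subst_mult poly_subst_pconst poly_subst_pvar)
    also have "\<dots> = (\<Sum>v<N. pconst (h v) * pvar v - (if v = i then q else 0))"
      by (rule sum.cong) (auto simp: g_def right_diff_distrib i pconst_simps [symmetric] simp flip: mult.assoc)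
    also have "\<dots> = q - q"
      using i by (simp add: sum_subtractf q_def)
    finally show ?thesis by simp
  qed
  have "q dvd p - poly_subst g p" for p
  proof (induction p rule: cpoly_ring_induct)
    case (mult p r)
    have "p * r - poly_subst g p * poly_subst g r =
        (p - poly_subst g p) * r + poly_subst g p * (r - poly_subst g r)"
      by (simp add: algebra_simps)
    with mult show ?case by (simp add: poly_subst_mult)
  next
    case (add p r)
    have "p + r - (poly_subst g p + poly_subst g r) = (p - poly_subst g p) + (r - poly_subst g r)"
      by simp
    with add show ?case by (simp only: poly_subst_add dvd_add)
  qed (auto simp: poly_subst_pconst poly_subst_pvar g_def)
  then have iff: "q dvd p \<longleftrightarrow> poly_subst g p = 0" for p
    using gq by (metis diff_zero dvdE mult_zero_left poly_subst_mult)
  have "q \<noteq> 0"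
  proof
    assume "q = 0"
    have "Poly_Mapping.lookup q (Poly_Mapping.single i 1) = h i"
    proof -
      have single_eq: "Poly_Mapping.single v (1::nat) = Poly_Mapping.single i 1 \<Longrightarrow> v = i" for v
        by (metis lookup_single_eq lookup_single_not_eq zero_neq_one)
      have "Poly_Mapping.lookup (pconst (h v) * pvar v) (Poly_Mapping.single i 1) = (if v = i then h i else 0)" for v
        using single_eq [of v] by (auto simp: pconst_def pvar_def mult_single lookup_single when_def)
      then show ?thesis using i by (simp add: q_def lookup_sum)
    qed
    with \<open>q = 0\<close> i show False by simp
  qed
  moreover have "\<not> q dvd 1"
    unfolding iff using poly_subst_pconst [of g 1] by (simp add: pconst_simps)
  ultimately show ?thesis
    by (auto simp: prime_elem_def iff poly_subst_mult)
qed

lemma Fract_sum: "Fract (\<Sum>i\<in>I. g i) (1::'a::idom) = (\<Sum>i\<in>I. Fract (g i) 1)"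
proof (induction I rule: infinite_finite_induct)
  case (insert i I)
  have "Fract (g i + sum g I) 1 = Fract (g i) 1 + Fract (sum g I) (1::'a)" by simp
  with insert show ?case by simp
qed (simp_all add: Zero_fract_def [symmetric])

lemma Const_pconst: "Const c = Fract (pconst c) 1"
  by (simp add: Const_def pconst_def)

lemma Var_pvar: "Var v = Fract (pvar v) 1"
  by (simp add: Var_def pvar_def)

lemma Const_add: "Const (x + y) = Const x + Const y"
  and Const_mult: "Const (x * y) = Const x * Const y"
  and Const_0 [simp]: "Const 0 = 0"
  and Const_1 [simp]: "Const 1 = 1"
  by (simp_all add: Const_pconst pconst_simps Zero_fract_def One_fract_def)

lemma Const_minus: "Const (- x) = - Const x"
  using Const_add [of x "- x"] by (simp add: eq_neg_iff_add_eq_0 add.commute)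

lemma Const_diff: "Const (x - y) = Const x - Const y"
  using Const_add [of x "- y"] by (simp add: Const_minus)

lemma Const_of_nat [simp]: "Const (of_nat n) = of_nat n"
  by (induction n) (simp_all add: Const_add)

lemma Const_numeral [simp]: "Const (numeral n) = numeral n"
  using Const_of_nat [of "numeral n"] by simp

lemma Const_eq_0_iff [simp]: "Const c = 0 \<longleftrightarrow> c = 0"
proof
  assume "Const c = 0"
  then have "pconst c = 0" by (simp add: Const_pconst Zero_fract_def eq_fract)
  then show "c = 0" by (metis lookup_single_eq lookup_zero pconst_def)
qed simp

lemma Const_inverse: "Const (inverse x) = inverse (Const x)"
proof (cases "x = 0")
  case False
  then have "Const (inverse x) * Const x = 1" by (simp flip: Const_mult)
  with False show ?thesis by (simp add: field_simps)
qed simp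

lemma Const_divide: "Const (x / y) = Const x / Const y"
  by (simp add: divide_inverse Const_mult Const_inverse)

lemma Const_power: "Const (x ^ n) = Const x ^ n"
  by (induction n) (simp_all add: Const_mult)

lemmas Const_simps = Const_add Const_mult Const_minus Const_diff Const_inverse Const_divide Const_power

lemma crat_induct [case_names const var add mult inverse]:
  assumes const: "\<And>c. P (Const c)" and var: "\<And>v. P (Var v)"
    and add: "\<And>f g. P f \<Longrightarrow> P g \<Longrightarrow> P (f + g)" and mult: "\<And>f g. P f \<Longrightarrow> P g \<Longrightarrow> P (f * g)"
    and inverse: "\<And>f. P f \<Longrightarrow> f \<noteq> 0 \<Longrightarrow> P (inverse f)"
  shows "P f"
proof -
  have poly: "P (Fract p 1)" for p
  proof (induction p rule: cpoly_ring_induct)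
    case (add p q)
    then show ?case using assms(3) [of "Fract p 1" "Fract q 1"] by simp
  next
    case (mult p q)
    then show ?case using assms(4) [of "Fract p 1" "Fract q 1"] by simp
  qed (use const var in \<open>simp_all add: Const_pconst Var_pvar\<close>)
  show ?thesis
  proof (cases f)
    case (Fract p q)
    have "Fract q 1 \<noteq> 0"
      using Fract(2) by (simp add: Zero_fract_def eq_fract)
    moreover have "f = Fract p 1 * inverse (Fract q 1)"
      using Fract by simp
    ultimately show ?thesis using poly mult inverse by metis
  qed
qed

section \<open>Derivations of the field of rational functions\<close>

definition derivation :: "(crat \<Rightarrow> crat) \<Rightarrow> bool" where
  "derivation D \<longleftrightarrow> (\<forall>f g. D (f + g) = D f + D g) \<and> (\<forall>f g. D (f * g) = D f * g + f * D g)
     \<and> (\<forall>c. D (Const c) = 0)"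

lemma derivationD:
  assumes "derivation D"
  shows derivation_add: "D (f + g) = D f + D g"
    and derivation_mult: "D (f * g) = D f * g + f * D g"
    and derivation_Const: "D (Const c) = 0"
  using assms by (auto simp: derivation_def)

lemma derivation_rat_deriv: "derivation (rat_deriv v)"
  by (simp add: derivation_def rat_deriv_add rat_deriv_mult)

lemma derivation_0: "derivation D \<Longrightarrow> D 0 = 0"
  using derivation_Const [of D 0] by simp

lemma derivation_minus: "derivation D \<Longrightarrow> D (- f) = - D f"
  using derivation_add [of D f "- f"] derivation_0 [of D] by (simp add: eq_neg_iff_add_eq_0 add.commute)

lemma derivation_diff: "derivation D \<Longrightarrow> D (f - g) = D f - D g"
  using derivation_add [of D f "- g"] by (simp add: derivation_minus)

lemma derivation_sum: "derivation D \<Longrightarrow> D (\<Sum>i\<in>I. f i) = (\<Sum>i\<in>I. D (f i))"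
  by (induction I rule: infinite_finite_induct) (simp_all add: derivation_0 derivation_add)

lemma derivation_Const_mult: "derivation D \<Longrightarrow> D (Const c * f) = Const c * D f"
  by (simp add: derivation_mult derivation_Const)

lemma derivation_numeral: "derivation D \<Longrightarrow> D (numeral n) = 0"
  using derivation_Const [of D "numeral n"] by simp

lemma derivation_inverse: "derivation D \<Longrightarrow> D (inverse f) = - D f / f\<^sup>2"
proof (cases "f = 0")
  case False
  assume D: "derivation D"
  have "D (inverse f * f) = 0"
    using False derivation_Const [OF D, of 1] by simp
  then have "f * D (inverse f) = - D f * inverse f"
    by (simp add: derivation_mult [OF D] eq_neg_iff_add_eq_0 mult.commute add.commute)
  then have "inverse f * (f * D (inverse f)) = - D f * (inverse f)\<^sup>2"
    by (simp add: power2_eq_square)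
  with False show ?thesis
    by (simp add: divide_inverse power_inverse flip: mult.assoc)
qed (simp add: derivation_0)

lemma derivation_divide: "derivation D \<Longrightarrow> D (f / g) = (D f * g - f * D g) / g\<^sup>2"
  by (cases "g = 0")
   (simp_all add: divide_inverse derivation_mult derivation_inverse derivation_0,
    simp add: field_simps power2_eq_square)

lemma derivation_power: "derivation D \<Longrightarrow> D (f ^ n) = of_nat n * f ^ (n - 1) * D f"
proof (induction n)
  case 0
  then show ?case using derivation_Const [of D 1] by simp
next
  case (Suc n)
  then show ?case
    by (cases n) (simp_all add: derivation_mult algebra_simps)
qed

lemmas derivation_simps = derivation_add derivation_mult derivation_Const derivation_0
  derivation_minus derivation_diff derivation_sum derivation_numeral

lemma derivation_eqI:
  assumes "derivation D" "derivation D'" "\<And>v. D (Var v) = D' (Var v)"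
  shows "D f = D' f"
  by (induction f rule: crat_induct)
    (use assms in \<open>simp_all add: derivation_simps derivation_inverse\<close>)

lemma derivation_comb:
  "(\<And>i. i \<in> I \<Longrightarrow> derivation (D i)) \<Longrightarrow> derivation (\<lambda>f. \<Sum>i\<in>I. g i * D i f)"
  by (auto simp: derivation_def distrib_left sum.distrib sum_distrib_left sum_distrib_right mult_ac
     intro!: sum.cong simp flip: sum.distrib)

lemma derivation_diff_mult:
  "derivation D \<Longrightarrow> derivation D' \<Longrightarrow> derivation (\<lambda>f. D f - g * D' f)"
  by (simp add: derivation_def algebra_simps)

lemma derivation_commutator:
  assumes "derivation D" "derivation D'"
  shows "derivation (\<lambda>f. D (D' f) - D' (D f))"
  using assms by (simp add: derivation_def) (simp add: derivation_0 [OF assms(1)] derivation_0 [OF assms(2)] algebra_simps)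

lemma derivation_commute:
  assumes D: "derivation D" and D': "derivation D'" and "\<And>v. D (D' (Var v)) = D' (D (Var v))"
  shows "D (D' f) = D' (D f)"
proof -
  have "D (D' f) - D' (D f) = (\<lambda>f. \<Sum>i\<in>{}. 0 * D f) f"
    by (rule derivation_eqI [OF derivation_commutator [OF D D'] derivation_comb]) (use assms in auto)
  then show ?thesis by simp
qed

definition polynomials :: "crat set" where "polynomials = range (\<lambda>p. Fract p 1)"

lemma polynomials_closed:
  "Const c \<in> polynomials" "Var v \<in> polynomials" "f \<in> polynomials \<Longrightarrow> g \<in> polynomials \<Longrightarrow> f + g \<in> polynomials"
  "f \<in> polynomials \<Longrightarrow> g \<in> polynomials \<Longrightarrow> f * g \<in> polynomials"
  "f \<in> polynomials \<Longrightarrow> rat_deriv v f \<in> polynomials"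
proof -
  show "rat_deriv v f \<in> polynomials" if f: "f \<in> polynomials"
  proof -
    obtain p where p: "f = Fract p 1" using f by (auto simp: polynomials_def)
    have "poly_deriv v 1 = 0"
      using poly_deriv_single [of v 0 1] by simp
    then have "rat_deriv v f = Fract (poly_deriv v p) 1" by (simp add: p rat_deriv_Fract)
    then show ?thesis by (simp add: polynomials_def)
  qed
qed (auto simp: polynomials_def Const_pconst Var_pvar)

definition euler :: "nat \<Rightarrow> crat \<Rightarrow> crat" where
  "euler N f = (\<Sum>v<N. Var v * rat_deriv v f)"

lemma derivation_euler: "derivation (euler N)"
  unfolding euler_def [abs_def] by (rule derivation_comb) (rule derivation_rat_deriv)

text \<open>The Euler operator multiplies a monomial by its degree in the first \<open>N\<close>
  variables, a natural number; the remaining variables count as constants. So it has no negative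
  eigenvalue on polynomials.\<close>

lemma polynomial_negative_degree:
  assumes "f \<in> polynomials" "euler N f = - of_nat k * f" "k > 0"
  shows "f = 0"
proof -
  obtain p where p: "f = Fract p 1" using assms(1) by (auto simp: polynomials_def)
  define e where "e p = (\<Sum>v<N. pvar v * poly_deriv v p)" for p
  have "poly_deriv v 1 = 0" for v
    using poly_deriv_single [of v 0 1] by simp
  then have "euler N f = Fract (e p) 1"
    by (simp add: euler_def p rat_deriv_Fract Var_pvar e_def Fract_sum)
  moreover have "- of_nat k * f = Fract (- of_nat k * p) 1"
    by (simp add: p flip: Fract_of_nat_eq)
  ultimately have ep: "e p = - of_nat k * p"
    using assms(2) by (simp add: eq_fract)
  have "Poly_Mapping.lookup (e p) m = of_nat (\<Sum>v<N. Poly_Mapping.lookup m v) * Poly_Mapping.lookup p m" for m p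
  proof (induction p rule: cpoly_induct)
    case zero
    then show ?case by (simp add: e_def)
  next
    case (add p n c)
    have "pvar v * poly_deriv v (Poly_Mapping.single n c) =
        Poly_Mapping.single n (of_nat (Poly_Mapping.lookup n v) * c)" for v
    proof (cases "Poly_Mapping.lookup n v = 0")
      case False
      then have "Poly_Mapping.single v 1 + (n - Poly_Mapping.single v 1) = n"
        by (intro poly_mapping_eqI) (auto simp: lookup_add lookup_minus lookup_single when_def)
      then show ?thesis by (simp add: poly_deriv_single pvar_def mult_single)
    qed (simp add: poly_deriv_single)
    then have "Poly_Mapping.lookup (e (Poly_Mapping.single n c)) m =
        of_nat (\<Sum>v<N. Poly_Mapping.lookup m v) * Poly_Mapping.lookup (Poly_Mapping.single n c) m"
      by (simp add: e_def lookup_sum lookup_single when_def sum_distrib_right)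
    moreover have "e (p + q) = e p + e q" for q
      by (simp add: e_def poly_deriv_add distrib_left sum.distrib)
    ultimately show ?case using add by (simp add: lookup_add distrib_left)
  qed
  note this [of p]
  moreover have "Poly_Mapping.lookup (- of_nat k * p) m = - of_nat k * Poly_Mapping.lookup p m" for m
  proof -
    have "- of_nat k * p = Poly_Mapping.map ((*) (- of_nat k)) p"
      unfolding mult_map_scale_conv_mult by (simp add: single_uminus)
    then show ?thesis
      by (simp only: Poly_Mapping.map.rep_eq when_def) simp
  qed
  ultimately have "of_nat (\<Sum>v<N. Poly_Mapping.lookup m v) * Poly_Mapping.lookup p m
      = - of_nat k * Poly_Mapping.lookup p m" for m
    unfolding ep by simp
  then have "of_nat (k + (\<Sum>v<N. Poly_Mapping.lookup m v)) * Poly_Mapping.lookup p m = 0" for m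
    unfolding of_nat_add distrib_right by (simp add: mult_minus_left)
  then have "Poly_Mapping.lookup p m = 0" for m
    using assms(3) mult_eq_0_iff [of "of_nat (k + (\<Sum>v<N. Poly_Mapping.lookup m v))" "Poly_Mapping.lookup p m"]
    unfolding of_nat_eq_0_iff by simp
  then have "p = 0" by (simp add: poly_mapping_eqI)
  then show ?thesis by (simp add: p Zero_fract_def)
qed

section \<open>The local ring of a hyperplane\<close>

text \<open>A complex normal vector may be isotropic and then lies in its own hyperplane. Excluding
  this allows derivatives to be split into the normal one, \<open>nd\<close>, scaled so that
  \<open>nd lin = 1\<close>, and the tangential projections \<open>td v\<close>.\<close>

locale hyperplane =
  fixes N :: nat and h :: "nat \<Rightarrow> complex"
  assumes nonisotropic: "(\<Sum>v<N. (h v)\<^sup>2) \<noteq> 0"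
begin

definition lin :: crat where "lin = (\<Sum>v<N. Const (h v) * Var v)"
definition lin_poly :: cpoly where "lin_poly = (\<Sum>v<N. pconst (h v) * pvar v)"
definition nrm :: complex where "nrm = (\<Sum>v<N. (h v)\<^sup>2)"
definition nd :: "crat \<Rightarrow> crat" where "nd f = (\<Sum>v<N. Const (h v / nrm) * rat_deriv v f)"
definition td :: "nat \<Rightarrow> crat \<Rightarrow> crat" where "td v f = rat_deriv v f - Const (h v) * nd f"

definition loc :: "crat set" where "loc = {Fract p q | p q. \<not> lin_poly dvd q}"
definition loc_ideal :: "crat set" where "loc_ideal = (\<lambda>f. lin * f) ` loc"

lemma nrm_nz [simp]: "nrm \<noteq> 0"
  using nonisotropic by (simp add: nrm_def)

lemma prime_lin_poly: "prime_elem lin_poly"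
proof -
  have "\<exists>v<N. h v \<noteq> 0"
    using nonisotropic by (metis (no_types, lifting) lessThan_iff power_zero_numeral sum.neutral)
  then show ?thesis
    unfolding lin_poly_def using linear_form_prime by blast
qed

lemma lin_poly_nz [simp]: "lin_poly \<noteq> 0"
  using prime_lin_poly by auto

lemma lin_Fract: "lin = Fract lin_poly 1"
  by (simp add: lin_def lin_poly_def Const_pconst Var_pvar Fract_sum)

lemma lin_nz [simp]: "lin \<noteq> 0"
  by (simp add: lin_Fract Zero_fract_def eq_fract)

lemma loc_add: "f \<in> loc \<Longrightarrow> g \<in> loc \<Longrightarrow> f + g \<in> loc"
proof -
  assume "f \<in> loc" "g \<in> loc"
  then obtain p q r s where *: "f = Fract p q" "g = Fract r s" "\<not> lin_poly dvd q" "\<not> lin_poly dvd s"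
    by (auto simp: loc_def)
  then have "q \<noteq> 0" "s \<noteq> 0" by auto
  with * have "f + g = Fract (p * s + r * q) (q * s)" by simp
  moreover have "\<not> lin_poly dvd q * s"
    using * prime_lin_poly prime_elem_dvd_multD by blast
  ultimately show ?thesis by (auto simp: loc_def)
qed

lemma loc_mult: "f \<in> loc \<Longrightarrow> g \<in> loc \<Longrightarrow> f * g \<in> loc"
proof -
  assume "f \<in> loc" "g \<in> loc"
  then obtain p q r s where *: "f = Fract p q" "g = Fract r s" "\<not> lin_poly dvd q" "\<not> lin_poly dvd s"
    by (auto simp: loc_def)
  then have "f * g = Fract (p * r) (q * s)" by simp
  moreover have "\<not> lin_poly dvd q * s"
    using * prime_lin_poly prime_elem_dvd_multD by blast
  ultimately show ?thesis by (auto simp: loc_def)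
qed

lemma polynomials_loc: "f \<in> polynomials \<Longrightarrow> f \<in> loc"
  using prime_lin_poly by (force simp: polynomials_def loc_def prime_elem_def)

lemma loc_Const: "Const c \<in> loc" and loc_Var: "Var v \<in> loc"
  by (simp_all add: polynomials_loc polynomials_closed)

lemma loc_numeral: "0 \<in> loc" "1 \<in> loc" "numeral n \<in> loc"
  using loc_Const [of 0] loc_Const [of 1] loc_Const [of "numeral n"] by simp_all

lemma loc_minus: "f \<in> loc \<Longrightarrow> - f \<in> loc"
  using loc_mult [OF loc_Const [of "- 1"]] by (simp add: Const_minus)

lemma loc_diff: "f \<in> loc \<Longrightarrow> g \<in> loc \<Longrightarrow> f - g \<in> loc"
  using loc_add [OF _ loc_minus] by fastforce

lemma loc_sum: "(\<And>i. i \<in> I \<Longrightarrow> g i \<in> loc) \<Longrightarrow> (\<Sum>i\<in>I. g i) \<in> loc"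
  by (induction I rule: infinite_finite_induct) (simp_all add: loc_numeral loc_add)

lemma loc_power: "f \<in> loc \<Longrightarrow> f ^ n \<in> loc"
  by (induction n) (simp_all add: loc_numeral loc_mult)

lemma loc_lin: "lin \<in> loc"
  unfolding lin_def by (intro loc_sum loc_mult loc_Const loc_Var)

lemma loc_rat_deriv: "f \<in> loc \<Longrightarrow> rat_deriv v f \<in> loc"
proof -
  assume "f \<in> loc"
  then obtain p q where *: "f = Fract p q" "\<not> lin_poly dvd q"
    by (auto simp: loc_def)
  then have "q \<noteq> 0" by auto
  with * have "rat_deriv v f = Fract (poly_deriv v p * q - p * poly_deriv v q) (q * q)"
    by (simp add: rat_deriv_Fract power2_eq_square)
  moreover have "\<not> lin_poly dvd q * q"
    using * prime_lin_poly prime_elem_dvd_multD by blast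
  ultimately show ?thesis by (auto simp: loc_def)
qed

lemma loc_inverse:
  assumes "f \<in> loc" "f \<notin> loc_ideal"
  shows "inverse f \<in> loc"
proof -
  obtain p q where *: "f = Fract p q" "\<not> lin_poly dvd q"
    using assms(1) by (auto simp: loc_def)
  have "\<not> lin_poly dvd p"
  proof
    assume "lin_poly dvd p"
    then obtain r where "p = lin_poly * r" by (auto elim: dvdE)
    then have "f = lin * Fract r q" by (simp add: * lin_Fract)
    moreover have "Fract r q \<in> loc" using * by (auto simp: loc_def)
    ultimately show False using assms(2) by (auto simp: loc_ideal_def)
  qed
  then show ?thesis using * by (auto simp: loc_def)
qed

lemma one_notin_loc_ideal: "1 \<notin> loc_ideal"
proof
  assume "1 \<in> loc_ideal"
  then obtain f where "f \<in> loc" "1 = lin * f" by (auto simp: loc_ideal_def)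
  then obtain p q where *: "1 = lin * Fract p q" "\<not> lin_poly dvd q"
    by (auto simp: loc_def)
  then have "q \<noteq> 0" by auto
  with * have "q = lin_poly * p"
    by (simp add: lin_Fract One_fract_def eq_fract)
  with * show False by simp
qed

lemma ideal_add: "f \<in> loc_ideal \<Longrightarrow> g \<in> loc_ideal \<Longrightarrow> f + g \<in> loc_ideal"
  unfolding loc_ideal_def using loc_add by (force simp flip: distrib_left)

lemma ideal_mult: "f \<in> loc_ideal \<Longrightarrow> g \<in> loc \<Longrightarrow> f * g \<in> loc_ideal"
  and ideal_mult_left: "f \<in> loc_ideal \<Longrightarrow> g \<in> loc \<Longrightarrow> g * f \<in> loc_ideal"
  unfolding loc_ideal_def using loc_mult by (force simp: mult_ac)+

lemma ideal_minus: "f \<in> loc_ideal \<Longrightarrow> - f \<in> loc_ideal"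
  using ideal_mult [of f "- 1"] loc_minus loc_numeral by simp

lemma ideal_diff: "f \<in> loc_ideal \<Longrightarrow> g \<in> loc_ideal \<Longrightarrow> f - g \<in> loc_ideal"
  using ideal_add [OF _ ideal_minus] by fastforce

lemma ideal_0: "0 \<in> loc_ideal"
  unfolding loc_ideal_def using loc_numeral by force

lemma ideal_lin: "f \<in> loc \<Longrightarrow> lin * f \<in> loc_ideal"
  by (simp add: loc_ideal_def)

lemma ideal_sum: "(\<And>i. i \<in> I \<Longrightarrow> g i \<in> loc_ideal) \<Longrightarrow> (\<Sum>i\<in>I. g i) \<in> loc_ideal"
  by (induction I rule: infinite_finite_induct) (simp_all add: ideal_0 ideal_add)

lemma unit_cancel:
  assumes "u \<in> loc" "u \<notin> loc_ideal" "u * f \<in> loc_ideal"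
  shows "f \<in> loc_ideal"
proof -
  have "u \<noteq> 0" using assms(2) ideal_0 by auto
  then have "f = inverse u * (u * f)" by simp
  with ideal_mult_left [OF assms(3) loc_inverse [OF assms(1,2)]] show ?thesis by simp
qed

lemma unit_Const: "c \<noteq> 0 \<Longrightarrow> Const c \<notin> loc_ideal"
  using ideal_mult [of "Const c" "Const (inverse c)"] one_notin_loc_ideal loc_Const
  by (auto simp flip: Const_mult)

lemma unit_mult:
  assumes "f \<in> loc" "f \<notin> loc_ideal" "g \<notin> loc_ideal"
  shows "f * g \<notin> loc_ideal"
  using unit_cancel assms by blast

lemma unit_power: "f \<in> loc \<Longrightarrow> f \<notin> loc_ideal \<Longrightarrow> f ^ n \<notin> loc_ideal"
  by (induction n) (simp_all add: one_notin_loc_ideal unit_mult)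

lemma loc_divide: "f \<in> loc \<Longrightarrow> g \<in> loc \<Longrightarrow> g \<notin> loc_ideal \<Longrightarrow> f / g \<in> loc"
  by (simp add: divide_inverse loc_mult loc_inverse)

text \<open>A representation of \<open>f\<close> with denominator \<open>q\<close> shows that
  \<open>lin_poly\<close> divides \<open>p * q\<close> but not \<open>q\<close>; primality forces it
  into \<open>p\<close>, where it cancels.\<close>

lemma polynomials_gluing:
  assumes "f \<in> loc" "f * lin \<in> polynomials"
  shows "f \<in> polynomials"
proof -
  obtain p where p: "f * lin = Fract p 1" using assms(2) by (auto simp: polynomials_def)
  obtain r q where f: "f = Fract r q" "\<not> lin_poly dvd q" using assms(1) by (auto simp: loc_def)
  then have "q \<noteq> 0" by auto
  with f p have "p * q = lin_poly * r"
    by (simp add: lin_Fract eq_fract mult_ac)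
  then have "lin_poly dvd p"
    using f(2) prime_lin_poly by (metis dvd_triv_left prime_elem_dvd_multD)
  then obtain s where "p = s * lin_poly" by (auto elim: dvdE simp: mult.commute)
  then have "f * lin = Fract s 1 * lin" by (simp only: p) (simp add: lin_Fract)
  then show ?thesis by (simp add: polynomials_def)
qed

lemma derivation_nd: "derivation nd"
  unfolding nd_def [abs_def] by (rule derivation_comb) (rule derivation_rat_deriv)

lemma derivation_td: "derivation (td v)"
  unfolding td_def [abs_def] by (intro derivation_diff_mult derivation_rat_deriv derivation_nd)

lemma nd_Var: "nd (Var v) = Const (if v < N then h v / nrm else 0)"
proof -
  have "nd (Var v) = (\<Sum>w<N. if w = v then Const (h v / nrm) else 0)"
    unfolding nd_def by (rule sum.cong) (auto simp: rat_deriv_Var)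
  then show ?thesis by simp
qed

lemma td_Var: "td v (Var w) = Const ((if v = w then 1 else 0) - h v * (if w < N then h w / nrm else 0))"
  by (simp add: td_def rat_deriv_Var nd_Var Const_simps)

lemma Const_sum: "Const (\<Sum>i\<in>I. g i) = (\<Sum>i\<in>I. Const (g i))"
  by (induction I rule: infinite_finite_induct) (simp_all add: Const_add)

lemma nd_lin [simp]: "nd lin = 1"
proof -
  have "nd lin = Const (\<Sum>v<N. h v * (h v / nrm))"
    by (simp add: lin_def derivation_simps [OF derivation_nd] nd_Var Const_sum flip: Const_mult)
  also have "(\<Sum>v<N. h v * (h v / nrm)) = nrm / nrm"
    unfolding nrm_def [of] by (simp add: sum_divide_distrib [symmetric] power2_eq_square)
  finally show ?thesis by simp
qed

lemma rat_deriv_lin: "v < N \<Longrightarrow> rat_deriv v lin = Const (h v)"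
proof -
  assume "v < N"
  have "rat_deriv v lin = (\<Sum>w<N. if w = v then Const (h v) else 0)"
    unfolding lin_def derivation_sum [OF derivation_rat_deriv] 
    by (rule sum.cong) (auto simp: rat_deriv_Var derivation_Const_mult [OF derivation_rat_deriv])
  with \<open>v < N\<close> show ?thesis by simp
qed

lemma td_lin [simp]: "v < N \<Longrightarrow> td v lin = 0"
  by (simp add: td_def rat_deriv_lin)

lemma nd_rat_deriv: "nd (rat_deriv v f) = rat_deriv v (nd f)"
  by (rule derivation_commute [OF derivation_nd derivation_rat_deriv])
    (auto simp: rat_deriv_Var nd_Var derivation_0 [OF derivation_nd] derivation_Const [OF derivation_nd, of 1, simplified])

lemma nd_td: "nd (td v f) = td v (nd f)"
  by (simp add: td_def derivation_diff [OF derivation_nd] derivation_Const_mult [OF derivation_nd] nd_rat_deriv)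

text \<open>The \<open>td v\<close> are the projections of all \<open>N\<close> coordinate
  derivatives to the hyperplane. They are linearly dependent, yet their squares add up to the
  tangential Laplacian. The factor \<open>nrm\<close> reflects the scaling of
  \<open>nd\<close>.\<close>

lemma laplacian_decomp:
  "(\<Sum>v<N. rat_deriv v (rat_deriv v f)) = Const nrm * nd (nd f) + (\<Sum>v<N. td v (td v f))"
proof -
  have "td v (td v f) = rat_deriv v (rat_deriv v f) - 2 * Const (h v) * rat_deriv v (nd f)
      + Const ((h v)\<^sup>2) * nd (nd f)" for v
    by (simp add: td_def derivation_diff [OF derivation_rat_deriv] derivation_diff [OF derivation_nd]
        derivation_Const_mult [OF derivation_rat_deriv]
        derivation_Const_mult [OF derivation_nd] nd_rat_deriv Const_simps algebra_simps power2_eq_square)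
  then have "(\<Sum>v<N. td v (td v f)) = (\<Sum>v<N. rat_deriv v (rat_deriv v f))
      - 2 * (\<Sum>v<N. Const (h v) * rat_deriv v (nd f)) + Const nrm * nd (nd f)"
    by (simp add: sum.distrib sum_subtractf nrm_def Const_sum sum_distrib_left sum_distrib_right mult.assoc)
  moreover have "(\<Sum>v<N. Const (h v) * rat_deriv v (nd f)) = Const nrm * nd (nd f)"
    by (simp add: nd_def [of "nd f"] sum_distrib_left flip: Const_mult mult.assoc)
  ultimately show ?thesis by simp
qed

lemma loc_nd: "f \<in> loc \<Longrightarrow> nd f \<in> loc"
  unfolding nd_def by (intro loc_sum loc_mult loc_Const loc_rat_deriv)

lemma loc_td: "f \<in> loc \<Longrightarrow> td v f \<in> loc"
  unfolding td_def by (intro loc_diff loc_mult loc_Const loc_rat_deriv loc_nd)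

section \<open>Even elements of the local ring and the reflection\<close>

definition tang :: "nat \<Rightarrow> crat" where "tang v = Var v - nd (Var v) * lin"

lemma nd_tang [simp]: "nd (tang v) = 0"
  by (simp add: tang_def derivation_simps [OF derivation_nd] nd_Var)

text \<open>Described by generators, closed under inverses of units, instead of as the fixed points
  of a reflection: no automorphism of the field has to be constructed, and stability under
  derivations follows by induction.\<close>

inductive_set even_loc :: "crat set" where
  const: "Const c \<in> even_loc"
| tang: "tang v \<in> even_loc"
| lin2: "lin * lin \<in> even_loc"
| add: "f \<in> even_loc \<Longrightarrow> g \<in> even_loc \<Longrightarrow> f + g \<in> even_loc"
| mult: "f \<in> even_loc \<Longrightarrow> g \<in> even_loc \<Longrightarrow> f * g \<in> even_loc"
| inverse: "f \<in> even_loc \<Longrightarrow> f \<notin> loc_ideal \<Longrightarrow> inverse f \<in> even_loc"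

lemma even_minus: "f \<in> even_loc \<Longrightarrow> - f \<in> even_loc"
  using even_loc.mult [OF even_loc.const [of "- 1"]] by (simp add: Const_minus)

lemma even_diff: "f \<in> even_loc \<Longrightarrow> g \<in> even_loc \<Longrightarrow> f - g \<in> even_loc"
  using even_loc.add [OF _ even_minus] by fastforce

lemma even_0: "0 \<in> even_loc" and even_1: "1 \<in> even_loc" and even_numeral: "numeral n \<in> even_loc"
  using even_loc.const [of 0] even_loc.const [of 1] even_loc.const [of "numeral n"] by simp_all

lemma even_sum: "(\<And>i. i \<in> I \<Longrightarrow> g i \<in> even_loc) \<Longrightarrow> (\<Sum>i\<in>I. g i) \<in> even_loc"
  by (induction I rule: infinite_finite_induct) (simp_all add: even_0 even_loc.add)

lemma even_power: "f \<in> even_loc \<Longrightarrow> f ^ n \<in> even_loc"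
  by (induction n) (simp_all add: even_1 even_loc.mult)

lemma even_imp_loc: "f \<in> even_loc \<Longrightarrow> f \<in> loc"
  by (induction rule: even_loc.induct)
    (auto simp: tang_def nd_Var intro: loc_Const loc_Var loc_diff loc_mult loc_lin loc_add loc_inverse)

text \<open>An even function has an odd normal derivative; this is the source of the parity axiom
  \<open>A_Y\<close>.\<close>

lemma even_nd: "f \<in> even_loc \<Longrightarrow> \<exists>g\<in>even_loc. nd f = lin * g"
proof (induction rule: even_loc.induct)
  case lin2
  show ?case
    by (rule bexI [of _ 2]) (simp_all add: derivation_mult [OF derivation_nd] even_numeral)
next
  case (add f g)
  then show ?case
    by (metis derivation_add derivation_nd distrib_left even_loc.add)
next
  case (mult f g)
  then obtain f' g' where "f' \<in> even_loc" "g' \<in> even_loc" "nd f = lin * f'" "nd g = lin * g'" by auto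
  with mult(1,2) show ?case
    by (intro bexI [of _ "f' * g + f * g'"])
      (auto simp: derivation_mult [OF derivation_nd] algebra_simps intro!: even_loc.add even_loc.mult)
next
  case (inverse f)
  then obtain f' where "f' \<in> even_loc" "nd f = lin * f'" by auto
  with inverse(1,2) show ?case
    by (intro bexI [of _ "- (f' * (inverse f * inverse f))"])
      (auto simp: derivation_inverse [OF derivation_nd] divide_inverse power2_eq_square
        intro!: even_loc.mult even_loc.inverse even_minus)
qed (auto intro!: bexI [of _ 0] simp: even_0 derivation_Const [OF derivation_nd])

lemma even_td:
  assumes "w < N" "f \<in> even_loc"
  shows "td w f \<in> even_loc"
  using assms(2)
proof (induction rule: even_loc.induct)
  case (inverse f)
  then show ?case
    by (auto simp: derivation_inverse [OF derivation_td] divide_inverse power2_eq_square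
        intro!: even_loc.mult even_loc.inverse even_minus)
qed (auto simp: derivation_simps [OF derivation_td] tang_def td_Var nd_Var assms(1) even_0
    simp flip: Const_simps intro: even_loc.intros)

text \<open>The graph of the reflection in the hyperplane, on the ring generated by
  \<open>even_loc\<close> and \<open>lin\<close>.\<close>

definition refl :: "crat \<Rightarrow> crat \<Rightarrow> bool" where
  "refl f g \<longleftrightarrow> (\<exists>u\<in>even_loc. \<exists>v\<in>even_loc. f = u + lin * v \<and> g = u - lin * v)"

lemma refl_even: "f \<in> even_loc \<Longrightarrow> refl f f"
  unfolding refl_def by (rule bexI [of _ f], rule bexI [of _ 0]) (auto simp: even_0)

lemma refl_sum_even: "refl f g \<Longrightarrow> f + g \<in> even_loc"
proof -
  assume "refl f g"
  then obtain u v where "u \<in> even_loc" "f = u + lin * v" "g = u - lin * v"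
    by (auto simp: refl_def)
  then show ?thesis using even_loc.add [of u u] by simp
qed

lemma refl_sym: "refl f g \<Longrightarrow> refl g f"
proof -
  assume "refl f g"
  then obtain u v where "u \<in> even_loc" "v \<in> even_loc" "f = u + lin * v" "g = u - lin * v"
    by (auto simp: refl_def)
  then show ?thesis
    unfolding refl_def by (intro bexI [of _ u] bexI [of _ "- v"]) (simp_all add: even_minus)
qed

lemma refl_add: "refl f g \<Longrightarrow> refl f' g' \<Longrightarrow> refl (f + f') (g + g')"
proof -
  assume "refl f g" "refl f' g'"
  then obtain u v u' v' where *: "u \<in> even_loc" "v \<in> even_loc" "u' \<in> even_loc" "v' \<in> even_loc"
      "f = u + lin * v" "g = u - lin * v" "f' = u' + lin * v'" "g' = u' - lin * v'"
    by (auto simp: refl_def)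
  show ?thesis
    unfolding refl_def
    by (rule bexI [of _ "u + u'"], rule bexI [of _ "v + v'"])
      (use * in \<open>auto simp: algebra_simps intro: even_loc.add\<close>)
qed

lemma refl_mult: "refl f g \<Longrightarrow> refl f' g' \<Longrightarrow> refl (f * f') (g * g')"
proof -
  assume "refl f g" "refl f' g'"
  then obtain u v u' v' where *: "u \<in> even_loc" "v \<in> even_loc" "u' \<in> even_loc" "v' \<in> even_loc"
      "f = u + lin * v" "g = u - lin * v" "f' = u' + lin * v'" "g' = u' - lin * v'"
    by (auto simp: refl_def)
  show ?thesis
    unfolding refl_def
    by (rule bexI [of _ "u * u' + lin * lin * (v * v')"], rule bexI [of _ "u * v' + v * u'"])
      (use * in \<open>auto simp: algebra_simps intro!: even_loc.add even_loc.mult even_loc.lin2\<close>)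
qed

lemma refl_minus: "refl f g \<Longrightarrow> refl (- f) (- g)"
  using refl_mult [OF refl_even [OF even_loc.const [of "- 1"]]] by (simp add: Const_minus)

lemma refl_diff: "refl f g \<Longrightarrow> refl f' g' \<Longrightarrow> refl (f - f') (g - g')"
  using refl_add [OF _ refl_minus] by fastforce

lemma refl_power: "refl f g \<Longrightarrow> refl (f ^ n) (g ^ n)"
  by (induction n) (simp_all add: refl_even even_1 refl_mult)

text \<open>The denominator is made even by the conjugate: \<open>f * g\<close> is
  \<open>u\<^sup>2 - lin\<^sup>2 v\<^sup>2\<close>, which is even and a unit because
  \<open>u\<close> is one.\<close>

lemma refl_inverse:
  assumes "refl f g" "f \<notin> loc_ideal"
  shows "refl (inverse f) (inverse g)"
proof -
  obtain u v where *: "u \<in> even_loc" "v \<in> even_loc" "f = u + lin * v" "g = u - lin * v"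
    using assms(1) by (auto simp: refl_def)
  have loc: "u \<in> loc" "v \<in> loc" using * even_imp_loc by auto
  have u: "u \<notin> loc_ideal"
    using assms(2) ideal_add ideal_lin loc * by blast
  define w where "w = u * u - lin * lin * (v * v)"
  have "w \<notin> loc_ideal"
  proof
    assume "w \<in> loc_ideal"
    then have "w + lin * (lin * (v * v)) \<in> loc_ideal"
      using loc by (intro ideal_add ideal_lin loc_mult loc_lin) auto
    then have "u * u \<in> loc_ideal" by (simp add: w_def mult.assoc)
    with u loc unit_cancel show False by blast
  qed
  moreover have "w \<in> even_loc"
    unfolding w_def using * by (intro even_diff even_loc.mult even_loc.lin2)
  ultimately have w: "inverse w \<in> even_loc" "w \<noteq> 0"
    using even_loc.inverse ideal_0 by auto
  have w2: "w = f * g" by (simp add: w_def * algebra_simps)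
  with w have nz: "f \<noteq> 0" "g \<noteq> 0" by auto
  have "inverse f = inverse w * g" "inverse g = inverse w * f"
    using nz by (simp_all add: w2)
  then show ?thesis
    unfolding refl_def
    by (intro bexI [of _ "inverse w * u"] bexI [of _ "- (inverse w * v)"])
      (use * w in \<open>auto simp: algebra_simps intro: even_loc.mult even_minus\<close>)
qed

lemma refl_divide: "refl f g \<Longrightarrow> refl f' g' \<Longrightarrow> f' \<notin> loc_ideal \<Longrightarrow> refl (f / f') (g / g')"
  by (simp add: divide_inverse refl_mult refl_inverse)

end

section \<open>The ring of additive operators\<close>

text \<open>As a type, the additive maps form a ring to which the calculus of commutators above
  applies; additivity is what makes composition distribute over sums in its second factor.\<close>

typedef endo = "{X :: crat \<Rightarrow> crat. \<forall>f g. X (f + g) = X f + X g}"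
  morphisms app Endo
  by (rule exI [of _ id]) simp

setup_lifting type_definition_endo

lemma endo_eqI: "(\<And>f. app X f = app Y f) \<Longrightarrow> X = Y"
  by transfer auto

lemma app_add: "app X (f + g) = app X f + app X g"
  by transfer simp

lemma app_0 [simp]: "app X 0 = 0"
  using app_add [of X 0 0] by simp

lemma app_minus: "app X (- f) = - app X f"
  using app_add [of X f "- f"] by (simp add: eq_neg_iff_add_eq_0 add.commute)

instantiation endo :: ring_1
begin

lift_definition zero_endo :: endo is "\<lambda>_. 0" by simp
lift_definition one_endo :: endo is "\<lambda>f. f" by simp
lift_definition plus_endo :: "endo \<Rightarrow> endo \<Rightarrow> endo" is "\<lambda>X Y f. X f + Y f" by (simp add: algebra_simps)
lift_definition minus_endo :: "endo \<Rightarrow> endo \<Rightarrow> endo" is "\<lambda>X Y f. X f - Y f" by (simp add: algebra_simps)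
lift_definition uminus_endo :: "endo \<Rightarrow> endo" is "\<lambda>X f. - X f" by simp
lift_definition times_endo :: "endo \<Rightarrow> endo \<Rightarrow> endo" is "\<lambda>X Y f. X (Y f)" by simp

instance
proof
  show "(0::endo) \<noteq> 1"
    by transfer (metis zero_neq_one)
qed (transfer; simp add: fun_eq_iff algebra_simps; fail)+

end

lemma app_simps [simp]:
  "app 0 f = 0" "app 1 f = f" "app (X + Y) f = app X f + app Y f" "app (X - Y) f = app X f - app Y f"
  "app (- X) f = - app X f" "app (X * Y) f = app X (app Y f)"
  by (transfer; simp)+

lemma app_sum: "app (\<Sum>i\<in>I. X i) f = (\<Sum>i\<in>I. app (X i) f)"
  by (induction I rule: infinite_finite_induct) simp_all

lemma app_of_nat [simp]: "app (of_nat n) f = of_nat n * f"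
  by (induction n) (simp_all add: algebra_simps)

lemma app_com: "app (com X Y) f = app X (app Y f) - app Y (app X f)"
  by (simp add: com_def)

definition ml :: "crat \<Rightarrow> endo" where "ml g = Endo (\<lambda>f. g * f)"

lemma app_ml [simp]: "app (ml g) f = g * f"
  unfolding ml_def by (subst Endo_inverse) (auto simp: algebra_simps)

lemma ml_simps: "ml (f + g) = ml f + ml g" "ml (f * g) = ml f * ml g" "ml (f - g) = ml f - ml g"
  "ml (- f) = - ml f" "ml 0 = 0" "ml 1 = 1"
  by (auto intro!: endo_eqI simp: algebra_simps)

lemma com_ml_ml [simp]: "com (ml f) (ml g) = 0"
  by (rule endo_eqI) (simp add: app_com)

lemma ml_of_nat: "ml (of_nat n) = of_nat n"
  by (rule endo_eqI) simp

definition dop :: "(crat \<Rightarrow> crat) \<Rightarrow> endo" where "dop D = Endo D"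

lemma app_dop [simp]: "derivation D \<Longrightarrow> app (dop D) f = D f"
  unfolding dop_def by (subst Endo_inverse) (auto simp: derivation_add)

lemma com_dop_ml: "derivation D \<Longrightarrow> com (dop D) (ml f) = ml (D f)"
  by (rule endo_eqI) (simp add: app_com derivation_mult)

text \<open>Additive maps need not be complex linear. Linearity is recorded separately, in the form
  of a commutator, so that constants can be moved through brackets.\<close>

definition Clin :: "endo \<Rightarrow> bool" where "Clin X \<longleftrightarrow> (\<forall>c. com X (ml (Const c)) = 0)"

lemma Clin_com: "Clin X \<Longrightarrow> com X (ml (Const c)) = 0"
  by (simp add: Clin_def)

lemma Clin_app: "Clin X \<Longrightarrow> app X (Const c * f) = Const c * app X f"
  using Clin_com [of X c] by (metis app_com app_ml app_simps(1) eq_iff_diff_eq_0)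

lemma Clin_intros:
  "Clin (ml f)" "Clin 0" "Clin 1"
  "Clin X \<Longrightarrow> Clin Y \<Longrightarrow> Clin (X + Y)" "Clin X \<Longrightarrow> Clin Y \<Longrightarrow> Clin (X - Y)"
  "Clin X \<Longrightarrow> Clin Y \<Longrightarrow> Clin (X * Y)" "derivation D \<Longrightarrow> Clin (dop D)"
  by (simp_all add: Clin_def com_add_left com_diff_left com_mult_left com_dop_ml derivation_Const ml_simps)

lemma Clin_sum: "(\<And>i. i \<in> I \<Longrightarrow> Clin (X i)) \<Longrightarrow> Clin (\<Sum>i\<in>I. X i)"
  by (induction I rule: infinite_finite_induct) (auto intro: Clin_intros)

lemma Clin_com_closed: "Clin X \<Longrightarrow> Clin Y \<Longrightarrow> Clin (com X Y)"
  by (simp add: com_def Clin_intros)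

section \<open>Order and symbol through iterated commutators with functions\<close>

fun coms :: "crat list \<Rightarrow> endo \<Rightarrow> endo" where
  "coms [] X = X"
| "coms (f # fs) X = coms fs (com X (ml f))"

lemma coms_0 [simp]: "coms fs 0 = 0"
  by (induction fs) simp_all

lemma coms_add: "coms fs (X + Y) = coms fs X + coms fs Y"
  by (induction fs arbitrary: X Y) (simp_all add: com_add_left)

lemma coms_ml: "coms fs (ml g * X) = ml g * coms fs X"
  by (induction fs arbitrary: X) (simp_all add: com_mult_left)

lemma coms_append: "coms (fs @ gs) X = coms gs (coms fs X)"
  by (induction fs arbitrary: X) simp_all

lemma com_swap: "com x y = - com y x"
  by (simp add: com_def)

lemma com_ml_commute: "com (com X (ml f)) (ml g) = com (com X (ml g)) (ml f)"
  using com_jacobi [of X "ml f" "ml g"]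
  by (simp add: com_swap [of "ml f" "com X (ml g)"])

lemma Clin_coms: "Clin X \<Longrightarrow> Clin (coms fs X)"
  by (induction fs arbitrary: X) (simp_all add: Clin_com_closed Clin_intros)

text \<open>Grothendieck's notion of order, tested on coordinates only; for complex linear operators
  \<open>commutes_with_ml\<close> passes from coordinates to all functions.\<close>

definition ord_lt :: "nat \<Rightarrow> nat \<Rightarrow> endo \<Rightarrow> bool" where
  "ord_lt N n X \<longleftrightarrow> (\<forall>vs. length vs = n \<longrightarrow> set vs \<subseteq> {..<N} \<longrightarrow> coms (map Var vs) X = 0)"

lemma ord_lt_0: "ord_lt N 0 X \<longleftrightarrow> X = 0"
  by (simp add: ord_lt_def)

lemma ord_lt_Suc: "ord_lt N (Suc n) X \<longleftrightarrow> (\<forall>v<N. ord_lt N n (com X (ml (Var v))))"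
  by (force simp: ord_lt_def length_Suc_conv)

lemma ord_lt_zero: "ord_lt N n 0"
  by (simp add: ord_lt_def)

lemma ord_lt_add: "ord_lt N n X \<Longrightarrow> ord_lt N n Y \<Longrightarrow> ord_lt N n (X + Y)"
  by (simp add: ord_lt_def coms_add)

lemma ord_lt_ml: "ord_lt N n X \<Longrightarrow> ord_lt N n (ml g * X)"
  by (simp add: ord_lt_def coms_ml)

text \<open>By the Jacobi identity the bracket of \<open>com A X\<close> with a coordinate has two
  terms. The one containing the constant \<open>com A (ml (Var v))\<close> vanishes, since
  \<open>X\<close> is linear, and the other is covered by induction.\<close>

lemma ord_lt_com_const:
  assumes "\<And>v. v < N \<Longrightarrow> \<exists>c. com A (ml (Var v)) = ml (Const c)"
  shows "Clin X \<Longrightarrow> ord_lt N n X \<Longrightarrow> ord_lt N n (com A X)"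
proof (induction n arbitrary: X)
  case (Suc n)
  show ?case
    unfolding ord_lt_Suc
  proof (intro allI impI)
    fix v assume v: "v < N"
    obtain c where c: "com A (ml (Var v)) = ml (Const c)" using assms v by blast
    have "com (com A X) (ml (Var v)) = com (com A (ml (Var v))) X + com A (com X (ml (Var v)))"
      by (simp add: com_def algebra_simps)
    also have "com (com A (ml (Var v))) X = 0"
      unfolding c using Clin_com [OF Suc.prems(1), of c] by (simp add: com_eq_0_iff)
    finally show "ord_lt N n (com (com A X) (ml (Var v)))"
      using Suc.IH [of "com X (ml (Var v))"] Suc.prems v
      by (simp add: ord_lt_Suc Clin_com_closed Clin_intros)
  qed
qed (simp add: ord_lt_0)

text \<open>In the same splitting \<open>com L (ml (Var v))\<close> is no longer constant, but its
  own brackets with coordinates are, so commuting with it does not raise the order.\<close>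

lemma ord_lt_com_Suc:
  assumes "\<And>v w. v < N \<Longrightarrow> w < N \<Longrightarrow> \<exists>c. com (com L (ml (Var v))) (ml (Var w)) = ml (Const c)"
  shows "Clin X \<Longrightarrow> ord_lt N n X \<Longrightarrow> ord_lt N (Suc n) (com L X)"
proof (induction n arbitrary: X)
  case (Suc n)
  show ?case
    unfolding ord_lt_Suc [of N "Suc n"]
  proof (intro allI impI)
    fix v assume v: "v < N"
    have "com (com L X) (ml (Var v)) = com (com L (ml (Var v))) X + com L (com X (ml (Var v)))"
      by (simp add: com_def algebra_simps)
    moreover have "ord_lt N (Suc n) (com (com L (ml (Var v))) X)"
      by (rule ord_lt_com_const) (use assms v Suc.prems in auto)
    moreover have "ord_lt N (Suc n) (com L (com X (ml (Var v))))"
      using Suc v by (simp add: ord_lt_Suc Clin_com_closed Clin_intros)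
    ultimately show "ord_lt N (Suc n) (com (com L X) (ml (Var v)))"
      by (simp add: ord_lt_add)
  qed
qed (simp add: ord_lt_0 ord_lt_zero)

text \<open>The functions whose multiplication commutes with \<open>X\<close> form a subfield that
  contains the constants and the coordinates.\<close>

lemma commutes_with_ml:
  assumes "Clin X" "\<And>v. com X (ml (Var v)) = 0"
  shows "com X (ml f) = 0"
proof (induction f rule: crat_induct)
  case (inverse f)
  have "app X (inverse f * g) = inverse f * app X g" for g
  proof -
    have "app X (f * (inverse f * g)) = f * app X (inverse f * g)"
      using arg_cong [OF inverse(1), of "\<lambda>Y. app Y (inverse f * g)"] by (simp add: app_com)
    with inverse(2) show ?thesis by (simp flip: mult.assoc)
  qed
  then show ?case by (intro endo_eqI) (simp add: app_com)
qed (use assms in \<open>simp_all add: Clin_com ml_simps com_add_right com_mult_right\<close>)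

text \<open>Descending induction on the order: the top symbol has polynomial coefficients of negative
  degree.\<close>

lemma regular_negative_degree_zero:
  assumes F: "Clin F" and ext: "\<And>v. v \<ge> N \<Longrightarrow> com F (ml (Var v)) = 0"
    and deg: "com (dop (euler N)) F = ml (Const (- of_nat k)) * F"
    and regular: "\<And>vs. set vs \<subseteq> {..<N} \<Longrightarrow> ord_lt N (Suc (length vs)) F \<Longrightarrow>
      app (coms (map Var vs) F) 1 \<in> polynomials"
    and ord: "ord_lt N k F"
  shows "F = 0"
proof -
  \<comment> \<open>Each bracket with a coordinate raises the degree by one, because the coordinate
    is an eigenvector of the Euler operator with eigenvalue 1.\<close>
  have deg_coms: "com (dop (euler N)) (coms (map Var vs) X) = ml (Const (z + of_nat (length vs))) * coms (map Var vs) X"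
    if "set vs \<subseteq> {..<N}" "Clin X" "com (dop (euler N)) X = ml (Const z) * X" for vs z X
    using that
  proof (induction vs arbitrary: X z)
    case (Cons v vs)
    have "euler N (Var v) = (\<Sum>w<N. if w = v then Var v else 0)"
      unfolding euler_def by (rule sum.cong) (auto simp: rat_deriv_Var)
    then have "com (dop (euler N)) (ml (Var v)) = ml (Var v)"
      using Cons.prems by (simp add: com_dop_ml derivation_euler)
    then have "com (dop (euler N)) (com X (ml (Var v))) = ml (Const (z + 1)) * com X (ml (Var v))"
      using Cons.prems(3) by (simp add: com_jacobi [of "dop (euler N)"] com_mult_left Const_simps ml_simps distrib_right)
    from Cons.IH [OF _ _ this] Cons.prems show ?case
      by (simp add: Clin_com_closed Clin_intros add_ac)
  qed simp
  have "ord_lt N r F" if "r \<le> k" for r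
    using that
  proof (induction rule: inc_induct)
    case (step r)
    show ?case
      unfolding ord_lt_def
    proof (intro allI impI)
      fix vs assume vs: "length vs = r" "set vs \<subseteq> {..<N}"
      define G where "G = coms (map Var vs) F"
      have G: "Clin G" by (simp add: G_def Clin_coms F)
      have "com G (ml (Var v)) = 0" for v
      proof (cases "v < N")
        case True
        then have "coms (map Var (vs @ [v])) F = 0"
          using step.IH vs unfolding ord_lt_def by (metis length_append_singleton set_append Un_subset_iff list.set(1,2) insert_subset empty_subsetI lessThan_iff)
        then show ?thesis by (simp add: G_def coms_append)
      next
        case False
        have "com (coms gs X) (ml f) = coms gs (com X (ml f))" for gs X f
          by (induction gs arbitrary: X) (simp_all add: com_ml_commute)
        with False ext show ?thesis by (simp add: G_def)
      qed
      from commutes_with_ml [OF G this] have comm: "com G (ml f) = 0" for f .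
      \<comment> \<open>An operator that commutes with every multiplication is multiplication by its
        value at 1; here that value is a coefficient of the symbol.\<close>
      have "app G f = app G 1 * f" for f
        using arg_cong [OF comm [of f], of "\<lambda>X. app X 1"] by (simp add: app_com mult.commute)
      moreover have "app G 1 = 0"
      proof (rule polynomial_negative_degree)
        show "app G 1 \<in> polynomials"
          unfolding G_def using regular step.IH vs by simp
        have "com (dop (euler N)) G = ml (Const (- of_nat k + of_nat r)) * G"
          using deg_coms [OF vs(2) F deg] by (simp add: G_def vs)
        also have "(- of_nat k + of_nat r :: complex) = - of_nat (k - r)"
          using step.hyps by simp
        finally have "app (com (dop (euler N)) G) 1 = Const (- of_nat (k - r)) * app G 1" by simp
        moreover have "euler N 1 = 0"
          using derivation_Const [OF derivation_euler, of N 1] by simp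
        ultimately show "euler N (app G 1) = - of_nat (k - r) * app G 1"
          by (simp only: app_com app_dop [OF derivation_euler] Const_minus Const_of_nat app_0) simp
      qed (use step.hyps in simp)
      ultimately have "app G f = 0" for f by (metis mult_zero_left)
      then show "coms (map Var vs) F = 0"
        by (intro endo_eqI) (simp flip: G_def)
    qed
  qed (use ord in simp)
  from this [of 0] show ?thesis by (simp add: ord_lt_0)
qed

section \<open>Regularity of symbols along a hyperplane\<close>

context hyperplane
begin

abbreviation dlin :: "endo \<Rightarrow> endo" where "dlin X \<equiv> com X (ml lin)"

sublocale dlin: ring_derivation dlin
  by (rule ring_derivation_com_left)

lemma ord_lt_lin:
  assumes "ord_lt N (Suc n) X" "Clin X"
  shows "ord_lt N n (dlin X)"
proof -
  have "ord_lt N n (com X (ml (\<Sum>v\<in>I. Const (h v) * Var v)))" if "finite I" "I \<subseteq> {..<N}" for I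
    using that
  proof (induction I rule: finite_induct)
    case (insert i I)
    then have "ord_lt N n (ml (Const (h i)) * com X (ml (Var i)))"
      using assms(1) by (intro ord_lt_ml) (simp add: ord_lt_Suc)
    moreover have "com X (ml (Const (h i) * Var i)) = ml (Const (h i)) * com X (ml (Var i))"
      by (simp add: ml_simps com_mult_right Clin_com [OF assms(2)])
    ultimately show ?case
      using insert by (simp add: ml_simps com_add_right ord_lt_add)
  qed (simp add: ml_simps ord_lt_zero)
  then show ?thesis by (simp add: lin_def)
qed

lemma com_Var_decomp:
  assumes "Clin X"
  shows "com X (ml (Var v)) = ml (nd (Var v)) * dlin X + com X (ml (tang v))"
proof -
  have "com X (ml (nd (Var v) * lin)) = ml (nd (Var v)) * dlin X"
    by (simp add: ml_simps com_mult_right nd_Var Clin_com [OF assms])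
  then show ?thesis by (simp add: tang_def ml_simps com_diff_right)
qed

text \<open>A coordinate is a constant multiple of \<open>lin\<close> plus \<open>tang v\<close>,
  and brackets with \<open>tang v\<close> stay inside \<open>S\<close>. So every coefficient of the
  symbol is a combination of purely normal symbols of elements of \<open>S\<close>, and regularity
  is needed for those only.\<close>

lemma loc_symbol:
  assumes closed: "\<And>X v. X \<in> S \<Longrightarrow> com X (ml (tang v)) \<in> S"
    and Clin: "\<And>X. X \<in> S \<Longrightarrow> Clin X"
    and loc: "\<And>X a. X \<in> S \<Longrightarrow> (dlin ^^ Suc a) X = 0 \<Longrightarrow> app ((dlin ^^ a) X) 1 \<in> loc"
    and F: "F \<in> S" "ord_lt N (Suc (length vs)) F" and vs: "set vs \<subseteq> {..<N}"
  shows "app (coms (map Var vs) F) 1 \<in> loc"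
proof -
  \<comment> \<open>Generalised over the number \<open>a\<close> of brackets with \<open>lin\<close>
    already taken; the bound on the order of \<open>X\<close> has to pay for these as well.\<close>
  have "app (coms (map Var vs) ((dlin ^^ a) X)) 1 \<in> loc"
    if "X \<in> S" "ord_lt N (Suc (length vs + a)) X" "set vs \<subseteq> {..<N}" for a X vs
    using that
  proof (induction vs arbitrary: X a)
    case Nil
    have "ord_lt N n ((dlin ^^ m) Y) \<and> Clin ((dlin ^^ m) Y)" if "ord_lt N (n + m) Y" "Clin Y" for n m Y
      using that
      by (induction m arbitrary: n) (auto simp: ord_lt_lin Clin_com_closed Clin_intros simp flip: add_Suc)
    from this [of 0 "Suc a" X] Nil have "(dlin ^^ Suc a) X = 0"
      by (simp add: ord_lt_0 Clin del: funpow.simps)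
    with loc Nil show ?case by simp
  next
    case (Cons v vs)
    have comm: "com ((dlin ^^ a) X) (ml (tang v)) = (dlin ^^ a) (com X (ml (tang v)))"
      by (induction a) (simp_all add: com_ml_commute [of _ lin])
    have Clin_a: "Clin ((dlin ^^ a) X)"
      by (induction a) (use Clin Cons.prems in \<open>auto simp: Clin_com_closed Clin_intros\<close>)
    have "coms (map Var (v # vs)) ((dlin ^^ a) X) =
        ml (nd (Var v)) * coms (map Var vs) ((dlin ^^ Suc a) X)
        + coms (map Var vs) ((dlin ^^ a) (com X (ml (tang v))))"
      by (simp add: com_Var_decomp [OF Clin_a] coms_add coms_ml comm)
    moreover have "app (coms (map Var vs) ((dlin ^^ Suc a) X)) 1 \<in> loc"
      by (rule Cons.IH) (use Cons.prems in auto)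
    moreover have "app (coms (map Var vs) ((dlin ^^ a) (com X (ml (tang v))))) 1 \<in> loc"
    proof (rule Cons.IH)
      have "com X (ml (tang v)) = com X (ml (Var v)) + ml (- nd (Var v)) * dlin X"
        using com_Var_decomp [OF Clin, of X v] Cons.prems(1) by (simp add: ml_simps)
      moreover have "ord_lt N (Suc (length vs + a)) (dlin X)"
        by (rule ord_lt_lin) (use Cons.prems Clin in auto)
      moreover have "ord_lt N (Suc (length vs + a)) (com X (ml (Var v)))"
        using Cons.prems by (subst (asm) ord_lt_Suc) auto
      ultimately show "ord_lt N (Suc (length vs + a)) (com X (ml (tang v)))"
        by (simp add: ord_lt_add ord_lt_ml)
    qed (use Cons.prems closed in auto)
    ultimately show ?case
      by (simp add: loc_add loc_mult loc_Const nd_Var)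
  qed
  from this [of F vs 0] F vs show ?thesis by simp
qed

subsection \<open>Symmetric potentials\<close>

definition even_ops :: "endo set" where
  "even_ops = {X. Clin X \<and> dlin X = 0 \<and> (\<forall>f\<in>even_loc. app X f \<in> even_loc)}"

lemma even_ops_ml: "f \<in> even_loc \<Longrightarrow> ml f \<in> even_ops"
  by (simp add: even_ops_def Clin_intros even_loc.mult)

lemma even_ops_mult: "X \<in> even_ops \<Longrightarrow> Y \<in> even_ops \<Longrightarrow> X * Y \<in> even_ops"
  by (simp add: even_ops_def Clin_intros com_mult_left)

lemma even_ops_add: "X \<in> even_ops \<Longrightarrow> Y \<in> even_ops \<Longrightarrow> X + Y \<in> even_ops"
  by (simp add: even_ops_def Clin_intros com_add_left even_loc.add)

lemma even_ops_sum: "(\<And>i. i \<in> I \<Longrightarrow> X i \<in> even_ops) \<Longrightarrow> (\<Sum>i\<in>I. X i) \<in> even_ops"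
  using even_ops_ml [OF even_0]
  by (induction I rule: infinite_finite_induct) (simp_all add: ml_simps even_ops_add)

lemma even_ops_td: "v < N \<Longrightarrow> dop (td v) \<in> even_ops"
  by (simp add: even_ops_def Clin_intros derivation_td com_dop_ml ml_simps even_td)

text \<open>Formally the conjugate of \<open>nd\<close> by the power \<open>lin^\<kappa>\<close>,
  which is not a rational function for a general complex \<kappa>.\<close>

definition Ynd :: "complex \<Rightarrow> endo" where "Ynd \<kappa> = dop nd - ml (Const \<kappa> / lin)"

lemma even_calculus: "even_calculus (ml lin) (ml (inverse lin)) (Ynd \<kappa>) (ml (Const (2 * \<kappa>))) even_ops"
proof
  show "ml lin * ml (inverse lin) = 1" "ml (inverse lin) * ml lin = 1"
    by (simp_all flip: ml_simps)
  have *: "com (dop nd) (ml lin) = 1"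
    by (simp add: com_dop_ml derivation_nd ml_simps)
  then show "Ynd \<kappa> * ml lin = ml lin * Ynd \<kappa> + 1"
    using com_ml_ml [of "Const \<kappa> / lin" lin] by (simp add: Ynd_def com_def algebra_simps)
  show "ml (Const (2 * \<kappa>)) * ml lin = ml lin * ml (Const (2 * \<kappa>))"
    by (simp add: mult.commute flip: ml_simps)
  have "com (Ynd \<kappa>) (ml (Const (2 * \<kappa>))) = 0"
    unfolding Ynd_def by (intro Clin_com Clin_intros derivation_nd)
  then show "ml (Const (2 * \<kappa>)) * Ynd \<kappa> = Ynd \<kappa> * ml (Const (2 * \<kappa>))"
    by (simp add: com_eq_0_iff)
  show "ml (Const (2 * \<kappa>)) * X = X * ml (Const (2 * \<kappa>))" if "X \<in> even_ops" for X
    using that Clin_com [of X "2 * \<kappa>"] by (simp add: even_ops_def com_eq_0_iff)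
  show "1 \<in> even_ops" using even_ops_ml [OF even_1] by (simp add: ml_simps)
  show "- X \<in> even_ops" if "X \<in> even_ops" for X
    using even_ops_mult [OF even_ops_ml [OF even_loc.const [of "- 1"]] that] by (simp add: Const_simps ml_simps)
  show "ml (Const (2 * \<kappa>)) \<in> even_ops" by (intro even_ops_ml even_loc.const)
  show "ml lin * ml lin \<in> even_ops" using even_ops_ml [OF even_loc.lin2] by (simp add: ml_simps)
  show "X * ml lin = ml lin * X" if "X \<in> even_ops" for X
    using that by (simp add: even_ops_def com_eq_0_iff)
  show "\<exists>X'\<in>even_ops. Ynd \<kappa> * X = X * Ynd \<kappa> + ml lin * X'" if X: "X \<in> even_ops" for X
  proof
    \<comment> \<open>The normal derivatives of \<open>f\<close> and of \<open>app X f\<close> are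
      both divisible by \<open>lin\<close>, and \<open>X\<close> commutes with \<open>lin\<close>.
      So the commutator of \<open>nd\<close> and \<open>X\<close> sends even functions to odd ones
      and can be divided by \<open>lin\<close>.\<close>
    define X' where "X' = ml (inverse lin) * com (dop nd) X"
    have Xl0: "dlin X = 0" using X by (simp add: even_ops_def)
    have Xl: "app X (lin * f) = lin * app X f" for f
      using arg_cong [OF Xl0, of "\<lambda>X. app X f"] by (simp only: app_com app_ml) simp
    have "com X (ml (inverse lin)) = 0"
    proof (rule endo_eqI)
      fix f
      have "app X (lin * (inverse lin * f)) = lin * app X (inverse lin * f)" by (rule Xl)
      then show "app (com X (ml (inverse lin))) f = app 0 f"
        by (simp add: app_com flip: mult.assoc)
    qed
    moreover have "Const \<kappa> / lin = Const \<kappa> * inverse lin" by (simp add: divide_inverse)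
    ultimately have "com X (ml (Const \<kappa> / lin)) = 0"
      using X by (simp add: even_ops_def ml_simps com_mult_right Clin_com)
    then have "com (Ynd \<kappa>) X = com (dop nd) X"
      by (simp add: Ynd_def com_diff_left) (simp add: com_def)
    also have "\<dots> = ml lin * X'"
      by (simp add: X'_def flip: mult.assoc ml_simps(2)) (simp add: ml_simps)
    finally show "Ynd \<kappa> * X = X * Ynd \<kappa> + ml lin * X'"
      by (simp add: com_def algebra_simps)
    show "X' \<in> even_ops"
      unfolding even_ops_def
    proof (intro CollectI conjI ballI)
      show "Clin X'"
        unfolding X'_def using X by (auto simp: even_ops_def intro!: Clin_intros Clin_com_closed derivation_nd)
      have "dlin (com (dop nd) X) = com (com (dop nd) (ml lin)) X + com (dop nd) (dlin X)"
        by (simp add: com_def algebra_simps)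
      then have "dlin (com (dop nd) X) = 0" by (simp add: * Xl0)
      then show "dlin X' = 0" by (simp add: X'_def com_mult_left)
      fix f assume f: "f \<in> even_loc"
      then have Xf: "app X f \<in> even_loc" using X by (simp add: even_ops_def)
      obtain g where g: "g \<in> even_loc" "nd f = lin * g" using even_nd f by blast
      obtain g' where g': "g' \<in> even_loc" "nd (app X f) = lin * g'" using even_nd Xf by blast
      have "app X' f = g' - app X g"
        by (simp add: X'_def app_com derivation_nd g g' Xl flip: right_diff_distrib mult.assoc)
      moreover have "app X g \<in> even_loc" using X g by (simp add: even_ops_def)
      ultimately show "app X' f \<in> even_loc" using g' by (simp add: even_diff)
    qed
  qed
  show "X = 0" if "n > 0" "of_nat n * X = 0" for n and X :: endo
  proof (rule endo_eqI)
    fix f show "app X f = app 0 f"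
      using arg_cong [OF that(2), of "\<lambda>X. app X f"] that(1) by simp
  qed
qed (simp_all add: even_ops_add even_ops_mult)

lemma symmetric_regular:
  assumes L: "\<And>f. app L f = (\<Sum>v<N. rat_deriv v (rat_deriv v f)) + (Const \<gamma> / lin\<^sup>2 + R) * f"
    and R: "R \<in> even_loc" and p: "p \<in> even_loc"
    and vs: "set vs \<subseteq> {..<N}" and ord: "ord_lt N (Suc (length vs)) ((com L ^^ k) (ml p))"
  shows "app (coms (map Var vs) ((com L ^^ k) (ml p))) 1 \<in> loc"
proof -
  \<comment> \<open>\<kappa> has to solve
    \<open>nrm * (\<kappa> * \<kappa> - \<kappa>) = - \<gamma>\<close>, because the normal part of
    the Laplacian is \<open>nrm\<close> times the square of \<open>nd\<close>; \<open>s\<close> is a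
    root of the discriminant.\<close>
  obtain s where s: "s\<^sup>2 = 1 - 4 * (\<gamma> / nrm)" using power2_csqrt by blast
  define \<kappa> where "\<kappa> = (1 + s) / 2"
  have "\<kappa> * \<kappa> - \<kappa> = (s\<^sup>2 - 1) / 4"
    by (simp add: \<kappa>_def field_simps power2_eq_square)
  then have \<kappa>: "\<gamma> = - nrm * (\<kappa> * \<kappa> - \<kappa>)"
    by (simp add: s)
  interpret even_calculus "ml lin" "ml (inverse lin)" "Ynd \<kappa>" "ml (Const (2 * \<kappa>))" even_ops
    by (rule even_calculus)
  have Y: "app (Ynd \<kappa>) f = nd f - Const \<kappa> / lin * f" for f
    by (simp add: Ynd_def derivation_nd)
  have T_app: "app T f = nd (nd f) - Const (\<kappa> * \<kappa> - \<kappa>) / lin\<^sup>2 * f" for f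
    unfolding T_def app_simps app_ml Y
    by (simp add: derivation_simps [OF derivation_nd] derivation_divide [OF derivation_nd] Const_simps)
      (simp add: field_simps power2_eq_square)
  have "L = ml (Const nrm) * T + ((\<Sum>v<N. dop (td v) * dop (td v)) + ml R)"
  proof (rule endo_eqI)
    fix f
    show "app L f = app (ml (Const nrm) * T + ((\<Sum>v<N. dop (td v) * dop (td v)) + ml R)) f"
      unfolding app_simps app_ml L laplacian_decomp T_app app_sum
      by (simp add: derivation_td \<kappa> Const_simps) (simp add: field_simps power2_eq_square)
  qed
  also have "\<dots> \<in> C"
    by (intro C_add C_A_mult C_T C_A even_ops_add even_ops_ml even_ops_sum even_ops_mult even_ops_td
      even_loc.const R) auto
  finally have LC: "L \<in> C" .
  have Clin_C: "Clin X" if "X \<in> C" for X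
  proof -
    have Y: "Clin (Ynd \<kappa>)" unfolding Ynd_def by (intro Clin_intros derivation_nd)
    then have "Clin T" unfolding T_def by (intro Clin_intros)
    then have T: "Clin (T ^ n)" for n by (induction n) (auto intro: Clin_intros)
    from that show ?thesis
    proof (induction rule: C.induct)
      case (add X Z i)
      then show ?case
        using Y T by (auto simp: E_def Z_def even_ops_def intro!: Clin_intros)
    qed (rule Clin_intros)
  qed
  show ?thesis
  proof (rule loc_symbol [where S = C])
    show "com X (ml (tang v)) \<in> C" if "X \<in> C" for X v
      by (rule C_com [OF that C_A [OF even_ops_ml [OF even_loc.tang]]])
    show "(com L ^^ k) (ml p) \<in> C"
      by (intro C_com_funpow LC C_A even_ops_ml p)
    fix X a assume "X \<in> C" "(dlin ^^ Suc a) X = 0"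
    then have "(dlin ^^ a) X \<in> even_ops \<union> (\<lambda>y. ml lin * y) ` even_ops"
      by (rule C_top_coeff)
    moreover have "app Z 1 \<in> loc" if "Z \<in> even_ops" for Z
      using that even_1 by (auto simp: even_ops_def intro: even_imp_loc)
    ultimately show "app ((dlin ^^ a) X) 1 \<in> loc"
      using loc_mult [OF loc_lin] by auto
  qed (use Clin_C ord vs in auto)
qed

subsection \<open>Quasi-invariant potentials\<close>

definition quasi_loc :: "crat set" where "quasi_loc = {f \<in> loc. nd f \<in> loc_ideal}"

definition quasi_ops :: "endo set" where
  "quasi_ops = {X. Clin X \<and> (\<forall>f\<in>quasi_loc. lin * app X (inverse lin * f) \<in> quasi_loc)}"

lemma quasi_add: "f \<in> quasi_loc \<Longrightarrow> g \<in> quasi_loc \<Longrightarrow> f + g \<in> quasi_loc"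
  and quasi_diff: "f \<in> quasi_loc \<Longrightarrow> g \<in> quasi_loc \<Longrightarrow> f - g \<in> quasi_loc"
  and quasi_mult: "f \<in> quasi_loc \<Longrightarrow> g \<in> quasi_loc \<Longrightarrow> f * g \<in> quasi_loc"
  by (auto simp: quasi_loc_def derivation_simps [OF derivation_nd]
      intro: loc_add loc_diff loc_mult ideal_add ideal_diff ideal_mult ideal_mult_left)

lemma quasi_ops_com: "X \<in> quasi_ops \<Longrightarrow> Y \<in> quasi_ops \<Longrightarrow> com X Y \<in> quasi_ops"
proof -
  assume X: "X \<in> quasi_ops" and Y: "Y \<in> quasi_ops"
  have "lin * app X (app Y (inverse lin * f)) \<in> quasi_loc"
    if "X \<in> quasi_ops" "Y \<in> quasi_ops" "f \<in> quasi_loc" for X Y f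
  proof -
    have "lin * app X (inverse lin * (lin * app Y (inverse lin * f))) \<in> quasi_loc"
      using that by (auto simp: quasi_ops_def)
    then show ?thesis by (simp flip: mult.assoc)
  qed
  with X Y show ?thesis
    by (auto simp: quasi_ops_def app_com right_diff_distrib intro!: Clin_com_closed quasi_diff)
qed

lemma quasi_ops_ml: "f \<in> quasi_loc \<Longrightarrow> ml f \<in> quasi_ops"
  using quasi_mult by (force simp: quasi_ops_def Clin_intros mult_ac)

text \<open>If \<open>X\<close> preserves \<open>quasi_loc\<close>, then \<open>lin\<^sup>-\<^sup>1 nd X (lin nd - 1)\<close> preserves \<open>loc\<close>, and its symbol is
  that of \<open>X\<close> multiplied by the square of the symbol of \<open>nd\<close>.\<close>

lemma quasi_top_coeff:
  assumes X: "X \<in> quasi_ops" and top: "(dlin ^^ Suc a) X = 0"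
  shows "app ((dlin ^^ a) X) 1 \<in> loc"
proof -
  define P where "P = ml (inverse lin) * dop nd"
  define Q where "Q = ml lin * dop nd - 1"
  define W where "W = ml lin * X * ml (inverse lin)"
  have dnd: "dlin (dop nd) = 1"
    by (simp add: com_dop_ml derivation_nd ml_simps)
  have P: "(dlin ^^ 1) P = ml (inverse lin)" "(dlin ^^ Suc 1) P = 0"
    and Q: "(dlin ^^ 1) Q = ml lin" "(dlin ^^ Suc 1) Q = 0"
    by (simp_all add: P_def Q_def com_mult_left com_diff_left dnd)
  have W: "(dlin ^^ n) W = ml lin * (dlin ^^ n) X * ml (inverse lin)" for n
    unfolding W_def by (induction n) (simp_all add: com_mult_left)
  then have W0: "(dlin ^^ Suc a) W = 0" using top by (simp del: funpow.simps)
  note PW = dlin.funpow_mult_top [OF P(2) W0]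
  note PWQ = dlin.funpow_mult_top [OF conjunct2 [OF PW] Q(2)]
  define H where "H = P * W * Q"
  have canc: "ml lin * ml (inverse lin) = 1" "ml (inverse lin) * ml lin = 1"
    by (simp_all flip: ml_simps)
  \<comment> \<open>The top commutators of \<open>P\<close>, \<open>W\<close> and \<open>Q\<close>
    carry the factors \<open>inverse lin\<close>, \<open>lin\<close> and \<open>inverse lin\<close>,
    and \<open>lin\<close>, which all cancel. Up to a positive integer \<open>H\<close> has the same
    top coefficient as \<open>X\<close>.\<close>
  have "(dlin ^^ (a + 2)) H = of_nat ((1 + a + 1) choose (1 + a)) *
      (of_nat ((1 + a) choose 1) * (ml (inverse lin) * (ml lin * (dlin ^^ a) X * ml (inverse lin))) * ml lin)"
    using conjunct1 [OF PWQ] unfolding H_def conjunct1 [OF PW] P(1) Q(1) W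
    by (simp del: funpow.simps add: numeral_2_eq_2 add.commute)
  also have "\<dots> = of_nat ((1 + a + 1) choose (1 + a)) * (of_nat ((1 + a) choose 1) *
      ((ml (inverse lin) * ml lin) * (dlin ^^ a) X * (ml (inverse lin) * ml lin)))"
    by (simp only: mult.assoc)
  also have "\<dots> = of_nat (((1 + a + 1) choose (1 + a)) * ((1 + a) choose 1)) * (dlin ^^ a) X"
    by (simp only: canc mult_1_left mult_1_right of_nat_mult mult.assoc)
  finally obtain n where n: "n > 0" and eq: "(dlin ^^ (a + 2)) H = of_nat n * (dlin ^^ a) X"
    by (metis zero_less_binomial_iff le_add1 nat_0_less_mult_iff)
  have H: "app H f \<in> loc" if "f \<in> loc" for f
  proof -
    \<comment> \<open>In the normal derivative the terms \<open>nd f\<close> cancel and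
      \<open>lin * nd (nd f)\<close> remains. So \<open>Q\<close> turns any regular function into an
      admissible one, and \<open>P\<close> can divide the derivative of the result by
      \<open>lin\<close>.\<close>
    have "lin * nd f - f \<in> quasi_loc"
      using that by (auto simp: quasi_loc_def derivation_simps [OF derivation_nd]
        intro!: loc_diff loc_mult loc_lin loc_nd ideal_lin)
    then have "lin * app X (inverse lin * (lin * nd f - f)) \<in> quasi_loc"
      using X by (simp add: quasi_ops_def)
    then obtain g where "g \<in> loc" "nd (lin * app X (inverse lin * (lin * nd f - f))) = lin * g"
      by (auto simp: quasi_loc_def loc_ideal_def)
    then show ?thesis
      by (simp add: H_def P_def W_def Q_def derivation_nd flip: mult.assoc)
  qed
  have "app ((dlin ^^ n) H) f \<in> loc" if "f \<in> loc" for n f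
    using that by (induction n arbitrary: f) (simp_all add: H app_com loc_diff loc_mult loc_lin)
  from this [of 1 "a + 2"] loc_numeral(2)
  have "of_nat n * app ((dlin ^^ a) X) 1 \<in> loc"
    unfolding eq by simp
  then have "Const (inverse (of_nat n)) * (of_nat n * app ((dlin ^^ a) X) 1) \<in> loc"
    by (rule loc_mult [OF loc_Const])
  with n show ?thesis
    by (simp add: Const_inverse flip: mult.assoc)
qed

lemma quasi_regular:
  assumes L: "\<And>f. app L f = (\<Sum>v<N. rat_deriv v (rat_deriv v f)) + (- 2 * Const nrm / lin\<^sup>2 + R) * f"
    and R: "R \<in> quasi_loc" and p: "p \<in> quasi_loc"
    and vs: "set vs \<subseteq> {..<N}" and ord: "ord_lt N (Suc (length vs)) ((com L ^^ k) (ml p))"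
  shows "app (coms (map Var vs) ((com L ^^ k) (ml p))) 1 \<in> loc"
proof -
  \<comment> \<open>Conjugation by \<open>lin\<close> turns the square of \<open>nd\<close> into
    itself minus \<open>2 / lin\<close> times \<open>nd\<close> plus \<open>2 / lin\<^sup>2\<close>;
    the last term cancels the singular potential.\<close>
  have gauge: "lin * app L (inverse lin * f) =
      Const nrm * (nd (nd f) - 2 * nd f / lin) + (\<Sum>v<N. td v (td v f)) + R * f" for f
  proof -
    have 1: "lin * nd (nd (inverse lin * f)) = nd (nd f) - 2 * nd f / lin + 2 / lin\<^sup>2 * f"
      by (simp add: derivation_simps [OF derivation_nd] derivation_inverse [OF derivation_nd]
          derivation_divide [OF derivation_nd] derivation_power [OF derivation_nd])
        (simp add: field_simps power2_eq_square power4_eq_xxxx)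
    have "td v (td v (inverse lin * f)) = inverse lin * td v (td v f)" if "v < N" for v
      using that by (simp add: derivation_simps [OF derivation_td] derivation_inverse [OF derivation_td])
    then have 2: "lin * (\<Sum>v<N. td v (td v (inverse lin * f))) = (\<Sum>v<N. td v (td v f))"
      by (simp add: sum_distrib_left flip: mult.assoc)
    have "lin * app L (inverse lin * f) = Const nrm * (lin * nd (nd (inverse lin * f)))
        + lin * (\<Sum>v<N. td v (td v (inverse lin * f))) + (- 2 * Const nrm / lin\<^sup>2 + R) * f"
      by (simp add: L laplacian_decomp) (simp add: field_simps)
    also have "\<dots> = Const nrm * (nd (nd f) - 2 * nd f / lin) + (\<Sum>v<N. td v (td v f)) + R * f"
      unfolding 1 2 by (simp add: field_simps)
    finally show ?thesis .
  qed
  have LQ: "L \<in> quasi_ops"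
    unfolding quasi_ops_def
  proof (intro CollectI conjI ballI)
    have "L = (\<Sum>v<N. dop (rat_deriv v) * dop (rat_deriv v)) + ml (- 2 * Const nrm / lin\<^sup>2 + R)"
      by (rule endo_eqI) (simp add: L app_sum derivation_rat_deriv)
    then show "Clin L" by (auto intro!: Clin_intros Clin_sum derivation_rat_deriv)
    fix f assume f: "f \<in> quasi_loc"
    then obtain g where g: "g \<in> loc" "nd f = lin * g" by (auto simp: quasi_loc_def loc_ideal_def)
    have floc: "f \<in> loc" using f by (simp add: quasi_loc_def)
    have "nd (nd f) - 2 * nd f / lin = lin * nd g - g"
      by (simp add: g derivation_mult [OF derivation_nd])
    \<comment> \<open>The same cancellation of first derivatives as for \<open>Q\<close> above: the
      normal derivative is \<open>lin * nd (nd g)\<close>.\<close>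
    moreover have "lin * nd g - g \<in> quasi_loc"
      using g by (auto simp: quasi_loc_def derivation_simps [OF derivation_nd]
        intro!: loc_diff loc_mult loc_lin loc_nd ideal_lin)
    ultimately have "Const nrm * (nd (nd f) - 2 * nd f / lin) \<in> quasi_loc"
      by (auto simp: quasi_loc_def derivation_Const_mult [OF derivation_nd] loc_mult loc_Const ideal_mult_left)
    moreover have td: "(\<Sum>v<N. td v (td v f)) \<in> quasi_loc"
    proof -
      have "nd (td v (td v f)) = lin * td v (td v g)" if "v < N" for v
        using that by (simp add: nd_td g derivation_mult [OF derivation_td])
      then have "nd (\<Sum>v<N. td v (td v f)) = lin * (\<Sum>v<N. td v (td v g))"
        by (simp add: derivation_sum [OF derivation_nd] sum_distrib_left)
      then show ?thesis
        using floc g by (auto simp: quasi_loc_def intro!: loc_sum loc_td ideal_lin)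
    qed
    ultimately show "lin * app L (inverse lin * f) \<in> quasi_loc"
      unfolding gauge using quasi_mult [OF R f] by (intro quasi_add)
  qed
  have tang: "tang v \<in> quasi_loc" for v
    using even_imp_loc [OF even_loc.tang [of v]] by (simp add: quasi_loc_def ideal_0)
  show ?thesis
  proof (rule loc_symbol [where S = quasi_ops])
    show "com X (ml (tang v)) \<in> quasi_ops" if "X \<in> quasi_ops" for X v
      using that by (intro quasi_ops_com quasi_ops_ml tang)
    show "(com L ^^ k) (ml p) \<in> quasi_ops"
      by (induction k) (auto intro: quasi_ops_com quasi_ops_ml p LQ)
  qed (use quasi_top_coeff ord vs in \<open>auto simp: quasi_ops_def\<close>)
qed

end

lemma Clin_com_funpow: "Clin X \<Longrightarrow> Clin Y \<Longrightarrow> Clin ((com X ^^ k) Y)"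
  by (induction k) (simp_all add: Clin_com_closed)

section \<open>Rational functions with denominators from a given set\<close>

definition regular_off :: "crat set \<Rightarrow> crat set" where
  "regular_off D = {f. \<exists>fs. set fs \<subseteq> D \<and> f * prod_list fs \<in> polynomials}"

lemma polynomials_regular_off: "f \<in> polynomials \<Longrightarrow> f \<in> regular_off D"
  unfolding regular_off_def by (intro CollectI exI [of _ "[]"]) simp

lemma prod_list_polynomials:
  "D \<subseteq> polynomials \<Longrightarrow> set fs \<subseteq> D \<Longrightarrow> prod_list fs \<in> polynomials"
  using polynomials_closed(1) [of 1] by (induction fs) (auto intro!: polynomials_closed)

lemma regular_off_closed:
  assumes D: "D \<subseteq> polynomials" and f: "f \<in> regular_off D"
  shows "g \<in> regular_off D \<Longrightarrow> f + g \<in> regular_off D"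
    and "g \<in> regular_off D \<Longrightarrow> f * g \<in> regular_off D"
    and "rat_deriv v f \<in> regular_off D"
proof -
  obtain fs where fs: "set fs \<subseteq> D" "f * prod_list fs \<in> polynomials"
    using f by (auto simp: regular_off_def)
  note fs' = prod_list_polynomials [OF D fs(1)]
  show "f + g \<in> regular_off D" if g: "g \<in> regular_off D"
  proof -
    obtain gs where gs: "set gs \<subseteq> D" "g * prod_list gs \<in> polynomials"
      using g by (auto simp: regular_off_def)
    have "(f + g) * prod_list (fs @ gs) =
        f * prod_list fs * prod_list gs + g * prod_list gs * prod_list fs"
      by (simp add: algebra_simps)
    moreover have "\<dots> \<in> polynomials"
      by (intro polynomials_closed fs gs fs' prod_list_polynomials [OF D gs(1)])
    ultimately show ?thesis
      using fs gs unfolding regular_off_def by (intro CollectI exI [of _ "fs @ gs"]) simp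
  qed
  show "f * g \<in> regular_off D" if g: "g \<in> regular_off D"
  proof -
    obtain gs where gs: "set gs \<subseteq> D" "g * prod_list gs \<in> polynomials"
      using g by (auto simp: regular_off_def)
    have "(f * g) * prod_list (fs @ gs) = (f * prod_list fs) * (g * prod_list gs)"
      by (simp add: algebra_simps)
    moreover have "\<dots> \<in> polynomials"
      by (intro polynomials_closed fs gs)
    ultimately have "(f * g) * prod_list (fs @ gs) \<in> polynomials" by (simp only:)
    then show ?thesis
      using fs gs unfolding regular_off_def by (intro CollectI exI [of _ "fs @ gs"]) auto
  qed
  show "rat_deriv v f \<in> regular_off D"
  proof -
    let ?P = "prod_list fs"
    have "rat_deriv v f * prod_list (fs @ fs) = rat_deriv v (f * ?P) * ?P + Const (- 1) * ((f * ?P) * rat_deriv v ?P)"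
      by (simp add: rat_deriv_mult Const_minus algebra_simps)
    moreover have "\<dots> \<in> polynomials"
      by (intro polynomials_closed fs fs')
    ultimately show ?thesis
      using fs unfolding regular_off_def by (intro CollectI exI [of _ "fs @ fs"]) simp
  qed
qed

lemma regular_off_inverse: "d \<in> D \<Longrightarrow> inverse d \<in> regular_off D"
  unfolding regular_off_def using polynomials_closed(1) [of 1] polynomials_closed(1) [of 0]
  by (cases "d = 0") (auto intro!: exI [of _ "[d]"])

text \<open>The denominator is stripped one linear form at a time: \<open>f\<close> times the
  remaining forms is regular along the form to be removed, so that form divides the
  numerator.\<close>

lemma regular_off_polynomial:
  assumes f: "f \<in> regular_off D" and D: "D \<subseteq> polynomials"
    and loc: "\<And>d. d \<in> D \<Longrightarrow> \<exists>N h. hyperplane N h \<and> d = hyperplane.lin N h \<and> f \<in> hyperplane.loc N h"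
  shows "f \<in> polynomials"
proof -
  obtain fs where fs: "set fs \<subseteq> D" "f * prod_list fs \<in> polynomials"
    using f by (auto simp: regular_off_def)
  then show ?thesis
  proof (induction fs)
    case (Cons d fs)
    then obtain N h where h: "hyperplane N h" "d = hyperplane.lin N h" "f \<in> hyperplane.loc N h"
      using loc [of d] by auto
    interpret hyperplane N h by (rule h)
    have "f * prod_list fs \<in> polynomials"
    proof (rule polynomials_gluing)
      show "f * prod_list fs \<in> loc"
        using Cons.prems by (intro loc_mult h polynomials_loc prod_list_polynomials [OF D]) auto
      show "f * prod_list fs * lin \<in> polynomials"
        using Cons.prems by (simp add: h(2) mult_ac)
    qed
    with Cons show ?case by simp
  qed simp
qed

section \<open>The Calogero--Moser operator with three masses\<close>

text \<open>\<open>td v\<close> kills \<open>lin\<close> and hence preserves the ideal, which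
  contains no nonzero constant. One tangential derivative thus shows that a linear form is not a
  multiple of \<open>lin\<close>.\<close>

lemma (in hyperplane) unit_td:
  assumes "v < N" "td v f = Const c" "c \<noteq> 0"
  shows "f \<notin> loc_ideal"
proof
  assume "f \<in> loc_ideal"
  then obtain g where "g \<in> loc" "f = lin * g" by (auto simp: loc_ideal_def)
  then have "td v f \<in> loc_ideal"
    using assms(1) by (simp add: derivation_mult [OF derivation_td] ideal_lin loc_td)
  with assms unit_Const show False by simp
qed

text \<open>In the application \<open>M\<close> is the product of the three masses and
  \<open>K\<close> the common value of \<open>(m * (2 * l + 1))\<^sup>2\<close>. Since the three
  masses add up to zero, the sum of two distinct ones is minus the third, whence
  \<open>mass_pair\<close>; \<open>mass_sum\<close> keeps the hyperplanes non-isotropic.\<close>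

locale particles =
  fixes N :: nat and w :: "nat \<Rightarrow> complex" and M K :: complex
  assumes w_nz: "v < N \<Longrightarrow> w v \<noteq> 0"
    and mass_sum: "v < N \<Longrightarrow> v' < N \<Longrightarrow> (w v)\<^sup>2 + (w v')\<^sup>2 \<noteq> 0"
    and mass_pair: "v < N \<Longrightarrow> v' < N \<Longrightarrow> (w v)\<^sup>2 \<noteq> (w v')\<^sup>2 \<Longrightarrow>
      ((w v)\<^sup>2 + (w v')\<^sup>2) * ((w v)\<^sup>2 * (w v')\<^sup>2) = - M"
begin

definition m :: "nat \<Rightarrow> complex" where "m v = (w v)\<^sup>2"
definition u :: "nat \<Rightarrow> crat" where "u v = Const (w v) * Var v"
definition A :: "nat \<Rightarrow> crat" where "A v = (u v)\<^sup>2"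
text \<open>The potentials of both signs,
  \<open>2 / (u - u')\<^sup>2 + 2 / (u + u')\<^sup>2\<close>, over a common denominator: only
  squares enter.\<close>

definition G :: "nat \<Rightarrow> nat \<Rightarrow> crat" where
  "G v v' = Const (M / (m v * m v')) * (4 * (A v + A v') / (A v - A v')\<^sup>2)"
text \<open>For \<open>K = (m * (2 * l + 1))\<^sup>2\<close> the coefficient is
  \<open>- m * l * (l + 1)\<close>, the wall coupling in the coordinate \<open>u\<close>. Written
  through \<open>K\<close>, it depends on the particle only through its mass.\<close>

definition B :: "nat \<Rightarrow> crat" where
  "B v = Const (m v / 4 - K / (4 * m v)) / A v"
definition pairs :: "(nat \<times> nat) set" where
  "pairs = {(v, v'). v < N \<and> v' < N \<and> v \<noteq> v'}"

text \<open>Every unordered pair is counted twice in the first sum.\<close>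

definition V :: crat where
  "V = Const (1 / 2) * (\<Sum>(v, v')\<in>pairs. G v v') + (\<Sum>v<N. B v)"
definition LP :: endo where
  "LP = (\<Sum>v<N. dop (rat_deriv v) * dop (rat_deriv v)) + ml V"
definition P :: "nat \<Rightarrow> crat" where
  "P d = (\<Sum>v<N. Const (1 / m v) * A v ^ d)"

lemma m_nz: "v < N \<Longrightarrow> m v \<noteq> 0"
  by (simp add: m_def w_nz)

lemma finite_pairs [simp]: "finite pairs"
  by (rule finite_subset [of _ "{..<N} \<times> {..<N}"]) (auto simp: pairs_def)

lemma G_commute: "G v v' = G v' v"
  unfolding G_def by (simp add: power2_commute [of "A v"] add.commute [of "A v"] mult.commute [of "m v"])

lemma app_LP: "app LP f = (\<Sum>v<N. rat_deriv v (rat_deriv v f)) + V * f"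
  by (simp add: LP_def app_sum derivation_rat_deriv)

lemma Clin_LP: "Clin LP"
  unfolding LP_def by (intro Clin_intros Clin_sum derivation_rat_deriv)

definition forms :: "crat set" where
  "forms = u ` {..<N} \<union> {u v + Const e * u v' | v v' e. v < N \<and> v' < N \<and> v \<noteq> v' \<and> e \<in> {1, - 1}}"

lemma u_polynomial: "u v \<in> polynomials"
  unfolding u_def by (intro polynomials_closed)

lemma forms_polynomials: "forms \<subseteq> polynomials"
  unfolding forms_def by (auto intro!: polynomials_closed u_polynomial)

lemmas off_closed = regular_off_closed [OF forms_polynomials]

lemma off_sum: "(\<And>i. i \<in> I \<Longrightarrow> g i \<in> regular_off forms) \<Longrightarrow> (\<Sum>i\<in>I. g i) \<in> regular_off forms"
  using polynomials_regular_off [OF polynomials_closed(1) [of 0]]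
  by (induction I rule: infinite_finite_induct) (simp_all add: off_closed)

lemma off_Const: "Const c \<in> regular_off forms"
  by (intro polynomials_regular_off polynomials_closed)

lemma off_A: "A v \<in> regular_off forms"
  unfolding A_def power2_eq_square by (intro polynomials_regular_off polynomials_closed u_polynomial)

lemma A_diff: "A v - A v' = (u v + Const 1 * u v') * (u v + Const (- 1) * u v')"
  by (simp add: A_def Const_minus algebra_simps power2_eq_square)

lemma off_V: "V \<in> regular_off forms"
proof -
  have "inverse (A v) \<in> regular_off forms" if "v < N" for v
    unfolding A_def power2_eq_square inverse_mult_distrib using that
    by (intro off_closed regular_off_inverse) (auto simp: forms_def)
  moreover have "inverse (A v - A v') \<in> regular_off forms" if "(v, v') \<in> pairs" for v v'
    unfolding A_diff inverse_mult_distrib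
    by (intro off_closed regular_off_inverse; use that in \<open>force simp: forms_def pairs_def\<close>)
  ultimately show ?thesis
    unfolding V_def G_def B_def divide_inverse power2_eq_square inverse_mult_distrib
    using off_Const [of 4]
    by (auto intro!: off_closed off_sum off_Const off_A)
qed

text \<open>Differentiation creates no new poles, so the only possible ones are those of
  \<open>V\<close>, along \<open>forms\<close>; regularity there will suffice.\<close>

lemma off_operator:
  assumes "f \<in> regular_off forms"
  shows "app (coms (map Var vs) ((com LP ^^ k) (ml (P d)))) f \<in> regular_off forms"
proof -
  define pres where "pres X \<longleftrightarrow> (\<forall>f\<in>regular_off forms. app X f \<in> regular_off forms)" for X
  have minus: "- f \<in> regular_off forms" if "f \<in> regular_off forms" for f
    using off_closed(2) [OF off_Const [of "- 1"] that] by (simp add: Const_minus)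
  have com: "pres (com X Y)" if "pres X" "pres Y" for X Y
    using that off_closed(1) [OF _ minus]
    by (auto simp: pres_def app_com diff_conv_add_uminus simp del: add_uminus_conv_diff)
  have ml: "pres (ml g)" if "g \<in> regular_off forms" for g
    using that by (auto simp: pres_def intro: off_closed)
  have "A v ^ k \<in> regular_off forms" for v k
    using off_Const [of 1] by (induction k) (auto intro: off_closed off_A)
  then have "pres (ml (P d))"
    unfolding P_def by (intro ml off_sum off_closed off_Const)
  moreover have "pres LP"
    by (auto simp: pres_def app_LP intro!: off_closed off_sum off_V)
  ultimately have "pres ((com LP ^^ k) (ml (P d)))"
    by (induction k) (auto intro: com)
  moreover have "pres (coms (map Var vs) X)" if "pres X" for X
    using that
    by (induction vs arbitrary: X)
      (auto intro!: com ml polynomials_regular_off polynomials_closed)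
  ultimately have "pres (coms (map Var vs) ((com LP ^^ k) (ml (P d))))"
    by blast
  with assms show ?thesis by (auto simp: pres_def)
qed

section \<open>Homogeneity and order of the iterated commutators\<close>

lemma euler_u: "v < N \<Longrightarrow> euler N (u v) = u v"
proof -
  assume v: "v < N"
  have "euler N (Var v) = (\<Sum>x<N. if x = v then Var v else 0)"
    unfolding euler_def by (rule sum.cong) (auto simp: rat_deriv_Var)
  with v show ?thesis
    by (simp add: u_def derivation_simps [OF derivation_euler])
qed

lemma euler_A: "v < N \<Longrightarrow> euler N (A v) = 2 * A v"
  by (simp add: A_def derivation_mult [OF derivation_euler] euler_u power2_eq_square)

lemma euler_V: "euler N V = - 2 * V"
proof -
  note D = derivation_simps [OF derivation_euler] derivation_divide [OF derivation_euler]
    derivation_power [OF derivation_euler]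
  have "euler N (G v v') = - 2 * G v v'" if "(v, v') \<in> pairs" for v v'
  proof (cases "A v - A v' = 0")
    case False
    have *: "euler N (4 * X / Y\<^sup>2) = - 2 * (4 * X / Y\<^sup>2)"
      if "euler N X = 2 * X" "euler N Y = 2 * Y" "Y \<noteq> 0" for X Y
      using that by (simp add: D) (simp add: field_simps power2_eq_square power4_eq_xxxx)
    show ?thesis
      unfolding G_def derivation_Const_mult [OF derivation_euler]
      using that by (subst * [OF _ _ False]) (auto simp: D euler_A pairs_def algebra_simps)
  qed (simp add: G_def D)
  moreover have "euler N (B v) = - 2 * B v" if "v < N" for v
    using that unfolding B_def by (cases "A v = 0") (simp_all add: D euler_A power2_eq_square)
  ultimately show ?thesis
    unfolding V_def D by (simp add: sum_distrib_left case_prod_unfold algebra_simps)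
qed

lemma com_euler_LP: "com (dop (euler N)) LP = - 2 * LP"
proof (rule endo_eqI)
  fix f
  have comm: "euler N (rat_deriv v g) - rat_deriv v (euler N g) = - rat_deriv v g" if "v < N" for v g
  proof -
    have E: "euler N (Var x) = (if x < N then Var x else 0)" for x
    proof -
      have "euler N (Var x) = (\<Sum>y<N. if y = x then Var x else 0)"
        unfolding euler_def by (rule sum.cong) (auto simp: rat_deriv_Var)
      then show ?thesis by simp
    qed
    have "derivation (\<lambda>g. - rat_deriv v g)"
      by (simp add: derivation_def rat_deriv_add rat_deriv_mult)
    note eqI = derivation_eqI [OF derivation_commutator [OF derivation_euler derivation_rat_deriv] this]
    have *: "euler N 1 = 0" "rat_deriv v 0 = 0"
      using derivation_Const [OF derivation_euler, of N 1] derivation_0 [OF derivation_rat_deriv] by simp_all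
    show ?thesis
      by (rule eqI) (use that in \<open>simp add: rat_deriv_Var E * derivation_0 [OF derivation_euler]\<close>)
  qed
  have "euler N (rat_deriv v (rat_deriv v f)) - rat_deriv v (rat_deriv v (euler N f))
      = - 2 * rat_deriv v (rat_deriv v f)" if "v < N" for v
    using comm [OF that, of "rat_deriv v f"] arg_cong [OF comm [OF that, of f], of "rat_deriv v"]
    unfolding derivation_diff [OF derivation_rat_deriv] derivation_minus [OF derivation_rat_deriv]
    by algebra
  then have "(\<Sum>v<N. euler N (rat_deriv v (rat_deriv v f)) - rat_deriv v (rat_deriv v (euler N f)))
      = (\<Sum>v<N. - 2 * rat_deriv v (rat_deriv v f))"
    by (intro sum.cong) auto
  moreover have "app (- 2 * LP) f = - 2 * app LP f"
    using app_of_nat [of 2 "app LP f"] by simp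
  ultimately show "app (com (dop (euler N)) LP) f = app (- 2 * LP) f"
    unfolding app_com app_dop [OF derivation_euler] app_LP derivation_add [OF derivation_euler]
      derivation_mult [OF derivation_euler] derivation_sum [OF derivation_euler] euler_V
      sum_subtractf sum_distrib_left [symmetric]
    by (simp only:) (simp add: algebra_simps)
qed

lemma euler_P: "euler N (P d) = of_nat (2 * d) * P d"
proof -
  have "euler N (A v ^ d) = of_nat (2 * d) * A v ^ d" if "v < N" for v
    unfolding derivation_power [OF derivation_euler] euler_A [OF that] by (cases d) simp_all
  then show ?thesis
    unfolding P_def by (simp add: derivation_simps [OF derivation_euler] sum_distrib_left algebra_simps)
qed

lemma com_euler_power:
  "com (dop (euler N)) ((com LP ^^ k) (ml (P d))) =
    ml (Const (of_nat (2 * d) - of_nat (2 * k))) * (com LP ^^ k) (ml (P d))"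
proof (induction k)
  case 0
  show ?case
    by (simp add: com_dop_ml derivation_euler euler_P ml_simps Const_mult)
next
  case (Suc k)
  define X where "X = (com LP ^^ k) (ml (P d))"
  define z :: complex where "z = of_nat (2 * d) - of_nat (2 * k)"
  have "com (dop (euler N)) (com LP X) = com (- 2 * LP) X + com LP (ml (Const z) * X)"
    using Suc by (simp add: com_jacobi com_euler_LP X_def z_def)
  also have "com LP (ml (Const z) * X) = ml (Const z) * com LP X"
    by (simp add: com_mult_right Clin_com Clin_LP)
  also have "com (- 2 * LP) X = ml (Const (- 2)) * com LP X"
  proof -
    have "ml (Const (- 2)) = - 2"
      using ml_of_nat [of 2] by (simp add: Const_minus ml_simps(4))
    then show ?thesis
      by (simp add: com_def mult_2 distrib_left distrib_right left_diff_distrib right_diff_distrib)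
  qed
  finally have "com (dop (euler N)) (com LP X) = ml (Const (z - 2)) * com LP X"
    by (simp add: Const_diff Const_minus ml_simps algebra_simps)
  then show ?case by (simp add: X_def z_def algebra_simps)
qed

text \<open>The second brackets of \<open>LP\<close> with coordinates are constant, so starting from
  a function each commutator raises the order by at most one.\<close>

lemma ord_lt_power: "ord_lt N (Suc k) ((com LP ^^ k) (ml (P d)))"
proof (induction k)
  case 0
  show ?case by (simp add: ord_lt_Suc ord_lt_zero)
next
  case (Suc k)
  have "\<exists>c. com (com LP (ml (Var v))) (ml (Var x)) = ml (Const c)" for v x
  proof -
    define \<delta> :: "nat \<Rightarrow> nat \<Rightarrow> complex" where "\<delta> y v = (if y = v then 1 else 0)" for y v
    have D: "com (dop (rat_deriv y)) (ml (Var v)) = ml (Const (\<delta> y v))" for y v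
      by (simp add: com_dop_ml derivation_rat_deriv rat_deriv_Var \<delta>_def)
    have "com (com LP (ml (Var v))) (ml (Var x)) = (\<Sum>y<N. ml (Const (2 * (\<delta> y v * \<delta> y x))))"
    proof -
      have "ml (Const p) * ml (Const q) + ml (Const q) * ml (Const p) = ml (Const (2 * (p * q)))" for p q
        unfolding ml_simps(1,2) [symmetric] Const_add [symmetric] Const_mult [symmetric]
        by (simp add: mult.commute)
      then show ?thesis
        unfolding LP_def com_add_left com_sum_left com_mult_left D com_ml_ml
        by (simp add: add.commute)
    qed
    also have "\<dots> = ml (Const (\<Sum>y<N. 2 * (\<delta> y v * \<delta> y x)))"
      by (induction N) (simp_all add: ml_simps Const_add)
    finally show ?thesis by blast
  qed
  then show ?case
    using Suc by (simp add: ord_lt_com_Suc Clin_com_closed Clin_LP Clin_intros Clin_com_funpow)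
qed

end

text \<open>Pairing \<open>x\<close> with \<open>\<sigma> x\<close> makes every term even at the
  price of counting the sum twice.\<close>

lemma (in hyperplane) even_symmetric_sum:
  assumes "bij_betw \<sigma> S S" "\<And>x. x \<in> S \<Longrightarrow> refl (f x) (f (\<sigma> x))"
  shows "(\<Sum>x\<in>S. f x) \<in> even_loc"
proof -
  have "(\<Sum>x\<in>S. f x + f (\<sigma> x)) \<in> even_loc"
    by (intro even_sum refl_sum_even assms(2))
  moreover have "(\<Sum>x\<in>S. f x + f (\<sigma> x)) = 2 * (\<Sum>x\<in>S. f x)"
    using sum.reindex_bij_betw [OF assms(1), of f] by (simp add: sum.distrib)
  ultimately have "Const (1 / 2) * (2 * (\<Sum>x\<in>S. f x)) \<in> even_loc"
    using even_loc.mult [OF even_loc.const] by metis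
  then show ?thesis by (simp add: Const_divide)
qed

lemma (in hyperplane) ideal_symmetric_sum:
  assumes "bij_betw \<sigma> S S" "\<And>x. x \<in> S \<Longrightarrow> nd (f x + f (\<sigma> x)) \<in> loc_ideal"
  shows "nd (\<Sum>x\<in>S. f x) \<in> loc_ideal"
proof -
  have "(\<Sum>x\<in>S. nd (f x + f (\<sigma> x))) \<in> loc_ideal"
    by (intro ideal_sum assms(2))
  moreover have "(\<Sum>x\<in>S. nd (f x + f (\<sigma> x))) = 2 * nd (\<Sum>x\<in>S. f x)"
    using sum.reindex_bij_betw [OF assms(1), of "\<lambda>x. nd (f x)"]
    by (simp add: derivation_simps [OF derivation_nd] sum.distrib)
  ultimately have "Const (1 / 2) * (2 * nd (\<Sum>x\<in>S. f x)) \<in> loc_ideal"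
    using ideal_mult_left [OF _ loc_Const] by metis
  then show ?thesis by (simp add: Const_divide)
qed

section \<open>Walls, on which a single coordinate vanishes\<close>

locale particle_wall = particles +
  fixes i :: nat
  assumes i: "i < N"

sublocale particle_wall \<subseteq> hyperplane N "\<lambda>x. if x = i then w i else 0"
proof
  have "(\<Sum>v<N. (if v = i then w i else 0)\<^sup>2) = (\<Sum>v<N. if v = i then (w i)\<^sup>2 else 0)"
    by (rule sum.cong) auto
  then show "(\<Sum>v<N. (if v = i then w i else 0)\<^sup>2) \<noteq> 0"
    using i w_nz [OF i] by simp
qed

context particle_wall
begin

lemma lin_eq: "lin = u i"
proof -
  have "lin = (\<Sum>v<N. if v = i then u i else 0)"
    unfolding lin_def by (rule sum.cong) (auto simp: u_def)
  with i show ?thesis by simp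
qed

lemma even_A: "A v \<in> even_loc"
proof (cases "v = i")
  case True
  then show ?thesis
    using even_loc.lin2 by (simp add: A_def lin_eq power2_eq_square)
next
  case False
  then have "Var v \<in> even_loc"
    using even_loc.tang [of v] by (cases "v < N") (simp_all add: tang_def nd_Var)
  then show ?thesis
    unfolding A_def u_def by (intro even_power even_loc.mult even_loc.const)
qed

lemma u_loc: "u v \<in> loc"
  unfolding u_def by (intro loc_mult loc_Const loc_Var)

lemma td_u: "v \<noteq> i \<Longrightarrow> td v (u x) = (if x = v then Const (w v) else 0)"
  by (auto simp: u_def derivation_Const_mult [OF derivation_td] td_Var)

lemma unit_A: "v < N \<Longrightarrow> v \<noteq> i \<Longrightarrow> A v \<notin> loc_ideal"
proof -
  assume v: "v < N" "v \<noteq> i"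
  then have "u v \<notin> loc_ideal"
    by (intro unit_td [of v _ "w v"]) (auto simp: td_u w_nz)
  then show ?thesis
    unfolding A_def u_def by (intro unit_power loc_mult loc_Const loc_Var)
qed

lemma unit_A_diff: "(v, v') \<in> pairs \<Longrightarrow> A v - A v' \<notin> loc_ideal"
proof -
  assume p: "(v, v') \<in> pairs"
  have "u v + Const e * u v' \<notin> loc_ideal" if "e \<in> {1, - 1}" for e
  proof (cases "v = i")
    case True
    with p that show ?thesis
      by (intro unit_td [of v' _ "e * w v'"])
        (auto simp: pairs_def td_u derivation_simps [OF derivation_td] w_nz Const_mult)
  next
    case False
    with p that show ?thesis
      by (intro unit_td [of v _ "w v"])
        (auto simp: pairs_def td_u derivation_simps [OF derivation_td] w_nz)
  qed
  note * = this
  show ?thesis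
    unfolding A_diff by (intro unit_mult * loc_add loc_mult loc_Const u_loc) simp_all
qed

lemma regular:
  assumes "set vs \<subseteq> {..<N}" "ord_lt N (Suc (length vs)) ((com LP ^^ k) (ml (P d)))"
  shows "app (coms (map Var vs) ((com LP ^^ k) (ml (P d)))) 1 \<in> loc"
proof (rule symmetric_regular [OF _ _ _ assms])
  let ?R = "Const (1 / 2) * (\<Sum>(v, v')\<in>pairs. G v v') + (\<Sum>v\<in>{..<N} - {i}. B v)"
  show "app LP f = (\<Sum>v<N. rat_deriv v (rat_deriv v f)) +
      (Const (m i / 4 - K / (4 * m i)) / lin\<^sup>2 + ?R) * f" for f
    using i by (simp add: app_LP V_def B_def [of i] A_def [of i] lin_eq sum.remove [of "{..<N}" i] algebra_simps)
  have "G v v' \<in> even_loc" if "(v, v') \<in> pairs" for v v'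
    unfolding G_def divide_inverse using that unit_power [OF _ unit_A_diff, of v v' 2]
    by (intro even_loc.mult even_loc.const even_loc.add even_A even_numeral even_loc.inverse even_power even_diff)
      (auto intro: loc_diff even_imp_loc even_A)
  moreover have "B v \<in> even_loc" if "v < N" "v \<noteq> i" for v
    unfolding B_def divide_inverse using that
    by (intro even_loc.mult even_loc.const even_loc.inverse even_A unit_A)
  ultimately show "?R \<in> even_loc"
    by (intro even_loc.add even_loc.mult even_loc.const even_sum) auto
  show "P d \<in> even_loc"
    unfolding P_def by (intro even_sum even_loc.mult even_loc.const even_power even_A)
qed

end

section \<open>Hyperplanes on which two particles meet up to sign\<close>

locale particle_pair = particles +
  fixes i j :: nat and e :: complex
  assumes ij: "i < N" "j < N" "i \<noteq> j" and e: "e = 1 \<or> e = - 1"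

sublocale particle_pair \<subseteq> hyperplane N "\<lambda>x. if x = i then w i else if x = j then e * w j else 0"
proof
  have "(\<Sum>v<N. (if v = i then w i else if v = j then e * w j else 0)\<^sup>2)
      = (\<Sum>v<N. (if v = i then (w i)\<^sup>2 else 0) + (if v = j then (w j)\<^sup>2 else 0))"
    using ij e by (intro sum.cong) (auto simp: power_mult_distrib)
  also have "\<dots> = (w i)\<^sup>2 + (w j)\<^sup>2"
    using ij by (simp add: sum.distrib)
  finally show "(\<Sum>v<N. (if v = i then w i else if v = j then e * w j else 0)\<^sup>2) \<noteq> 0"
    using mass_sum ij by simp
qed

context particle_pair
begin

lemma nrm_eq: "nrm = m i + m j"
proof -
  have "nrm = (\<Sum>v<N. (if v = i then (w i)\<^sup>2 else 0) + (if v = j then (w j)\<^sup>2 else 0))"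
    unfolding nrm_def using ij e by (intro sum.cong) (auto simp: power_mult_distrib)
  then show ?thesis using ij by (simp add: sum.distrib m_def)
qed

lemma ee [simp]: "e * e = 1" "Const e * Const e = 1" "Const e * (Const e * f) = f"
  using e by (auto simp: Const_minus)

lemma e_nz [simp]: "e \<noteq> 0"
  using e by auto

lemma lin_eq: "lin = u i + Const e * u j"
proof -
  have "lin = (\<Sum>v<N. (if v = i then u i else 0) + (if v = j then Const e * u j else 0))"
    unfolding lin_def using ij by (intro sum.cong) (auto simp: u_def Const_mult)
  then show ?thesis using ij by (simp add: sum.distrib)
qed

definition lin' :: crat where "lin' = u i - Const e * u j"

lemma nd_u: "nd (u i) = Const (m i / nrm)" "nd (u j) = Const (e * m j / nrm)"
  "v \<noteq> i \<Longrightarrow> v \<noteq> j \<Longrightarrow> nd (u v) = 0"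
  unfolding u_def derivation_Const_mult [OF derivation_nd] nd_Var
  using ij by (auto simp: m_def power2_eq_square mult_ac simp flip: Const_mult)

lemma td_u: "v \<noteq> i \<Longrightarrow> v \<noteq> j \<Longrightarrow> td v (u x) = (if x = v then Const (w v) else 0)"
  by (auto simp: u_def derivation_Const_mult [OF derivation_td] td_Var)

lemma td_i: "td i (u i) = Const (w i * m j / nrm)" "td i (u j) = Const (- (e * w i * m j) / nrm)"
proof -
  have "w i * (1 - w i * w i / nrm) = w i * m j / nrm"
    using nrm_nz unfolding nrm_eq by (simp add: m_def field_simps power2_eq_square)
  with ij show "td i (u i) = Const (w i * m j / nrm)"
    by (simp add: u_def derivation_Const_mult [OF derivation_td] td_Var flip: Const_mult)
  show "td i (u j) = Const (- (e * w i * m j) / nrm)"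
    unfolding u_def derivation_Const_mult [OF derivation_td] td_Var
    using ij by (simp add: m_def power2_eq_square mult_ac flip: Const_mult)
qed

lemma u_loc: "u v \<in> loc"
  unfolding u_def by (intro loc_mult loc_Const loc_Var)

lemma A_loc: "A v \<in> loc"
  unfolding A_def by (intro loc_power u_loc)

lemma m_nz': "m i \<noteq> 0" "m j \<noteq> 0"
  using ij m_nz by auto

lemma unit_u: "v < N \<Longrightarrow> u v \<notin> loc_ideal"
proof -
  assume v: "v < N"
  consider "v = i" | "v = j" | "v \<noteq> i" "v \<noteq> j" by blast
  then show ?thesis
  proof cases
    case 1
    then show ?thesis
      using v m_nz' w_nz [of i] by (intro unit_td [of i _ "w i * m j / nrm"]) (auto simp: td_i)
  next
    case 2
    then show ?thesis
      using v m_nz' w_nz [of i] ij by (intro unit_td [of i _ "- (e * w i * m j) / nrm"]) (auto simp: td_i)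
  next
    case 3
    then show ?thesis
      using v w_nz [of v] by (intro unit_td [of v _ "w v"]) (auto simp: td_u)
  qed
qed

lemma unit_lin': "lin' \<notin> loc_ideal"
proof -
  have "td i lin' = Const (2 * w i * m j / nrm)"
  proof -
    have "w i * m j / nrm - e * (- (e * w i * m j) / nrm) = 2 * w i * m j / nrm"
      using ee(1) nrm_nz by (simp add: field_simps)
    then show ?thesis
      unfolding lin'_def derivation_diff [OF derivation_td] derivation_Const_mult [OF derivation_td] td_i
        Const_mult [symmetric] Const_diff [symmetric] by (rule arg_cong)
  qed
  then show ?thesis
    using m_nz' w_nz [of i] ij by (intro unit_td [of i _ "2 * w i * m j / nrm"]) auto
qed

lemma lin'_loc: "lin' \<in> loc"
  unfolding lin'_def by (intro loc_diff loc_mult loc_Const u_loc)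

definition pairs' where "pairs' = pairs - {(i, j), (j, i)}"

lemma finite_pairs' [simp]: "finite pairs'"
  by (simp add: pairs'_def)

lemma unit_A: "v < N \<Longrightarrow> A v \<notin> loc_ideal"
  unfolding A_def by (intro unit_power u_loc unit_u)

lemma unit_A_diff: "(v, v') \<in> pairs' \<Longrightarrow> A v - A v' \<notin> loc_ideal"
proof -
  assume p: "(v, v') \<in> pairs'"
  have "u v + Const s * u v' \<notin> loc_ideal" if "s \<in> {1, - 1}" for s
  proof (cases "v = i \<or> v = j")
    case True
    with p have "v' \<noteq> i" "v' \<noteq> j" "v' \<noteq> v" by (auto simp: pairs'_def pairs_def)
    with p that show ?thesis
      by (intro unit_td [of v' _ "s * w v'"])
        (auto simp: pairs'_def pairs_def td_u derivation_simps [OF derivation_td] w_nz Const_mult)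
  next
    case False
    with p that show ?thesis
      by (intro unit_td [of v _ "w v"])
        (auto simp: pairs'_def pairs_def td_u derivation_simps [OF derivation_td] w_nz)
  qed
  note * = this
  show ?thesis
    unfolding A_diff by (intro unit_mult * loc_add loc_mult loc_Const u_loc) simp_all
qed

text \<open>For equal masses this is the action of the reflection on the squares \<open>A\<close>.
  For distinct masses it only pairs up terms whose normal derivatives cancel on the
  hyperplane.\<close>

definition \<sigma> :: "nat \<Rightarrow> nat" where "\<sigma> v = (if v = i then j else if v = j then i else v)"

lemma \<sigma>_bij: "bij_betw \<sigma> {..<N} {..<N}" "bij_betw (map_prod \<sigma> \<sigma>) pairs' pairs'"
proof -
  have \<sigma>\<sigma>: "\<sigma> (\<sigma> v) = v" for v by (simp add: \<sigma>_def)
  have "\<sigma> v < N" if "v < N" for v using ij that by (simp add: \<sigma>_def)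
  moreover have "map_prod \<sigma> \<sigma> x \<in> pairs'" if "x \<in> pairs'" for x
    using that ij by (auto simp: pairs'_def pairs_def \<sigma>_def split: if_splits)
  ultimately show "bij_betw \<sigma> {..<N} {..<N}" "bij_betw (map_prod \<sigma> \<sigma>) pairs' pairs'"
    by (auto intro!: bij_betw_byWitness [where f' = \<sigma>] bij_betw_byWitness [where f' = "map_prod \<sigma> \<sigma>"]
        simp: \<sigma>\<sigma>)
qed

definition R :: crat where
  "R = Const (1 / 2) * (\<Sum>(v, v')\<in>pairs'. G v v') + (\<Sum>v<N. B v)
    + Const (2 * (M / (m i * m j))) / lin'\<^sup>2"

lemma V_decomp: "V = Const (2 * (M / (m i * m j))) / lin\<^sup>2 + R"
proof -
  have "pairs = insert (i, j) (insert (j, i) pairs')"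
    using ij by (auto simp: pairs'_def pairs_def)
  moreover have "(i, j) \<notin> pairs'" "(j, i) \<notin> pairs'"
    by (simp_all add: pairs'_def)
  ultimately have "(\<Sum>(v, v')\<in>pairs. G v v') = G i j + (G j i + (\<Sum>(v, v')\<in>pairs'. G v v'))"
    using ij by simp
  moreover have "G i j = Const (M / (m i * m j)) * (2 / lin\<^sup>2 + 2 / lin'\<^sup>2)"
  proof -
    have nz: "lin' \<noteq> 0" using unit_lin' ideal_0 by auto
    have minus: "A i - A j = lin * lin'"
      by (simp add: A_def lin_eq lin'_def power2_eq_square algebra_simps)
    have plus: "A i + A j = (lin\<^sup>2 + lin'\<^sup>2) / 2"
      by (simp add: A_def lin_eq lin'_def power2_eq_square field_simps)
    show ?thesis
      unfolding G_def minus plus using nz by (simp add: field_simps power2_eq_square power4_eq_xxxx)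
  qed
  ultimately show ?thesis
    unfolding V_def R_def Const_mult [of 2] G_commute [of j i]
    by (simp add: Const_divide [of 1 2] algebra_simps)
qed

lemma app_LP_decomp: "app LP f = (\<Sum>v<N. rat_deriv v (rat_deriv v f)) +
    (Const (2 * (M / (m i * m j))) / lin\<^sup>2 + R) * f"
  by (simp add: app_LP V_decomp)

text \<open>\<open>G\<close> and \<open>B\<close> see a particle only through its mass and its
  square \<open>A\<close>, so exchanging \<open>i\<close> and \<open>j\<close> is a symmetry. This
  includes particles of two species whose masses happen to agree.\<close>

lemma regular_equal_mass:
  assumes "m i = m j"
    and "set vs \<subseteq> {..<N}" "ord_lt N (Suc (length vs)) ((com LP ^^ k) (ml (P d)))"
  shows "app (coms (map Var vs) ((com LP ^^ k) (ml (P d)))) 1 \<in> loc"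
proof (rule symmetric_regular [OF app_LP_decomp _ _ assms(2,3)])
  have m\<sigma>: "m (\<sigma> v) = m v" for v by (simp add: \<sigma>_def assms(1))
  \<comment> \<open>The normal derivative of \<open>lin'\<close> is
    \<open>(m i - m j) / nrm\<close>; for equal masses \<open>lin'\<close> is therefore a tangential
    coordinate.\<close>
  have lin': "lin' \<in> even_loc"
  proof -
    have "lin' = Const (w i) * tang i - Const (e * w j) * tang j"
    proof -
      have "Const (w i) * tang i - Const (e * w j) * tang j
          = lin' - (nd (u i) - Const e * nd (u j)) * lin"
        unfolding lin'_def tang_def u_def derivation_Const_mult [OF derivation_nd] Const_mult
        by (simp add: algebra_simps)
      then show ?thesis
        by (simp add: nd_u assms(1) flip: Const_mult mult.assoc)
    qed
    then show ?thesis
      by (simp only:) (intro even_diff even_loc.mult even_loc.const even_loc.tang)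
  qed
  \<comment> \<open>\<open>u i\<close> is half of \<open>lin + lin'\<close> and
    \<open>Const e * u j\<close> half of \<open>lin - lin'\<close>; changing the sign of
    \<open>lin\<close> exchanges their squares.\<close>
  have A_ij: "refl (A i) (A j)"
  proof -
    have "Const (1 / 2) * lin' \<in> even_loc" "Const (1 / 4) * (lin * lin + lin' * lin') \<in> even_loc"
      by (intro even_loc.intros lin')+
    moreover have "A i = Const (1 / 4) * (lin * lin + lin' * lin') + lin * (Const (1 / 2) * lin')"
      "A j = Const (1 / 4) * (lin * lin + lin' * lin') - lin * (Const (1 / 2) * lin')"
      by (simp_all add: A_def lin_eq lin'_def power2_eq_square Const_divide field_simps)
    ultimately show ?thesis unfolding refl_def by blast
  qed
  have A: "refl (A v) (A (\<sigma> v))" for v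
  proof -
    consider "v = i" | "v = j" | "v \<noteq> i" "v \<noteq> j" by blast
    then show ?thesis
    proof cases
      case 3
      then have "Var v \<in> even_loc"
        using even_loc.tang [of v] by (cases "v < N") (simp_all add: tang_def nd_Var)
      then have "A v \<in> even_loc"
        unfolding A_def u_def by (intro even_power even_loc.mult even_loc.const)
      with 3 show ?thesis by (simp add: \<sigma>_def refl_even)
    qed (use ij A_ij refl_sym in \<open>auto simp: \<sigma>_def\<close>)
  qed
  have const: "refl (Const c) (Const c)" for c by (intro refl_even even_loc.const)
  have "refl (G v v') (G (\<sigma> v) (\<sigma> v'))" if "(v, v') \<in> pairs'" for v v'
    unfolding G_def m\<sigma> using unit_power [OF _ unit_A_diff [OF that], of 2] const [of 4]
    by (intro refl_mult refl_divide refl_add refl_diff refl_power const A) (auto intro: loc_diff A_loc)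
  then have "(\<Sum>x\<in>pairs'. case x of (v, v') \<Rightarrow> G v v') \<in> even_loc"
    by (intro even_symmetric_sum [OF \<sigma>_bij(2)]) auto
  moreover have "refl (B v) (B (\<sigma> v))" if "v < N" for v
    unfolding B_def m\<sigma> by (intro refl_divide const A unit_A that)
  then have "(\<Sum>v<N. B v) \<in> even_loc"
    by (intro even_symmetric_sum [OF \<sigma>_bij(1)]) auto
  ultimately show "R \<in> even_loc"
    unfolding R_def divide_inverse using unit_power [OF lin'_loc unit_lin', of 2]
    by (intro even_loc.add even_loc.mult even_loc.const even_loc.inverse even_power lin')
  have "refl (Const (1 / m v) * A v ^ d) (Const (1 / m (\<sigma> v)) * A (\<sigma> v) ^ d)" for v
    unfolding m\<sigma> by (intro refl_mult refl_power const A)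
  then show "P d \<in> even_loc"
    unfolding P_def by (intro even_symmetric_sum [OF \<sigma>_bij(1)])
qed

text \<open>Quasi-invariance of the pair: \<open>f\<close> and \<open>g\<close> are the same function of \<open>A i\<close> and of \<open>A j\<close>.\<close>

definition matched :: "crat \<Rightarrow> crat \<Rightarrow> bool" where
  "matched f g \<longleftrightarrow> f \<in> loc \<and> g \<in> loc \<and> f - g \<in> loc_ideal \<and>
     Const (1 / m i) * nd f + Const (1 / m j) * nd g \<in> loc_ideal"

text \<open>The normal derivatives of \<open>u i\<close> and \<open>Const e * u j\<close> are
  proportional to the masses. Division by the masses turns the derivatives of the squares into terms
  whose sum is \<open>2 / nrm\<close> times \<open>lin\<close>; the weights in
  \<open>matched\<close> come from here.\<close>

lemma matched_A: "matched (A i) (A j)"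
  unfolding matched_def
proof (intro conjI A_loc)
  have "A i - A j = lin * lin'"
    by (simp add: A_def lin_eq lin'_def power2_eq_square algebra_simps)
  then show "A i - A j \<in> loc_ideal" by (simp add: ideal_lin lin'_loc)
  have "Const (1 / m i) * nd (A i) + Const (1 / m j) * nd (A j) = lin * Const (2 / nrm)"
    using m_nz' by (simp add: A_def power2_eq_square derivation_mult [OF derivation_nd] nd_u lin_eq Const_simps)
      (simp add: field_simps)
  then show "Const (1 / m i) * nd (A i) + Const (1 / m j) * nd (A j) \<in> loc_ideal"
    by (simp add: ideal_lin loc_Const)
qed

lemma matched_self: "f \<in> loc \<Longrightarrow> nd f \<in> loc_ideal \<Longrightarrow> matched f f"
  unfolding matched_def by (auto intro!: ideal_add ideal_mult_left loc_Const simp: ideal_0)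

lemma matched_Const: "matched (Const c) (Const c)"
  by (intro matched_self loc_Const) (simp add: derivation_Const [OF derivation_nd] ideal_0)

lemma matched_add: "matched f g \<Longrightarrow> matched f' g' \<Longrightarrow> matched (f + f') (g + g')"
proof -
  assume *: "matched f g" "matched f' g'"
  have eq1: "f + f' - (g + g') = (f - g) + (f' - g')" by simp
  have eq2: "Const (1 / m i) * nd (f + f') + Const (1 / m j) * nd (g + g') =
      (Const (1 / m i) * nd f + Const (1 / m j) * nd g) + (Const (1 / m i) * nd f' + Const (1 / m j) * nd g')"
    by (simp add: derivation_add [OF derivation_nd] algebra_simps)
  show ?thesis
    using * unfolding matched_def eq1 eq2 by (blast intro: ideal_add loc_add)
qed

lemma matched_mult: "matched f g \<Longrightarrow> matched f' g' \<Longrightarrow> matched (f * f') (g * g')"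
proof -
  assume *: "matched f g" "matched f' g'"
  then have **: "f \<in> loc" "f' \<in> loc" "g \<in> loc" "g' \<in> loc"
    "Const (1 / m i) * nd f + Const (1 / m j) * nd g \<in> loc_ideal"
    "Const (1 / m i) * nd f' + Const (1 / m j) * nd g' \<in> loc_ideal"
    "f - g \<in> loc_ideal" "f' - g' \<in> loc_ideal"
    by (simp_all add: matched_def)
  have "f * f' - g * g' = (f - g) * f' + g * (f' - g')" by (simp add: algebra_simps)
  then have "f * f' - g * g' \<in> loc_ideal"
    using * ideal_add [OF ideal_mult [of "f - g" f'] ideal_mult_left [of "f' - g'" g]]
    by (simp add: matched_def)
  moreover have "Const (1 / m i) * nd (f * f') + Const (1 / m j) * nd (g * g') =
      (Const (1 / m i) * nd f + Const (1 / m j) * nd g) * f' - Const (1 / m j) * nd g * (f' - g')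
      + (Const (1 / m i) * nd f' + Const (1 / m j) * nd g') * f - Const (1 / m j) * nd g' * (f - g)"
    by (simp add: derivation_mult [OF derivation_nd] algebra_simps)
  then have "Const (1 / m i) * nd (f * f') + Const (1 / m j) * nd (g * g') \<in> loc_ideal"
    by (simp only:) (intro ideal_add ideal_diff ideal_mult [OF **(5)] ideal_mult [OF **(6)]
      ideal_mult_left [OF **(7)] ideal_mult_left [OF **(8)] loc_mult loc_Const loc_nd **(1-4))
  ultimately show ?thesis
    using * by (auto simp: matched_def loc_mult)
qed

lemma matched_diff: "matched f g \<Longrightarrow> matched f' g' \<Longrightarrow> matched (f - f') (g - g')"
  using matched_add [OF _ matched_mult [OF matched_Const [of "- 1"]]] by (simp add: Const_minus)

lemma matched_power: "matched f g \<Longrightarrow> matched (f ^ n) (g ^ n)"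
  by (induction n) (use matched_Const [of 1] in \<open>auto intro: matched_mult\<close>)

lemma matched_inverse:
  assumes "matched f g" "f \<notin> loc_ideal" "g \<notin> loc_ideal"
  shows "matched (inverse f) (inverse g)"
proof -
  have *: "f \<in> loc" "g \<in> loc" "f - g \<in> loc_ideal" "inverse f \<in> loc" "inverse g \<in> loc"
    "Const (1 / m i) * nd f + Const (1 / m j) * nd g \<in> loc_ideal"
    using assms by (auto simp: matched_def loc_inverse)
  have nz: "f \<noteq> 0" "g \<noteq> 0" using assms ideal_0 by auto
  have "inverse f - inverse g = (f - g) * (- (inverse f * inverse g))"
    using nz by (simp add: field_simps)
  then have 1: "inverse f - inverse g \<in> loc_ideal"
    by (simp only:) (intro ideal_mult loc_minus loc_mult *)
  have "Const (1 / m i) * nd (inverse f) + Const (1 / m j) * nd (inverse g) =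
      (Const (1 / m i) * nd f + Const (1 / m j) * nd g) * (- (inverse f * inverse f))
      + Const (1 / m j) * nd g * ((inverse f - inverse g) * (inverse f + inverse g))"
    by (simp add: derivation_inverse [OF derivation_nd] divide_inverse power2_eq_square algebra_simps)
  then have "Const (1 / m i) * nd (inverse f) + Const (1 / m j) * nd (inverse g) \<in> loc_ideal"
    by (simp only:) (intro ideal_add ideal_mult [OF *(6)] ideal_mult_left [OF ideal_mult [OF 1]]
      loc_minus loc_mult loc_add loc_Const loc_nd *)
  with * 1 show ?thesis by (simp add: matched_def)
qed

lemma matched_divide:
  "matched f g \<Longrightarrow> matched f' g' \<Longrightarrow> f' \<notin> loc_ideal \<Longrightarrow> g' \<notin> loc_ideal \<Longrightarrow> matched (f / f') (g / g')"
  by (simp add: divide_inverse matched_mult matched_inverse)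

text \<open>The weights are those of the two terms in \<open>P d\<close> and, up to a common factor,
  those of the couplings of \<open>i\<close> and \<open>j\<close> to a third particle.\<close>

lemma matched_sum: "matched f g \<Longrightarrow> nd (Const (1 / m i) * f + Const (1 / m j) * g) \<in> loc_ideal"
  by (simp add: matched_def derivation_add [OF derivation_nd] derivation_Const_mult [OF derivation_nd])

text \<open>The wall potentials at \<open>x\<^sub>i\<close>, \<open>x\<^sub>j\<close> compensate the potential of the conjugate hyperplane.\<close>

lemma coupling: "m i \<noteq> m j \<Longrightarrow> M / (m i * m j) = - nrm"
proof -
  assume "m i \<noteq> m j"
  then have "M = - ((m i + m j) * (m i * m j))"
    using mass_pair [of i j] ij by (simp add: m_def)
  then show ?thesis using m_nz' by (simp add: nrm_eq)
qed

text \<open>On the hyperplane \<open>y = - x\<close> and \<open>lin' = 2 * x\<close>, so the three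
  inverse cubes in the derivative become multiples of \<open>1 / x ^ 3\<close>, and their sum
  vanishes there precisely if \<open>\<alpha> - \<beta> + \<gamma> / 8 = 0\<close>.\<close>

lemma nd_wall_terms:
  assumes "m i \<noteq> m j"
  shows "nd (B i + B j + Const (2 * (M / (m i * m j))) / lin'\<^sup>2) \<in> loc_ideal"
proof -
  define g where "g = M / (m i * m j)"
  define x where "x = u i"
  define y where "y = Const e * u j"
  define \<alpha> where "\<alpha> = 2 * (m i / 4 - K / (4 * m i)) * m i / nrm"
  define \<beta> where "\<beta> = 2 * (m j / 4 - K / (4 * m j)) * m j / nrm"
  define \<gamma> where "\<gamma> = 4 * g * (m i - m j) / nrm"
  have g: "g = - nrm"
    using coupling [OF assms] by (simp add: g_def)
  have \<gamma>: "\<gamma> = - 4 * (m i - m j)"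
    using nrm_nz by (simp add: \<gamma>_def g)
  \<comment> \<open>\<open>K\<close> is common to both particles and drops out of the difference.
    This is where the relation between the \<open>l\<close> of different species enters.\<close>
  have \<alpha>\<beta>: "\<alpha> - \<beta> = (m i - m j) / 2"
  proof -
    have "\<alpha> - \<beta> = (m i * m i - m j * m j) / (2 * nrm)"
      using m_nz' nrm_nz by (simp add: \<alpha>_def \<beta>_def field_simps)
    also have "m i * m i - m j * m j = (m i - m j) * nrm"
      by (simp add: nrm_eq algebra_simps)
    also have "(m i - m j) * nrm / (2 * nrm) = (m i - m j) / 2"
      by simp
    finally show ?thesis .
  qed
  have unit: "x \<notin> loc_ideal" "y \<notin> loc_ideal" "lin' \<notin> loc_ideal" and loc: "x \<in> loc" "y \<in> loc"
  proof -
    show "y \<notin> loc_ideal"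
      unfolding y_def using ij by (intro unit_mult loc_Const unit_Const unit_u) auto
    show "x \<in> loc" "y \<in> loc" unfolding x_def y_def by (intro loc_mult loc_Const u_loc)+
  qed (simp_all add: x_def unit_u ij unit_lin')
  have nz: "x \<noteq> 0" "y \<noteq> 0" "lin' \<noteq> 0" using unit ideal_0 by auto
  have nd: "nd x = Const (m i / nrm)" "nd y = Const (m j / nrm)" "nd lin' = Const ((m i - m j) / nrm)"
    by (simp_all add: x_def y_def lin'_def nd_u derivation_simps [OF derivation_nd] diff_divide_distrib
        Const_diff flip: Const_mult mult.assoc)
  have AA: "A i = x\<^sup>2" "A j = y\<^sup>2"
    by (simp_all add: A_def x_def y_def power2_eq_square mult_ac)
  have pow: "nd (Const c / z\<^sup>2) = - Const (2 * c * c') / z ^ 3" if "nd z = Const c'" "z \<noteq> 0" for c c' z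
    unfolding derivation_divide [OF derivation_nd] derivation_power [OF derivation_nd]
      derivation_Const [OF derivation_nd]
    using that by (simp add: Const_mult field_simps power2_eq_square power3_eq_cube)
  have "nd (B i + B j + Const (2 * g) / lin'\<^sup>2) =
      - Const \<alpha> / x ^ 3 - Const \<beta> / y ^ 3 - Const \<gamma> / lin' ^ 3"
    unfolding derivation_add [OF derivation_nd] B_def AA pow [OF nd(1) nz(1)] pow [OF nd(2) nz(2)]
      pow [OF nd(3) nz(3)]
    by (simp add: \<alpha>_def \<beta>_def \<gamma>_def mult_ac)
  \<comment> \<open>By the relation between \<alpha>, \<beta> and \<gamma> the values on the
    hyperplane can be subtracted from the inverse cubes free of charge; each bracket is then
    divisible by \<open>lin\<close>.\<close>
  also have "\<dots> = - Const \<beta> * (1 / y ^ 3 + 1 / x ^ 3) - Const \<gamma> * (1 / lin' ^ 3 - 1 / (2 * x) ^ 3)"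
  proof -
    have "\<alpha> = \<beta> - \<gamma> / 8"
    proof -
      have "\<gamma> / 8 = - (\<alpha> - \<beta>)" unfolding \<alpha>\<beta> \<gamma> by (simp add: field_simps)
      then show ?thesis by (simp only:) simp
    qed
    then have *: "Const \<alpha> = Const \<beta> - Const \<gamma> / 8"
      by (simp add: Const_diff Const_divide)
    show ?thesis
      unfolding * by (simp add: power_mult_distrib diff_divide_distrib right_diff_distrib distrib_left)
  qed
  also have "1 / y ^ 3 + 1 / x ^ 3 = lin * ((x\<^sup>2 - x * y + y\<^sup>2) / (x ^ 3 * y ^ 3))"
    using nz by (simp add: lin_eq x_def [symmetric] y_def [symmetric]) (simp add: field_simps power2_eq_square power3_eq_cube)
  also have "1 / lin' ^ 3 - 1 / (2 * x) ^ 3 =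
      lin * (((2 * x)\<^sup>2 + 2 * x * lin' + lin'\<^sup>2) / (lin' ^ 3 * (2 * x) ^ 3))"
  proof -
    have *: "lin = 2 * x - lin'" by (simp add: lin_eq lin'_def x_def)
    show ?thesis
      unfolding * using nz by (simp add: field_simps power2_eq_square power3_eq_cube)
  qed
  finally have "nd (B i + B j + Const (2 * g) / lin'\<^sup>2) =
      - Const \<beta> * (lin * ((x\<^sup>2 - x * y + y\<^sup>2) / (x ^ 3 * y ^ 3)))
      - Const \<gamma> * (lin * (((2 * x)\<^sup>2 + 2 * x * lin' + lin'\<^sup>2) / (lin' ^ 3 * (2 * x) ^ 3)))" .
  also have "\<dots> \<in> loc_ideal"
  proof -
    have "2 * x \<notin> loc_ideal"
      using unit_mult [OF loc_Const [of 2] unit_Const unit(1)] by simp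
    then have "x ^ 3 * y ^ 3 \<notin> loc_ideal" "lin' ^ 3 * (2 * x) ^ 3 \<notin> loc_ideal"
      by (intro unit_mult [OF loc_power unit_power unit_power] loc_mult loc_numeral unit loc lin'_loc; assumption)+
    then show ?thesis
      using loc lin'_loc loc_numeral
      by (intro ideal_diff ideal_mult_left ideal_lin loc_minus loc_Const loc_divide loc_add loc_diff loc_mult loc_power)
  qed
  finally show ?thesis by (simp add: g_def)
qed

lemma regular_distinct_mass:
  assumes "m i \<noteq> m j"
    and "set vs \<subseteq> {..<N}" "ord_lt N (Suc (length vs)) ((com LP ^^ k) (ml (P d)))"
  shows "app (coms (map Var vs) ((com LP ^^ k) (ml (P d)))) 1 \<in> loc"
proof (rule quasi_regular [OF _ _ _ assms(2,3)])
  show "app LP f = (\<Sum>v<N. rat_deriv v (rat_deriv v f)) + (- 2 * Const nrm / lin\<^sup>2 + R) * f" for f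
    unfolding app_LP_decomp coupling [OF assms(1)] by (simp add: Const_mult Const_minus)
  have A_other: "nd (A v) = 0" if "v \<noteq> i" "v \<noteq> j" for v
    using that by (simp add: A_def derivation_power [OF derivation_nd] nd_u)
  have B_other: "nd (B v) = 0" if "v \<noteq> i" "v \<noteq> j" for v
    using that by (simp add: B_def derivation_divide [OF derivation_nd] A_other derivation_Const [OF derivation_nd])
  have G_loc: "G v v' \<in> loc" if "(v, v') \<in> pairs'" for v v'
    unfolding G_def using unit_power [OF _ unit_A_diff [OF that], of 2]
    by (intro loc_mult loc_Const loc_divide loc_add A_loc loc_numeral loc_power loc_diff) (auto intro: loc_diff A_loc)
  have B_loc: "B v \<in> loc" if "v < N" for v
    unfolding B_def by (intro loc_divide loc_Const A_loc unit_A that)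
  \<comment> \<open>\<Phi> is one and the same rational expression in \<open>A x\<close>, and its
    other ingredient \<open>A v\<close> has normal derivative zero; so \<open>\<Phi> i\<close> and
    \<open>\<Phi> j\<close> are matched.\<close>
  have G_ij: "nd (G i v + G j v) \<in> loc_ideal" if "v < N" "v \<noteq> i" "v \<noteq> j" for v
  proof -
    define \<Phi> where "\<Phi> x = 4 * (A x + A v) / (A x - A v)\<^sup>2" for x
    have "matched (A v) (A v)"
      using that by (intro matched_self A_loc) (simp add: A_other ideal_0)
    moreover have "A i - A v \<notin> loc_ideal" "A j - A v \<notin> loc_ideal"
      using that ij by (intro unit_A_diff; simp add: pairs'_def pairs_def)+
    ultimately have "matched (\<Phi> i) (\<Phi> j)"
      unfolding \<Phi>_def using matched_Const [of 4]
      by (intro matched_divide matched_mult matched_power matched_add matched_diff matched_A unit_power loc_diff A_loc) auto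
    then have "nd (Const (1 / m i) * \<Phi> i + Const (1 / m j) * \<Phi> j) \<in> loc_ideal"
      by (rule matched_sum)
    then have "Const (M / m v) * nd (Const (1 / m i) * \<Phi> i + Const (1 / m j) * \<Phi> j) \<in> loc_ideal"
      by (intro ideal_mult_left loc_Const)
    moreover have "G i v + G j v = Const (M / m v) * (Const (1 / m i) * \<Phi> i + Const (1 / m j) * \<Phi> j)"
    proof -
      have "Const (M / (m x * m v)) * f = Const (M / m v) * (Const (1 / m x) * f)" for x f
        unfolding mult.assoc [symmetric] Const_mult [symmetric] by (simp add: mult.commute)
      then show ?thesis
        unfolding G_def \<Phi>_def distrib_left by (simp only:)
    qed
    ultimately show ?thesis
      by (simp add: derivation_Const_mult [OF derivation_nd])
  qed
  have G_pair: "nd (G v v' + G (\<sigma> v) (\<sigma> v')) \<in> loc_ideal" if "(v, v') \<in> pairs'" for v v'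
  proof -
    have *: "v < N" "v' < N" "v \<noteq> v'" "(v, v') \<noteq> (i, j)" "(v, v') \<noteq> (j, i)"
      using that by (auto simp: pairs'_def pairs_def)
    \<comment> \<open>A pair other than the two removed ones has at most one member in common with
      \<open>{i, j}\<close>.\<close>
    consider "v \<in> {i, j}" "v' \<notin> {i, j}" | "v \<notin> {i, j}" "v' \<in> {i, j}" | "v \<notin> {i, j}" "v' \<notin> {i, j}"
      using * by blast
    then show ?thesis
    proof cases
      case 1
      then show ?thesis using G_ij [of v'] * ij by (auto simp: \<sigma>_def add.commute)
    next
      case 2
      then show ?thesis using G_ij [of v] * ij by (auto simp: \<sigma>_def add.commute G_commute [of v])
    next
      case 3
      then have "nd (G v v') = 0"
        by (simp add: G_def derivation_Const_mult [OF derivation_nd] derivation_divide [OF derivation_nd]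
            derivation_simps [OF derivation_nd] derivation_power [OF derivation_nd] A_other)
      with 3 show ?thesis by (simp add: \<sigma>_def derivation_simps [OF derivation_nd] ideal_0)
    qed
  qed
  have "nd (\<Sum>x\<in>pairs'. case x of (v, v') \<Rightarrow> G v v') \<in> loc_ideal"
    by (rule ideal_symmetric_sum [OF \<sigma>_bij(2)]) (use G_pair in auto)
  moreover have "nd ((\<Sum>v<N. B v) + Const (2 * (M / (m i * m j))) / lin'\<^sup>2) \<in> loc_ideal"
  proof -
    have "(\<Sum>v<N. B v) = B i + (B j + (\<Sum>v\<in>{..<N} - {i} - {j}. B v))"
      using ij by (simp add: sum.remove [of "{..<N}" i] sum.remove [of "{..<N} - {i}" j])
    moreover have "nd (\<Sum>v\<in>{..<N} - {i} - {j}. B v) = 0"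
      by (simp add: derivation_sum [OF derivation_nd] B_other)
    ultimately show ?thesis
      using nd_wall_terms [OF assms(1)] by (simp add: derivation_add [OF derivation_nd] add_ac)
  qed
  ultimately have "nd R \<in> loc_ideal"
    unfolding R_def add.assoc derivation_add [OF derivation_nd, of "Const (1 / 2) * _"]
    by (intro ideal_add) (simp_all add: derivation_Const_mult [OF derivation_nd] ideal_mult_left loc_Const)
  moreover have "R \<in> loc"
    unfolding R_def using unit_power [OF lin'_loc unit_lin', of 2] G_loc B_loc
    by (intro loc_add loc_mult loc_Const loc_sum loc_divide loc_power lin'_loc) auto
  ultimately show "R \<in> quasi_loc" by (simp add: quasi_loc_def)
  have P_pair: "nd (Const (1 / m v) * A v ^ d + Const (1 / m (\<sigma> v)) * A (\<sigma> v) ^ d) \<in> loc_ideal" for v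
  proof -
    consider "v = i" | "v = j" | "v \<noteq> i" "v \<noteq> j" by blast
    then show ?thesis
    proof cases
      case 3
      then show ?thesis
        by (simp add: \<sigma>_def derivation_simps [OF derivation_nd] derivation_power [OF derivation_nd] A_other ideal_0)
    qed (use matched_sum [OF matched_power [OF matched_A, of d]] ij in \<open>auto simp: \<sigma>_def add.commute\<close>)
  qed
  have "nd (P d) \<in> loc_ideal"
    unfolding P_def by (rule ideal_symmetric_sum [OF \<sigma>_bij(1)]) (rule P_pair)
  moreover have "P d \<in> loc"
    unfolding P_def by (intro loc_sum loc_mult loc_Const loc_power A_loc)
  ultimately show "P d \<in> quasi_loc" by (simp add: quasi_loc_def)
qed

end

context particles
begin

theorem ad_nilpotent: "(com LP ^^ Suc (2 * d)) (ml (P d)) = 0"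
\<comment> \<open>The number \<open>2d + 2\<close> is at once the strict bound on the order and
  minus the degree \<open>2d - 2 (2d + 1)\<close>.\<close>
proof (rule regular_negative_degree_zero [where N = N and k = "Suc (Suc (2 * d))"])
  let ?F = "(com LP ^^ Suc (2 * d)) (ml (P d))"
  show "Clin ?F" by (intro Clin_com_funpow Clin_LP Clin_intros)
  show "com ?F (ml (Var v)) = 0" if "v \<ge> N" for v
  proof -
    have "com LP (ml (Var v)) = 0"
      using that by (intro endo_eqI)
        (auto simp: app_com app_LP rat_deriv_mult rat_deriv_Var derivation_0 [OF derivation_rat_deriv]
          sum_distrib_left algebra_simps)
    then have "com (ml (Var v)) ?F = 0"
      by (intro com_funpow_commute) (simp_all add: com_swap [of _ LP])
    then show ?thesis by (simp add: com_swap [of _ "ml (Var v)"])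
  qed
  show "com (dop (euler N)) ?F = ml (Const (- of_nat (Suc (Suc (2 * d))))) * ?F"
    using com_euler_power [of "Suc (2 * d)" d] by (simp add: algebra_simps del: funpow.simps)
  show "ord_lt N (Suc (Suc (2 * d))) ?F" by (rule ord_lt_power)
  fix vs assume vs: "set vs \<subseteq> {..<N}" and ord: "ord_lt N (Suc (length vs)) ?F"
  show "app (coms (map Var vs) ?F) 1 \<in> polynomials"
  proof (rule regular_off_polynomial [OF off_operator forms_polynomials])
    show "1 \<in> regular_off forms" using off_Const [of 1] by simp
    fix f assume "f \<in> forms"
    then consider i where "i < N" "f = u i"
      | i j e where "i < N" "j < N" "i \<noteq> j" "e = 1 \<or> e = - 1" "f = u i + Const e * u j"
      by (auto simp: forms_def)
    then show "\<exists>N h. hyperplane N h \<and> f = hyperplane.lin N h \<and> app (coms (map Var vs) ?F) 1 \<in> hyperplane.loc N h"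
    proof cases
      case 1
      then interpret particle_wall N w M K i by unfold_locales
      show ?thesis
        using regular [OF vs ord] 1 lin_eq hyperplane_axioms
        by (intro exI [of _ N] exI [of _ "\<lambda>x. if x = i then w i else 0"]) simp
    next
      case 2
      then interpret particle_pair N w M K i j e by unfold_locales
      show ?thesis
        using regular_equal_mass [OF _ vs ord] regular_distinct_mass [OF _ vs ord] 2 lin_eq hyperplane_axioms
        by (intro exI [of _ N] exI [of _ "\<lambda>x. if x = i then w i else if x = j then e * w j else 0"])
          (cases "m i = m j"; simp)
    qed
  qed
qed

end

section \<open>The operators of the theorem\<close>

lemma sum_lessThan_add:
  "(\<Sum>i<p + q. f i) = (\<Sum>i<p. f i) + (\<Sum>i<q. f (p + i :: nat))" for f :: "nat \<Rightarrow> 'a::comm_monoid_add"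
  by (induction q) (simp_all add: add.assoc)

lemma ad_funpow_app: "(ad (app L) ^^ k) (app X) = app ((com L ^^ k) X)"
proof (induction k)
  case (Suc k)
  have "ad (app L) (app Y) = app (com L Y)" for Y
    by (rule ext) (simp add: ad_def app_com)
  with Suc show ?case by simp
qed simp

lemma mult_op_app: "mult_op g = app (ml g)"
  by (rule ext) (simp add: mult_op_def)

context particles
begin

lemma flows_commute:
  "com ((com LP ^^ (2 * d1)) (ml (P d1))) ((com LP ^^ (2 * d2)) (ml (P d2))) = 0"
proof -
  have "of_nat ((2 * d1 + 2 * d2) choose (2 * d1)) *
      com ((com LP ^^ (2 * d1)) (ml (P d1))) ((com LP ^^ (2 * d2)) (ml (P d2))) = 0" (is "of_nat ?n * ?X = 0")
    by (rule com_ad_nilpotent) (simp_all add: ad_nilpotent del: funpow.simps)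
  then have "of_nat ?n * app ?X f = 0" for f
    by (metis app_of_nat app_simps(1,6))
  moreover have "?n \<noteq> 0" by simp
  ultimately have "app ?X f = 0" for f
    by (metis mult_eq_0_iff of_nat_eq_0_iff)
  then show ?thesis by (intro endo_eqI) simp
qed

lemma P_1: "P 1 = (\<Sum>v<N. (Var v)\<^sup>2)"
proof -
  have "Const (1 / m v) * A v ^ 1 = (Var v)\<^sup>2" if "v < N" for v
  proof -
    have "Const (1 / m v) * (Const (w v))\<^sup>2 = 1"
      using w_nz [OF that] by (simp add: m_def flip: Const_power Const_mult)
    then show ?thesis
      by (simp add: A_def u_def power_mult_distrib flip: mult.assoc)
  qed
  then show ?thesis by (simp add: P_def)
qed

text \<open>The first commutator is four times the Euler operator plus a constant, and homogeneity
  gives \<open>2 * LP\<close> as the commutator of \<open>LP\<close> with the Euler operator. The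
  factor 8 is \<open>2\<^sup>2\<close> times \<open>2!\<close>, the normalisation of
  \<open>Ld\<close> for \<open>d = 1\<close>.\<close>

lemma first_flow: "(com LP ^^ 2) (ml (P 1)) = 8 * LP"
proof -
  have D: "com (dop (rat_deriv v)) (ml (P 1)) = 2 * ml (Var v)" if "v < N" for v
  proof -
    have "rat_deriv v (P 1) = (\<Sum>x<N. if x = v then 2 * Var v else 0)"
      unfolding P_1 derivation_sum [OF derivation_rat_deriv]
      by (rule sum.cong) (auto simp: power2_eq_square rat_deriv_mult rat_deriv_Var)
    with that have "rat_deriv v (P 1) = 2 * Var v" by simp
    then show ?thesis
      using ml_of_nat [of 2] by (simp add: com_dop_ml derivation_rat_deriv ml_simps)
  qed
  have "com LP (ml (P 1)) = (\<Sum>v<N. com (dop (rat_deriv v) * dop (rat_deriv v)) (ml (P 1)))"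
    by (simp add: LP_def com_add_left com_sum_left)
  also have "\<dots> = (\<Sum>v<N. 4 * (ml (Var v) * dop (rat_deriv v)) + 2)"
  proof (rule sum.cong)
    fix v assume "v \<in> {..<N}"
    then have v: "com (dop (rat_deriv v)) (ml (P 1)) = 2 * ml (Var v)" using D by simp
    have "com (dop (rat_deriv v)) (ml (Var v)) = 1"
      by (simp add: com_dop_ml derivation_rat_deriv rat_deriv_Var ml_simps)
    then have "dop (rat_deriv v) * ml (Var v) = ml (Var v) * dop (rat_deriv v) + 1"
      by (simp add: com_def algebra_simps)
    then have "dop (rat_deriv v) * (2 * ml (Var v)) = 2 * (ml (Var v) * dop (rat_deriv v)) + 2"
      by (simp add: mult_2 distrib_left)
    then show "com (dop (rat_deriv v) * dop (rat_deriv v)) (ml (P 1)) = 4 * (ml (Var v) * dop (rat_deriv v)) + 2"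
      unfolding com_mult_left v using distrib_right [of 2 2 "ml (Var v) * dop (rat_deriv v)"]
      by (simp add: mult.assoc)
  qed simp
  also have "\<dots> = 4 * dop (euler N) + of_nat (2 * N)"
  proof (rule endo_eqI)
    fix f
    have num: "app (numeral n) g = numeral n * g" for n g
      using app_of_nat [of "numeral n" g] by simp
    show "app (\<Sum>v<N. 4 * (ml (Var v) * dop (rat_deriv v)) + 2) f = app (4 * dop (euler N) + of_nat (2 * N)) f"
      by (simp add: app_sum num derivation_rat_deriv derivation_euler sum.distrib euler_def sum_distrib_left
          del: of_nat_mult) (simp add: algebra_simps)
  qed
  finally have "com LP (ml (P 1)) = 4 * dop (euler N) + of_nat (2 * N)" .
  moreover have "com LP (of_nat n) = 0" for n
    by (simp add: com_def mult_of_nat_commute)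
  moreover have "com LP (dop (euler N)) = 2 * LP"
    using com_euler_LP by (simp add: com_swap [of LP])
  moreover have "com LP 4 = 0"
    using \<open>\<And>n. com LP (of_nat n) = 0\<close> [of 4] by simp
  ultimately show ?thesis
    by (simp add: numeral_2_eq_2 com_add_right com_mult_right flip: mult.assoc)
qed

lemma u_lincomb_nz:
  assumes "v < N" "v' < N" "v \<noteq> v'"
  shows "u v + Const e * u v' \<noteq> 0"
proof
  assume "u v + Const e * u v' = 0"
  then have "rat_deriv v (u v + Const e * u v') = 0"
    by (simp add: derivation_0 [OF derivation_rat_deriv])
  with assms show False
    by (simp add: u_def rat_deriv_add rat_deriv_mult rat_deriv_Var w_nz)
qed

lemma G_signs:
  assumes "v < N" "v' < N" "v \<noteq> v'"
  shows "G v v' = Const (M / (m v * m v')) * (\<Sum>s\<in>{1, - 1}. 2 / (u v + s * u v')\<^sup>2)"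
proof -
  have nz: "u v + u v' \<noteq> 0" "u v - u v' \<noteq> 0"
    using u_lincomb_nz [OF assms, of 1] u_lincomb_nz [OF assms, of "- 1"] by (simp_all add: Const_minus)
  have "4 * (x\<^sup>2 + y\<^sup>2) / (x\<^sup>2 - y\<^sup>2)\<^sup>2 = 2 / (x + y)\<^sup>2 + 2 / (x - y)\<^sup>2"
    if "x + y \<noteq> 0" "x - y \<noteq> 0" for x y :: crat
  proof -
    have "x\<^sup>2 - y\<^sup>2 = (x + y) * (x - y)" by (simp add: power2_eq_square algebra_simps)
    moreover have "4 * (x\<^sup>2 + y\<^sup>2) = 2 * (x - y)\<^sup>2 + 2 * (x + y)\<^sup>2"
      by (simp add: power2_eq_square algebra_simps)
    ultimately show ?thesis
      using that by (simp only: power_mult_distrib) (simp add: add_divide_distrib)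
  qed
  from this [OF nz] show ?thesis
    by (simp add: G_def A_def one_neq_neg_one)
qed

lemma sum_pairs: "Const (1 / 2) * (\<Sum>(v, v')\<in>pairs. G v v') = (\<Sum>v'<N. \<Sum>v<v'. G v v')"
proof -
  define T where "T = (SIGMA v':{..<N}. {..<v'})"
  have "pairs = T \<union> prod.swap ` T"
    by (auto simp: pairs_def T_def image_iff)
  moreover have "T \<inter> prod.swap ` T = {}" "finite T"
    by (auto simp: T_def)
  moreover have "(\<Sum>(v, v')\<in>prod.swap ` T. G v v') = (\<Sum>(v, v')\<in>T. G v v')"
    by (subst sum.reindex) (auto simp: inj_on_def case_prod_unfold intro!: sum.cong G_commute)
  ultimately have "(\<Sum>(v, v')\<in>pairs. G v v') = 2 * (\<Sum>(v, v')\<in>T. G v v')"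
    by (simp add: sum.union_disjoint)
  also have "(\<Sum>(v, v')\<in>T. G v v') = (\<Sum>v'<N. \<Sum>v<v'. G v v')"
    by (simp add: T_def sum.Sigma G_commute)
  finally show ?thesis by (simp add: Const_divide)
qed

end

text \<open>Squaring disposes of the choice of signs; the wall couplings see only the common
  square.\<close>

locale three_masses =
  fixes n1 n2 n3 :: nat and a b c l1 l2 l3 :: complex
  assumes abc_nz: "a \<noteq> 0" "b \<noteq> 0" "c \<noteq> 0"
    and abc: "a\<^sup>2 + b\<^sup>2 + c\<^sup>2 = 0"
    and l12: "(a\<^sup>2 * (2 * l1 + 1))\<^sup>2 = (b\<^sup>2 * (2 * l2 + 1))\<^sup>2"
    and l13: "(a\<^sup>2 * (2 * l1 + 1))\<^sup>2 = (c\<^sup>2 * (2 * l3 + 1))\<^sup>2"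
begin

definition wt :: "nat \<Rightarrow> complex" where
  "wt v = (if v < n1 then a else if v < n1 + n2 then b else c)"

sublocale particles "n1 + n2 + n3" wt "a\<^sup>2 * b\<^sup>2 * c\<^sup>2" "(a\<^sup>2 * (2 * l1 + 1))\<^sup>2"
proof
  \<comment> \<open>Every sum of two masses is minus the third: nonzero, and times the product of
    the two it is minus the product of all three.\<close>
  have sums: "a\<^sup>2 + b\<^sup>2 = - c\<^sup>2" "b\<^sup>2 + a\<^sup>2 = - c\<^sup>2" "a\<^sup>2 + c\<^sup>2 = - b\<^sup>2" "c\<^sup>2 + a\<^sup>2 = - b\<^sup>2"
    "b\<^sup>2 + c\<^sup>2 = - a\<^sup>2" "c\<^sup>2 + b\<^sup>2 = - a\<^sup>2"
    using abc by algebra+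
  show "wt v \<noteq> 0" for v
    using abc_nz by (simp add: wt_def)
  show "(wt v)\<^sup>2 + (wt v')\<^sup>2 \<noteq> 0" for v v'
    using abc_nz by (auto simp: wt_def sums)
  show "((wt v)\<^sup>2 + (wt v')\<^sup>2) * ((wt v)\<^sup>2 * (wt v')\<^sup>2) = - (a\<^sup>2 * b\<^sup>2 * c\<^sup>2)"
    if "(wt v)\<^sup>2 \<noteq> (wt v')\<^sup>2" for v v'
    using that by (auto simp: wt_def sums split: if_splits)
qed

lemma wall: "K = (p\<^sup>2 * (2 * l + 1))\<^sup>2 \<Longrightarrow> p \<noteq> 0 \<Longrightarrow> p\<^sup>2 / 4 - K / (4 * p\<^sup>2) = - (p\<^sup>2 * (l * (l + 1)))"
  for K p l :: complex
  by (simp add: field_simps power2_eq_square)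

lemma wall_term:
  "K = (p\<^sup>2 * (2 * l + 1))\<^sup>2 \<Longrightarrow> p \<noteq> 0 \<Longrightarrow>
    Const (p\<^sup>2 / 4 - K / (4 * p\<^sup>2)) / (Const p * x)\<^sup>2 = - (Const (l * (l + 1)) / x\<^sup>2)"
  by (drule (1) wall) (simp add: Const_simps power_mult_distrib)

lemma pair_term:
  "p \<noteq> 0 \<Longrightarrow> Const (z / (p\<^sup>2 * p\<^sup>2)) * (\<Sum>s\<in>{1, - 1}. 2 / (Const p * x + s * (Const p * y))\<^sup>2) =
    Const (z / p\<^sup>2 / p ^ 4) * (\<Sum>s\<in>{1, - 1}. 2 / (x + s * y)\<^sup>2)"
proof -
  assume p: "p \<noteq> 0"
  have "2 / (Const p * x + s * (Const p * y))\<^sup>2 = Const (1 / p\<^sup>2) * (2 / (x + s * y)\<^sup>2)" for s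
  proof -
    have "Const p * x + s * (Const p * y) = Const p * (x + s * y)" by (simp add: algebra_simps)
    then show ?thesis by (simp add: power_mult_distrib Const_divide Const_power)
  qed
  moreover have "z / (p\<^sup>2 * p\<^sup>2) * (1 / p\<^sup>2) = z / p\<^sup>2 / p ^ 4"
    by (simp add: power2_eq_square power4_eq_xxxx mult.assoc)
  ultimately show ?thesis
    by (simp only: sum_distrib_left [symmetric] mult.assoc [symmetric] Const_mult [symmetric])
qed

lemma app_LP_eq_LA: "app LP = LA n1 n2 n3 a b c l1 l2 l3"
proof
  fix f
  note blocks = sum_lessThan_add [of _ "n1 + n2" n3] sum_lessThan_add [of _ n1 n2]
  have wt: "i < n1 \<Longrightarrow> wt i = a" "i < n2 \<Longrightarrow> wt (n1 + i) = b" "wt (n1 + n2 + i) = c" for i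
    by (simp_all add: wt_def)
  have lap: "(\<Sum>v<n1 + n2 + n3. rat_deriv v (rat_deriv v f)) =
      laplacian {..<n1} f + laplacian {n1..<n1 + n2} f + laplacian {n1 + n2..<n1 + n2 + n3} f"
  proof -
    have "(\<Sum>v\<in>{p..<p + q}. g v) = (\<Sum>i<q. g (p + i))" for p q and g :: "nat \<Rightarrow> crat"
      using sum.shift_bounds_nat_ivl [of g 0 p q] by (simp add: atLeast0LessThan add.commute)
    then show ?thesis
      by (simp add: laplacian_def blocks)
  qed
  have B: "(\<Sum>v<n1 + n2 + n3. B v) = - (\<Sum>i<n1. Const (l1 * (l1 + 1)) / (Var i)\<^sup>2)
      - (\<Sum>i<n2. Const (l2 * (l2 + 1)) / (Var (n1 + i))\<^sup>2)
      - (\<Sum>i<n3. Const (l3 * (l3 + 1)) / (Var (n1 + n2 + i))\<^sup>2)"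
  proof -
    have "B i = - (Const (l1 * (l1 + 1)) / (Var i)\<^sup>2)" if "i < n1" for i
      unfolding B_def m_def A_def u_def wt(1) [OF that]
      by (rule wall_term [OF refl abc_nz(1)])
    moreover have "B (n1 + i) = - (Const (l2 * (l2 + 1)) / (Var (n1 + i))\<^sup>2)" if "i < n2" for i
      unfolding B_def m_def A_def u_def wt(2) [OF that]
      by (rule wall_term [OF l12 abc_nz(2)])
    moreover have "B (n1 + n2 + i) = - (Const (l3 * (l3 + 1)) / (Var (n1 + n2 + i))\<^sup>2)" for i
      unfolding B_def m_def A_def u_def wt(3)
      by (rule wall_term [OF l13 abc_nz(3)])
    ultimately show ?thesis
      by (simp add: blocks sum_negf)
  qed
  define S where "S x y = (\<Sum>s\<in>{1, - 1}. 2 / (x + s * y)\<^sup>2)" for x y :: crat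
  have G: "G v v' = Const (a\<^sup>2 * b\<^sup>2 * c\<^sup>2 / ((wt v)\<^sup>2 * (wt v')\<^sup>2)) * S (Const (wt v) * Var v) (Const (wt v') * Var v')"
    if "v < n1 + n2 + n3" "v' < n1 + n2 + n3" "v \<noteq> v'" for v v'
    using G_signs [OF that] by (simp only: S_def u_def m_def)
  have S: "Const (z / (p\<^sup>2 * p\<^sup>2)) * S (Const p * x) (Const p * y) = Const (z / p\<^sup>2 / p ^ 4) * S x y"
    if "p \<noteq> 0" for p z x y
    unfolding S_def by (rule pair_term [OF that])
  have G11: "G i j = Const (b\<^sup>2 * c\<^sup>2 / a ^ 4) * S (Var i) (Var j)" if "i < j" "j < n1" for i j
    using that abc_nz G [of i j] S [of a "a\<^sup>2 * b\<^sup>2 * c\<^sup>2"] by (simp add: wt)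
  have G22: "G (n1 + i) (n1 + j) = Const (a\<^sup>2 * c\<^sup>2 / b ^ 4) * S (Var (n1 + i)) (Var (n1 + j))"
    if "i < j" "j < n2" for i j
    using that abc_nz G [of "n1 + i" "n1 + j"] S [of b "a\<^sup>2 * b\<^sup>2 * c\<^sup>2"] by (simp add: wt)
  have G33: "G (n1 + n2 + i) (n1 + n2 + j) = Const (a\<^sup>2 * b\<^sup>2 / c ^ 4) * S (Var (n1 + n2 + i)) (Var (n1 + n2 + j))"
    if "i < j" "j < n3" for i j
    using that abc_nz G [of "n1 + n2 + i" "n1 + n2 + j"] S [of c "a\<^sup>2 * b\<^sup>2 * c\<^sup>2"] by (simp add: wt)
  have G12: "G i (n1 + j) = Const (c\<^sup>2) * S (Const a * Var i) (Const b * Var (n1 + j))" if "i < n1" "j < n2" for i j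
    using that abc_nz G [of i "n1 + j"] by (simp add: wt)
  have G13: "G i (n1 + n2 + j) = Const (b\<^sup>2) * S (Const a * Var i) (Const c * Var (n1 + n2 + j))" if "i < n1" "j < n3" for i j
    using that abc_nz G [of i "n1 + n2 + j"] by (simp add: wt)
  have G23: "G (n1 + i) (n1 + n2 + j) = Const (a\<^sup>2) * S (Const b * Var (n1 + i)) (Const c * Var (n1 + n2 + j))"
    if "i < n2" "j < n3" for i j
    using that abc_nz G [of "n1 + i" "n1 + n2 + j"] by (simp add: wt)
  have GG: "(\<Sum>v'<n1 + n2 + n3. \<Sum>v<v'. G v v') =
      Const (b\<^sup>2 * c\<^sup>2 / a ^ 4) * (\<Sum>j<n1. \<Sum>i<j. S (Var i) (Var j))
    + (Const (c\<^sup>2) * (\<Sum>i<n1. \<Sum>j<n2. S (Const a * Var i) (Const b * Var (n1 + j)))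
    + Const (a\<^sup>2 * c\<^sup>2 / b ^ 4) * (\<Sum>j<n2. \<Sum>i<j. S (Var (n1 + i)) (Var (n1 + j))))
    + (Const (b\<^sup>2) * (\<Sum>i<n1. \<Sum>j<n3. S (Const a * Var i) (Const c * Var (n1 + n2 + j)))
    + Const (a\<^sup>2) * (\<Sum>i<n2. \<Sum>j<n3. S (Const b * Var (n1 + i)) (Const c * Var (n1 + n2 + j)))
    + Const (a\<^sup>2 * b\<^sup>2 / c ^ 4) * (\<Sum>j<n3. \<Sum>i<j. S (Var (n1 + n2 + i)) (Var (n1 + n2 + j))))"
  proof -
    \<comment> \<open>A pair of different species is listed at its later member; splitting the inner
      range separates it from the pairs within one species.\<close>
    have "(\<Sum>j<n2. \<Sum>v<n1 + j. G v (n1 + j)) =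
        (\<Sum>i<n1. \<Sum>j<n2. G i (n1 + j)) + (\<Sum>j<n2. \<Sum>i<j. G (n1 + i) (n1 + j))"
      by (simp add: sum_lessThan_add sum.distrib sum.swap [of _ "{..<n1}"])
    moreover have "(\<Sum>j<n3. \<Sum>v<n1 + n2 + j. G v (n1 + n2 + j)) =
        (\<Sum>i<n1. \<Sum>j<n3. G i (n1 + n2 + j)) + (\<Sum>i<n2. \<Sum>j<n3. G (n1 + i) (n1 + n2 + j))
        + (\<Sum>j<n3. \<Sum>i<j. G (n1 + n2 + i) (n1 + n2 + j))"
      by (simp add: sum_lessThan_add sum.distrib sum.swap [of _ "{..<n1}"] sum.swap [of _ "{..<n2}"])
    ultimately show ?thesis
      unfolding blocks by (simp add: G11 G22 G33 G12 G13 G23 sum_distrib_left cong: sum.cong_simp)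
  qed
  \<comment> \<open>\<open>LA\<close> places the potential between two species in the line of the
    third one, so \<open>g23\<close>, \<open>g13\<close> and \<open>g12\<close> go with the first,
    second and third Laplacian.\<close>
  have regroup: "y1 + y2 + y3 + (g1 + (g12 + g2) + (g13 + g23 + g3) + (- s1 - s2 - s3)) * f =
      y1 + (g1 - s1 + g23) * f + y2 + (g2 - s2 + g13) * f + y3 + (g3 - s3 + g12) * f"
    for y1 y2 y3 g1 g2 g3 g12 g13 g23 s1 s2 s3 :: crat
    by (simp add: algebra_simps)
  show "app LP f = LA n1 n2 n3 a b c l1 l2 l3 f"
    unfolding app_LP V_def sum_pairs lap B GG LA_def Let_def S_def mult.assoc [of _ "Const _"]
    by (rule regroup)
qed

lemma P_eq_p_poly:
  assumes "d \<ge> 1"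
  shows "P d = p_poly n1 n2 n3 a b c d"
proof -
  have *: "Const (1 / p\<^sup>2) * ((Const p * x)\<^sup>2) ^ d = Const (p ^ (2 * d - 2)) * x ^ (2 * d)" if "p \<noteq> 0" for p x
  proof -
    have "2 * d = 2 * d - 2 + 2" using assms by simp
    then have "p ^ (2 * d) = p ^ (2 * d - 2) * p\<^sup>2" by (metis power_add)
    with that have "1 / p\<^sup>2 * p ^ (2 * d) = p ^ (2 * d - 2)" by simp
    then have "Const (1 / p\<^sup>2) * Const p ^ (2 * d) = Const (p ^ (2 * d - 2))"
      by (simp flip: Const_power Const_mult)
    then show ?thesis
      by (simp add: power_mult_distrib power_mult [symmetric] flip: mult.assoc)
  qed
  show ?thesis
    using abc_nz
    by (simp add: P_def p_poly_def sum_lessThan_add m_def A_def u_def wt_def * sum_distrib_left)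
qed

lemma Ld_app:
  assumes "d \<ge> 1"
  shows "Ld n1 n2 n3 a b c l1 l2 l3 d f =
    Const (1 / (2 ^ (2 * d) * fact (2 * d))) * app ((com LP ^^ (2 * d)) (ml (P d))) f"
  unfolding Ld_def mult_op_app P_eq_p_poly [OF assms, symmetric] app_LP_eq_LA [symmetric] ad_funpow_app ..

lemma Ld_commute:
  assumes "d1 \<ge> 1" "d2 \<ge> 1"
  shows "ad (Ld n1 n2 n3 a b c l1 l2 l3 d1) (Ld n1 n2 n3 a b c l1 l2 l3 d2) f = 0"
proof -
  have Clin: "Clin ((com LP ^^ k) (ml g))" for k g
    by (intro Clin_com_funpow Clin_LP Clin_intros)
  have "app ((com LP ^^ (2 * d1)) (ml (P d1))) (app ((com LP ^^ (2 * d2)) (ml (P d2))) f) =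
      app ((com LP ^^ (2 * d2)) (ml (P d2))) (app ((com LP ^^ (2 * d1)) (ml (P d1))) f)"
    using arg_cong [OF flows_commute [of d1 d2], of "\<lambda>X. app X f"] by (simp add: app_com)
  then show ?thesis
    by (simp add: ad_def Ld_app [OF assms(1)] Ld_app [OF assms(2)] Clin_app [OF Clin] mult.left_commute)
qed

lemma Ld_1: "Ld n1 n2 n3 a b c l1 l2 l3 1 f = LA n1 n2 n3 a b c l1 l2 l3 f"
proof -
  have "(2::complex) ^ (2 * 1) * fact (2 * 1) = of_nat 8"
    by (simp add: fact_numeral)
  then have "Ld n1 n2 n3 a b c l1 l2 l3 1 f = Const (1 / of_nat 8) * app (of_nat 8 * LP) f"
    unfolding Ld_app [OF order_refl] using first_flow by simp
  then show ?thesis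
    unfolding app_simps app_of_nat app_LP_eq_LA by (simp add: Const_divide)
qed

end

theorem proposition6p10:
  fixes n1 n2 n3 :: nat and a b c l1 l2 l3 :: complex
  assumes "a \<noteq> 0" and "b \<noteq> 0" and "c \<noteq> 0"
    and "a\<^sup>2 + b\<^sup>2 + c\<^sup>2 = 0"
    and "\<exists>s\<in>{1, -1}. a\<^sup>2 * (2 * l1 + 1) = s * (b\<^sup>2 * (2 * l2 + 1))"
    and "\<exists>s\<in>{1, -1}. a\<^sup>2 * (2 * l1 + 1) = s * (c\<^sup>2 * (2 * l3 + 1))"
  shows "(\<forall>d1\<ge>1. \<forall>d2\<ge>1. \<forall>f \<in> rat_functions (n1 + n2 + n3).
            ad (Ld n1 n2 n3 a b c l1 l2 l3 d1) (Ld n1 n2 n3 a b c l1 l2 l3 d2) f = 0)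
       \<and> (\<forall>f \<in> rat_functions (n1 + n2 + n3).
            Ld n1 n2 n3 a b c l1 l2 l3 1 f = LA n1 n2 n3 a b c l1 l2 l3 f)"
proof -
  have "(a\<^sup>2 * (2 * l1 + 1))\<^sup>2 = (b\<^sup>2 * (2 * l2 + 1))\<^sup>2"
    using assms(5) by auto
  moreover have "(a\<^sup>2 * (2 * l1 + 1))\<^sup>2 = (c\<^sup>2 * (2 * l3 + 1))\<^sup>2"
    using assms(6) by auto
  ultimately interpret three_masses n1 n2 n3 a b c l1 l2 l3
    using assms(1-4) by unfold_locales
  show ?thesis
    using Ld_commute Ld_1 by blast
qed

end
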